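(* Let $b$ be a prime, $m\in\mathbb{N}$, $N=b^m$, $s\in\mathbb{N}$, $\alpha>1$. Let $(\gamma_j)_{j\ge1}$ be a non-increasing sequence of positive reals and let $\gamma_{\mathfrak{u}}=\prod_{j\in\mathfrak{u}}\gamma_j$ be the corresponding product weights. Let $0\le w_1\le w_2\le\cdots$ be integers and $Y_j=x^{w_j}\in\mathbb{F}_b[x]$. Let $\boldsymbol{g}=(Y_1g_1,\ldots,Y_sg_s)$ be constructed by the reduced successive coordinate search (SCS) algorithm for polynomial lattice rules with modulus $x^m$ (defined in the context) from some starting vector $\boldsymbol{g}^0\in\{g\in\mathbb{F}_b[x]:\deg(g)<m\}^s$. Then for all $\delta\in(0,\frac{\alpha-1}{2}]$, $$e_{N,s}(\boldsymbol{g})\le C_{s,\alpha,\boldsymbol{\gamma},\delta}\,N^{-\alpha/2+\delta},$$ where $$C_{s,\alpha,\boldsymbol{\gamma},\delta}:=\left(\left(\sum_{d=1}^s\gamma_d^{\frac{1}{\alpha-2\delta}}b^{w_d}\right)\left(2\mu_b\left(\tfrac{\alpha}{\alpha-2\delta}\right)\right)\prod_{d=1}^{s-1}\left(1+\gamma_d^{\frac{1}{\alpha-2\delta}}\,\mu_b\left(\tfrac{\alpha}{\alpha-2\delta}\right)\right)\right)^{\alpha/2-\delta}.$$ Furthermore, the constant $C_{s,\alpha,\boldsymbol{\gamma},\delta}$ is bounded independently of the dimension $s$ if $$\sum_{d=1}^\infty\gamma_d^{\frac{1}{\alpha-2\delta}}\,b^{w_d}<\infty.$$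
   Context: Notation: $[s]=\{1,\ldots,s\}$; for a vector $\boldsymbol{x}$ and $\mathfrak{u}\subseteq[s]$, $\boldsymbol{x}_{\mathfrak{u}}=(x_j)_{j\in\mathfrak{u}}$; $\mathbb{F}_b$ is the field with $b$ elements, identified with $\{0,\ldots,b-1\}$. For $h\in\mathbb{N}$, $\psi_b(h)=\lfloor\log_b h\rfloor$ and $r_\alpha(h)=b^{-\alpha\psi_b(h)}$; for vectors $r_\alpha(\boldsymbol{h})=\prod_j r_\alpha(h_j)$. For $\beta>1$, $\mu_b(\beta)=\sum_{h=1}^\infty r_\beta(h)=\frac{b^\beta(b-1)}{b^\beta-b}$. Walsh functions: for $h=h_0+h_1b+\cdots+h_ab^a$ (base-$b$ digits) and $x=\frac{x_1}{b}+\frac{x_2}{b^2}+\cdots\in[0,1)$ (with infinitely many digits $x_i\neq b-1$), $\mathrm{wal}_h(x)=\mathrm{e}^{2\pi\mathrm{i}(x_1h_0+\cdots+x_{a+1}h_a)/b}$; $\mathrm{wal}_{\boldsymbol{h}}(\boldsymbol{x})=\prod_j\mathrm{wal}_{h_j}(x_j)$. Weighted Walsh space: $\mathcal{H}(K^{\mathrm{wal}}_{s,\alpha,\boldsymbol{\gamma}})$ is the reproducing kernel Hilbert space with kernel $$K^{\mathrm{wal}}_{s,\alpha,\boldsymbol{\gamma}}(\boldsymbol{x},\boldsymbol{y})=1+\sum_{\emptyset\ne\mathfrak{u}\subseteq[s]}\gamma_{\mathfrak{u}}\sum_{\boldsymbol{h}_{\mathfrak{u}}\in\mathbb{N}^{|\mathfrak{u}|}}r_\alpha(\boldsymbol{h}_{\mathfrak{u}})\,\mathrm{wal}_{\boldsymbol{h}_{\mathfrak{u}}}(\boldsymbol{x}_{\mathfrak{u}})\,\overline{\mathrm{wal}_{\boldsymbol{h}_{\mathfrak{u}}}(\boldsymbol{y}_{\mathfrak{u}})}.$$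 Polynomial lattice rule with modulus $x^m$: for $v\in\mathbb{F}_b[x]$ with $v\equiv a_0+a_1x+\cdots+a_{m-1}x^{m-1}\pmod{x^m}$ put $\nu(v/x^m)=\frac{a_{m-1}}{b}+\cdots+\frac{a_1}{b^{m-1}}+\frac{a_0}{b^m}\in[0,1)$. For $\boldsymbol{g}=(g_1,\ldots,g_s)\in(\mathbb{F}_b[x])^s$ the node set consists of the $b^m$ points $\boldsymbol{x}_n=(\nu(ng_1/x^m),\ldots,\nu(ng_s/x^m))$, $n\in\mathbb{F}_b[x]$, $\deg(n)<m$. Worst-case error: $e_{N,s}(\boldsymbol{g})$ is the supremum of the absolute integration error $\left|\int_{[0,1]^s}f-\frac1{b^m}\sum_nf(\boldsymbol{x}_n)\right|$ over the unit ball of $\mathcal{H}(K^{\mathrm{wal}}_{s,\alpha,\boldsymbol{\gamma}})$. It is known that $$e_{N,s}^2(\boldsymbol{g})=\sum_{\emptyset\ne\mathfrak{u}\subseteq[s]}\gamma_{\mathfrak{u}}\sum_{\boldsymbol{h}_{\mathfrak{u}}\in\mathcal{D}_{\mathfrak{u}}}\prod_{j\in\mathfrak{u}}b^{-\alpha\psi_b(h_j)},\qquad \mathcal{D}_{\mathfrak{u}}=\Big\{\boldsymbol{h}_{\mathfrak{u}}\in\mathbb{N}^{|\mathfrak{u}|}:\sum_{j\in\mathfrak{u}}\mathrm{tr}_m(h_j)g_j\equiv0\ (\mathrm{mod}\ x^m)\Big\},$$ where $\mathrm{tr}_m(h)=h_0+h_1x+\cdots+h_{m-1}x^{m-1}\in\mathbb{F}_b[x]$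 for $h=\sum_ih_ib^i$. Search spaces: $\mathcal{G}_{N,w_j}=\{g\in\mathbb{F}_b[x]:0\le\deg(g)<m-w_j,\ \gcd(g,x^m)=1\}$ if $w_j<m$, and $\mathcal{G}_{N,w_j}=\{1\}$ if $w_j\ge m$. Reduced SCS algorithm: given $\boldsymbol{g}^0=(g_1^0,\ldots,g_s^0)$, for $d=1,\ldots,s$ successively, with $g_1,\ldots,g_{d-1}$ already selected, choose $g_d\in\mathcal{G}_{N,w_d}$ such that $e_{N,s}^2((Y_1g_1,\ldots,Y_{d-1}g_{d-1},Y_dg_d,g_{d+1}^0,\ldots,g_s^0))$ is minimized as a function of $g_d$ over $\mathcal{G}_{N,w_d}$. The output is $\boldsymbol{g}=(Y_1g_1,\ldots,Y_sg_s)$. *)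

theory Defs
  imports "HOL-Analysis.Analysis" "Berlekamp_Zassenhaus.Finite_Field"
begin

section \<open>Reproducing kernel Hilbert spaces\<close>

text \<open>
  \<open>H\<close> is a complex Hilbert space of functions on the set \<open>X\<close>, with inner product \<open>ip\<close> (linear in the
  first argument) and reproducing kernel \<open>K\<close>. A function on \<open>X\<close> is an element of
  \<open>extensional X\<close>; values of \<open>ip\<close> outside \<open>H\<close> are irrelevant.
\<close>

locale rkhs =
  fixes X :: "'a set"
    and K :: "'a \<Rightarrow> 'a \<Rightarrow> complex"
    and H :: "('a \<Rightarrow> complex) set"
    and ip :: "('a \<Rightarrow> complex) \<Rightarrow> ('a \<Rightarrow> complex) \<Rightarrow> complex"
  assumes carrier: "H \<subseteq> extensional X"
    and zero_mem: "(\<lambda>x\<in>X. 0) \<in> H"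
    and add_mem: "f \<in> H \<Longrightarrow> g \<in> H \<Longrightarrow> (\<lambda>x\<in>X. f x + g x) \<in> H"
    and scale_mem: "f \<in> H \<Longrightarrow> (\<lambda>x\<in>X. c * f x) \<in> H"
    and ip_add: "f \<in> H \<Longrightarrow> g \<in> H \<Longrightarrow> h \<in> H \<Longrightarrow> ip (\<lambda>x\<in>X. f x + g x) h = ip f h + ip g h"
    and ip_scale: "f \<in> H \<Longrightarrow> h \<in> H \<Longrightarrow> ip (\<lambda>x\<in>X. c * f x) h = c * ip f h"
    and ip_cnj: "f \<in> H \<Longrightarrow> g \<in> H \<Longrightarrow> ip g f = cnj (ip f g)"
    and ip_nonneg: "f \<in> H \<Longrightarrow> 0 \<le> Re (ip f f)"
    and ip_definite: "f \<in> H \<Longrightarrow> ip f f = 0 \<Longrightarrow> f = (\<lambda>x\<in>X. 0)"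
    and Cauchy_convergent:
      "(\<And>n. F n \<in> H) \<Longrightarrow>
       (\<And>\<epsilon>. 0 < \<epsilon> \<Longrightarrow> \<exists>n0. \<forall>k\<ge>n0. \<forall>n\<ge>n0.
          sqrt (Re (ip (\<lambda>x\<in>X. F k x - F n x) (\<lambda>x\<in>X. F k x - F n x))) < \<epsilon>) \<Longrightarrow>
       \<exists>f\<in>H. (\<lambda>n. sqrt (Re (ip (\<lambda>x\<in>X. F n x - f x) (\<lambda>x\<in>X. F n x - f x)))) \<longlonglongrightarrow> 0"
    and kernel_mem: "y \<in> X \<Longrightarrow> (\<lambda>x\<in>X. K x y) \<in> H"
    and reproducing: "f \<in> H \<Longrightarrow> y \<in> X \<Longrightarrow> f y = ip f (\<lambda>x\<in>X. K x y)"

text \<open>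
  By the Moore--Aronszajn theorem a positive semidefinite kernel \<open>K\<close> on \<open>X\<close> has exactly one reproducing
  kernel Hilbert space, so the existential quantifier refers to that space and its norm.
\<close>

definition rkhs_unit_ball :: "'a set \<Rightarrow> ('a \<Rightarrow> 'a \<Rightarrow> complex) \<Rightarrow> ('a \<Rightarrow> complex) set" where
  "rkhs_unit_ball X K = {f. \<exists>H ip. rkhs X K H ip \<and> f \<in> H \<and> sqrt (Re (ip f f)) \<le> 1}"


section \<open>Walsh functions and the weighted Walsh space\<close>

definition psi :: "nat \<Rightarrow> nat \<Rightarrow> int" where
  "psi b h = \<lfloor>log (real b) (real h)\<rfloor>"

definition r_decay :: "nat \<Rightarrow> real \<Rightarrow> nat \<Rightarrow> real" where
  "r_decay b \<alpha> h = real b powr (- \<alpha> * real_of_int (psi b h))"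

definition mu :: "nat \<Rightarrow> real \<Rightarrow> real" where
  "mu b \<beta> = (\<Sum>h. r_decay b \<beta> (Suc h))"

text \<open>
  \<open>base_digit b h i\<close> is the coefficient of \<open>b ^ i\<close> in \<open>h\<close>. For \<open>x \<in> [0,1)\<close>, \<open>frac_digit b x i\<close> is the
  coefficient of \<open>1 / b ^ i\<close> (\<open>i \<ge> 1\<close>) in the expansion of \<open>x\<close> having infinitely many digits
  different from \<open>b - 1\<close>.
\<close>

definition base_digit :: "nat \<Rightarrow> nat \<Rightarrow> nat \<Rightarrow> nat" where
  "base_digit b h i = h div b ^ i mod b"

definition frac_digit :: "nat \<Rightarrow> real \<Rightarrow> nat \<Rightarrow> int" where
  "frac_digit b x i = \<lfloor>x * real b ^ i\<rfloor> mod int b"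

definition wal :: "nat \<Rightarrow> nat \<Rightarrow> real \<Rightarrow> complex" where
  "wal b h x =
     exp (2 * of_real pi * \<i> *
       of_int (\<Sum>i\<le>nat (psi b h). frac_digit b x (Suc i) * int (base_digit b h i)) / of_nat b)"

definition unit_cube :: "nat \<Rightarrow> (nat \<Rightarrow> real) set" where
  "unit_cube s = {1..s} \<rightarrow>\<^sub>E {0..<1}"

definition walsh_kernel ::
  "nat \<Rightarrow> nat \<Rightarrow> real \<Rightarrow> (nat set \<Rightarrow> real) \<Rightarrow> (nat \<Rightarrow> real) \<Rightarrow> (nat \<Rightarrow> real) \<Rightarrow> complex" where
  "walsh_kernel b s \<alpha> \<gamma> x y =
     1 + (\<Sum>u\<in>Pow {1..s} - {{}}. of_real (\<gamma> u) *
            (\<Sum>\<^sub>\<infinity>h\<in>u \<rightarrow>\<^sub>E {1..}. of_real (\<Prod>j\<in>u. r_decay b \<alpha> (h j)) *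
               (\<Prod>j\<in>u. wal b (h j) (x j)) * cnj (\<Prod>j\<in>u. wal b (h j) (y j))))"


section \<open>Polynomial lattice rules and the worst-case error\<close>

text \<open>
  The field with \<open>b\<close> elements is \<open>'p mod_ring\<close> with \<open>b = CARD('p)\<close> prime; \<open>to_int_mod_ring\<close> identifies
  it with \<open>{0..<b}\<close>. The value \<open>nu m v\<close> is the one of \<open>v / x ^ m\<close>.
\<close>

definition nu :: "nat \<Rightarrow> 'p::prime_card mod_ring poly \<Rightarrow> real" where
  "nu m v = (\<Sum>k<m. real_of_int (to_int_mod_ring (poly.coeff v k)) / real CARD('p) ^ (m - k))"

definition polylat_point ::
  "nat \<Rightarrow> nat \<Rightarrow> (nat \<Rightarrow> 'p::prime_card mod_ring poly) \<Rightarrow> 'p mod_ring poly \<Rightarrow> nat \<Rightarrow> real" where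
  "polylat_point m s g n = (\<lambda>j\<in>{1..s}. nu m (n * g j))"

text \<open>
  Since \<open>degree 0 = 0\<close>, for \<open>m \<ge> 1\<close> the zero polynomial is among the \<open>n\<close> with \<open>degree n < m\<close>.
\<close>

definition polylat_rule ::
  "nat \<Rightarrow> nat \<Rightarrow> (nat \<Rightarrow> 'p::prime_card mod_ring poly) \<Rightarrow> ((nat \<Rightarrow> real) \<Rightarrow> complex) \<Rightarrow> complex" where
  "polylat_rule m s g f =
     (\<Sum>n | degree n < m. f (polylat_point m s g n)) / of_nat (CARD('p) ^ m)"

definition worst_case_error ::
  "nat \<Rightarrow> nat \<Rightarrow> real \<Rightarrow> (nat set \<Rightarrow> real) \<Rightarrow> (nat \<Rightarrow> 'p::prime_card mod_ring poly) \<Rightarrow> real" where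
  "worst_case_error m s \<alpha> \<gamma> g =
     (SUP f \<in> rkhs_unit_ball (unit_cube s) (walsh_kernel CARD('p) s \<alpha> \<gamma>).
        norm ((LINT x:unit_cube s|PiM {1..s} (\<lambda>_. lborel). f x) - polylat_rule m s g f))"


section \<open>The reduced successive coordinate search\<close>

definition search_space :: "nat \<Rightarrow> nat \<Rightarrow> 'p::prime_card mod_ring poly set" where
  "search_space m w =
     (if w < m then {g. g \<noteq> 0 \<and> degree g < m - w \<and> gcd g (Polynomial.monom 1 m) = 1} else {1})"

definition scs_vector ::
  "(nat \<Rightarrow> nat) \<Rightarrow> (nat \<Rightarrow> 'p::prime_card mod_ring poly) \<Rightarrow> (nat \<Rightarrow> 'p mod_ring poly) \<Rightarrow>
   nat \<Rightarrow> 'p mod_ring poly \<Rightarrow> nat \<Rightarrow> 'p mod_ring poly" where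
  "scs_vector w g0 g d q j =
     (if j < d then Polynomial.monom 1 (w j) * g j else if j = d then Polynomial.monom 1 (w d) * q else g0 j)"

text \<open>
  Minimizers need not be unique, so the algorithm is a relation: \<open>g 1, \<dots>, g s\<close> is a possible
  sequence of choices from the starting vector \<open>g0\<close>.
\<close>

definition reduced_scs ::
  "nat \<Rightarrow> nat \<Rightarrow> real \<Rightarrow> (nat set \<Rightarrow> real) \<Rightarrow> (nat \<Rightarrow> nat) \<Rightarrow>
   (nat \<Rightarrow> 'p::prime_card mod_ring poly) \<Rightarrow> (nat \<Rightarrow> 'p mod_ring poly) \<Rightarrow> bool" where
  "reduced_scs m s \<alpha> \<gamma> w g0 g \<longleftrightarrow>
     (\<forall>d\<in>{1..s}. g d \<in> search_space m (w d) \<and>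
        (\<forall>q\<in>search_space m (w d).
           (worst_case_error m s \<alpha> \<gamma> (scs_vector w g0 g d (g d)))\<^sup>2
             \<le> (worst_case_error m s \<alpha> \<gamma> (scs_vector w g0 g d q))\<^sup>2))"

definition scs_const ::
  "nat \<Rightarrow> (nat \<Rightarrow> nat) \<Rightarrow> nat \<Rightarrow> real \<Rightarrow> (nat \<Rightarrow> real) \<Rightarrow> real \<Rightarrow> real" where
  "scs_const b w s \<alpha> \<gamma> \<delta> =
     ((\<Sum>d=1..s. \<gamma> d powr (1 / (\<alpha> - 2 * \<delta>)) * real b ^ w d) *
      (2 * mu b (\<alpha> / (\<alpha> - 2 * \<delta>))) *
      (\<Prod>d=1..s - 1. 1 + \<gamma> d powr (1 / (\<alpha> - 2 * \<delta>)) * mu b (\<alpha> / (\<alpha> - 2 * \<delta>))))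
     powr (\<alpha> / 2 - \<delta>)"

end

theory Submission
  imports Defs
begin

text \<open>
  Indexing by all frequencies \<open>h\<close> with entries in \<open>\<nat> \<union> {0}\<close>, the kernel is the single series
  \<open>\<Sum>h. \<rho> h * wal h x * cnj (wal h y)\<close> with product weights \<open>\<rho> h\<close>. Its reproducing kernel Hilbert
  space is therefore a weighted \<open>\<ell>\<^sup>2\<close> space of Walsh coefficients, and the squared worst-case error is the
  sum of \<open>\<rho> h\<close> over the nonzero \<open>h\<close> in the dual lattice. The integral of a function in the unit ball is
  the limit of its means over finer and finer grids, so that the upper bound only needs the
  Cauchy--Schwarz inequality for finite combinations of point evaluations.

  Write \<open>\<theta> d\<close> for the part of this sum with \<open>h d \<noteq> 0\<close>. Step \<open>d\<close> of the algorithm minimizes \<open>\<theta> d\<close>, hence by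
  Jensen's inequality \<open>\<theta> d powr (1 / (\<alpha> - 2 * \<delta>))\<close> is at most the average over the search space of the sum
  of the powers. Given the other entries of \<open>h\<close>, only entries \<open>h d\<close> of one fixed \<open>b\<close>-adic valuation \<open>v\<close>
  (or at least \<open>m - w d\<close>) occur, with at most \<open>b ^ v\<close> solutions each; this avoids a logarithmic factor.
  Finally, sorting the dual lattice points of the output by their last nonzero entry bounds the
  error by \<open>\<Sum>d. \<theta> d\<close>.
\<close>

section \<open>Digits and Walsh functions at the nodes\<close>

text \<open>\<open>rkhs_unit_ball\<close> quantifies existentially over Hilbert spaces, so the two
  halves of the error formula use different tools: the upper bound is proved for an arbitrary space
  with the given kernel, and a concrete space of Walsh series supplies a function that attains it.
  Elements of an abstract space come without measurability; their uniform approximation by step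
  functions on grids yields measurability, integrability and the value of the integral at once.

  With \<open>t = 1 / (\<alpha> - 2 * \<delta>)\<close>, positivity of \<delta> gives
  \<open>\<alpha> * t > 1\<close>, which makes the powered weights summable, and
  \<open>\<delta> \<le> (\<alpha> - 1) / 2\<close> gives \<open>t \<le> 1\<close>, which Jensen's
  inequality requires. The factor 2 in the constant is the cost of excluding polynomials with zero
  constant coefficient from the search space. The product stops at \<open>s - 1\<close> because
  coordinate \<open>d\<close> is summed separately in step \<open>d\<close>, and non-increasing
  weights allow factor \<open>s\<close> to be dropped in its place.\<close>

definition polys :: "nat \<Rightarrow> 'a::zero poly set" where
  "polys n = {p. \<forall>k\<ge>n. poly.coeff p k = 0}"

lemma polys_0 [simp]: "polys 0 = {0}"
  by (auto simp: polys_def poly_eq_iff)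

lemma polys_Suc: "polys (Suc n) = (\<lambda>(a, p). pCons a p) ` (UNIV \<times> polys n)"
proof (intro equalityI subsetI)
  fix p :: "'a poly" assume "p \<in> polys (Suc n)"
  moreover obtain a q where p: "p = pCons a q" by (cases p)
  ultimately have "\<forall>k\<ge>n. poly.coeff q k = 0"
    by (auto simp: polys_def)
  with p show "p \<in> (\<lambda>(a, p). pCons a p) ` (UNIV \<times> polys n)"
    by (auto simp: polys_def)
qed (auto simp: polys_def coeff_pCons split: nat.splits)

lemma finite_polys [simp]: "finite (polys n :: 'a::{finite,zero} poly set)"
  by (induction n) (simp_all add: polys_Suc)

lemma card_polys: "card (polys n :: 'a::{finite,zero} poly set) = CARD('a) ^ n"
proof (induction n)
  case (Suc n)
  have "inj_on (\<lambda>(a :: 'a, p). pCons a p) (UNIV \<times> polys n)"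
    by (auto simp: inj_on_def)
  then show ?case
    using Suc by (simp add: polys_Suc card_image card_cartesian_product)
qed simp

text \<open>The assumption excludes \<open>n = 0\<close>, where the left side is empty but
  \<open>polys 0\<close> contains the zero polynomial. In contrast to the degree condition,
  \<open>polys n\<close> is an additive group for every \<open>n\<close>.\<close>

lemma degree_less_eq_polys:
  assumes "n \<ge> 1" shows "{p. degree p < n} = polys n"
proof -
  have "degree p < n" if "p \<in> polys n" for p :: "'a poly"
    using that assms leading_coeff_0_iff[of p] by (cases "p = 0") (force simp: polys_def not_le[symmetric])+
  then show ?thesis
    by (auto simp: polys_def intro: coeff_eq_0)
qed

section \<open>The additive character of the prime field\<close>

definition chr :: "'p::prime_card mod_ring \<Rightarrow> complex" where
  "chr a = cis (2 * pi * of_int (to_int_mod_ring a) / real CARD('p))"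

lemma to_int_of_int: "to_int_mod_ring (of_int z :: 'p::prime_card mod_ring) = z mod int CARD('p)"
  unfolding of_int_of_int_mod_ring by transfer simp

lemma of_int_to_int [simp]: "of_int (to_int_mod_ring a) = (a :: 'p::prime_card mod_ring)"
  unfolding of_int_of_int_mod_ring by simp

lemma to_int_bounds: "0 \<le> to_int_mod_ring (a :: 'p::prime_card mod_ring)"
  "to_int_mod_ring (a :: 'p::prime_card mod_ring) < int CARD('p)"
  using range_to_int_mod_ring[where 'a = 'p] by auto

lemma card_gt_1: "CARD('p::prime_card) > 1"
  using prime_card prime_gt_1_nat by blast

text \<open>Full turns of \<open>cis\<close> absorb multiples of the field size, so digit sums may
  be formed over the integers and reduced to the field afterwards.\<close>

lemma chr_of_int: "chr (of_int z :: 'p::prime_card mod_ring) = cis (2 * pi * of_int z / real CARD('p))"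
proof -
  let ?b = "CARD('p)"
  have b: "real ?b > 0" by simp
  have "(of_int z :: real) = of_int (z mod int ?b) + real ?b * of_int (z div int ?b)"
    by (metis add.commute div_mult_mod_eq mult.commute of_int_add of_int_mult of_int_of_nat_eq)
  then have "2 * pi * of_int z / real ?b
      = 2 * pi * of_int (z mod int ?b) / real ?b + 2 * pi * of_int (z div int ?b)"
    using b by (simp add: field_simps)
  then show ?thesis
    by (simp add: chr_def to_int_of_int cis_mult[symmetric])
qed

lemma chr_add: "chr (a + c) = chr a * chr (c :: 'p::prime_card mod_ring)"
proof -
  have "chr (of_int (to_int_mod_ring a + to_int_mod_ring c) :: 'p mod_ring)
      = chr (of_int (to_int_mod_ring a) :: 'p mod_ring) * chr (of_int (to_int_mod_ring c) :: 'p mod_ring)"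
    unfolding chr_of_int cis_mult by (simp add: add_divide_distrib ring_distribs)
  then show ?thesis by simp
qed

lemma chr_0 [simp]: "chr 0 = 1"
  by (simp add: chr_def)

lemma norm_chr [simp]: "norm (chr a) = 1"
  by (simp add: chr_def)

lemma chr_uminus: "chr (- a) = cnj (chr (a :: 'p::prime_card mod_ring))"
proof -
  have "chr (- a) * chr a = cnj (chr a) * chr a"
    by (simp add: chr_add[symmetric] mult.commute complex_norm_square[symmetric])
  moreover have "chr a \<noteq> 0"
    using norm_chr[of a] by force
  ultimately show ?thesis by simp
qed

lemma chr_sum: "chr (\<Sum>x\<in>A. f x) = (\<Prod>x\<in>A. chr (f x :: 'p::prime_card mod_ring))"
  by (induction A rule: infinite_finite_induct) (simp_all add: chr_add)

lemma chr_eq_1_iff: "chr (a :: 'p::prime_card mod_ring) = 1 \<longleftrightarrow> a = 0"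
proof
  assume "chr a = 1"
  then obtain n :: int where n: "2 * pi * of_int (to_int_mod_ring a) / real CARD('p) = of_int n * (2 * pi)"
    unfolding chr_def cis_conv_exp exp_eq_1 by auto
  then have "real_of_int (to_int_mod_ring a) = of_int (n * int CARD('p))"
    by (simp add: field_simps)
  then have *: "to_int_mod_ring a = n * int CARD('p)"
    by (simp only: of_int_eq_iff)
  then have "to_int_mod_ring a mod int CARD('p) = 0"
    by simp
  then have "to_int_mod_ring a = 0"
    using to_int_bounds[of a] by simp
  then show "a = 0"
    by (metis of_int_0 of_int_to_int)
qed simp

text \<open>Orthogonality of characters: taking coefficient \<open>m - 1\<close> of
  \<open>n * p\<close> is a linear functional of \<open>n\<close> in \<open>polys m\<close>, and it
  is zero exactly when the first \<open>m\<close> coefficients of \<open>p\<close> vanish.\<close>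

lemma mean_chr_coeff:
  fixes p :: "'p::prime_card mod_ring poly"
  assumes "m \<ge> 1"
  shows "(\<Sum>n\<in>polys m. chr (poly.coeff (n * p) (m - 1))) / of_nat (CARD('p) ^ m)
    = of_bool (Polynomial.monom 1 m dvd p)"
proof (cases "Polynomial.monom 1 m dvd p")
  case True
  have "poly.coeff (n * p) (m - 1) = 0" for n
    using dvd_mult[OF True, of n] assms unfolding monom_1_dvd_iff' by simp
  then show ?thesis
    using True by (simp add: card_polys)
next
  case False
  then obtain k where k: "k < m" "poly.coeff p k \<noteq> 0"
    unfolding monom_1_dvd_iff' by blast
  \<comment> \<open>This monomial moves the nonzero coefficient \<open>k\<close> of \<open>p\<close>
    to position \<open>m - 1\<close>, so the character is nontrivial at \<open>q\<close>;
    translating the summation by \<open>q\<close> then forces the sum to vanish.\<close>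
  define q :: "'p mod_ring poly" where "q = Polynomial.monom 1 (m - 1 - k)"
  let ?\<chi> = "\<lambda>n. chr (poly.coeff (n * p) (m - 1))"
  have q: "q \<in> polys m"
    using k by (auto simp: polys_def q_def)
  have "poly.coeff (q * p) (m - 1) = poly.coeff p k"
    using k by (simp add: q_def coeff_monom_mult)
  then have "?\<chi> q \<noteq> 1"
    using k by (simp add: chr_eq_1_iff)
  have "(\<Sum>n\<in>polys m. ?\<chi> n) = (\<Sum>n\<in>polys m. ?\<chi> (q + n))"
    by (rule sum.reindex_bij_witness[of _ "\<lambda>n. q + n" "\<lambda>n. n - q"])
      (use q in \<open>auto simp: polys_def\<close>)
  also have "\<dots> = ?\<chi> q * (\<Sum>n\<in>polys m. ?\<chi> n)"
    by (simp add: ring_distribs chr_add sum_distrib_left)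
  finally have "(\<Sum>n\<in>polys m. ?\<chi> n) = 0"
    using \<open>?\<chi> q \<noteq> 1\<close> by simp
  then show ?thesis
    using False by simp
qed

section \<open>Digits in base \<open>b\<close> and truncated frequencies\<close>

lemma base_digit_sum:
  assumes "\<And>k. k < n \<Longrightarrow> c k < b"
  shows "(\<Sum>k<n. c k * b ^ k) < b ^ n"
    and "i < n \<Longrightarrow> base_digit b (\<Sum>k<n. c k * b ^ k) i = c i"
proof -
  have less: "(\<Sum>k<n. c k * b ^ k) < b ^ n" if "\<And>k. k < n \<Longrightarrow> c k < b" for n
    using that
  proof (induction n)
    case (Suc n)
    have "(\<Sum>k<Suc n. c k * b ^ k) < b ^ n + c n * b ^ n"
      using Suc by simp
    also have "\<dots> = Suc (c n) * b ^ n" by simp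
    also have "\<dots> \<le> b * b ^ n"
      using Suc.prems[of n] by (intro mult_right_mono) auto
    finally show ?case by simp
  qed simp
  then show "(\<Sum>k<n. c k * b ^ k) < b ^ n"
    using assms by blast
  show "base_digit b (\<Sum>k<n. c k * b ^ k) i = c i" if "i < n"
    using that assms
  proof (induction n)
    case (Suc n)
    have b: "b > 0" using Suc.prems(2)[of n] by simp
    show ?case
    proof (cases "i = n")
      case True
      then show ?thesis
        using less[of n] Suc.prems(2)[of n] Suc.prems(2) b by (simp add: base_digit_def)
    next
      case False
      then have i: "i < n" using Suc.prems by simp
      \<comment> \<open>After division by \<open>b ^ i\<close> the top term is still a multiple of
        \<open>b\<close>, because \<open>i < n\<close>; hence it leaves digit \<open>i\<close>
        unchanged.\<close>
      have "b ^ n = b * b ^ (n - Suc i) * b ^ i"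
        using i by (simp flip: power_Suc power_add)
      then have "(\<Sum>k<Suc n. c k * b ^ k) div b ^ i
          = (\<Sum>k<n. c k * b ^ k) div b ^ i + b * (c n * b ^ (n - Suc i))"
      proof -
        have "c n * b ^ n = (b * (c n * b ^ (n - Suc i))) * b ^ i"
          using \<open>b ^ n = _\<close> by (simp add: mult_ac)
        then have "(\<Sum>k<Suc n. c k * b ^ k) = (\<Sum>k<n. c k * b ^ k) + (b * (c n * b ^ (n - Suc i))) * b ^ i"
          by simp
        then show ?thesis using b by (simp only: div_mult_self1) simp
      qed
      then have "base_digit b (\<Sum>k<Suc n. c k * b ^ k) i = base_digit b (\<Sum>k<n. c k * b ^ k) i"
        by (simp add: base_digit_def)
      then show ?thesis
        using Suc i by simp
    qed
  qed simp
qed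

lemma sum_base_digit:
  "(\<Sum>i<n. base_digit b k i * b ^ i) = k mod b ^ n"
proof (induction n)
  case (Suc n)
  then show ?case
    by (simp add: base_digit_def mod_mult2_eq mult.commute[of _ b] mult.commute[of "b ^ n"])
      (metis add.commute mod_mult2_eq mult.commute)
qed simp

lemma base_digit_eq_0: "h < b ^ i \<Longrightarrow> base_digit b h i = 0"
  by (simp add: base_digit_def)

text \<open>\<open>psi b h\<close> is the position of the leading digit when \<open>h > 0\<close>;
  for \<open>h = 0\<close> every digit is zero, whatever value the logarithm takes there.\<close>

lemma base_digit_psi_eq_0:
  assumes "b > 1" "i > nat (psi b h)"
  shows "base_digit b h i = 0"
proof (cases "h = 0")
  case False
  have "psi b h < int i"
    using assms(2) by simp
  then have "log b h < i"
    unfolding psi_def by linarith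
  then have "real h < real b powr real i"
    using assms False by (simp add: log_less_iff)
  then have "real h < real (b ^ i)"
    using assms by (simp add: powr_realpow)
  then show ?thesis
    by (intro base_digit_eq_0) (simp only: of_nat_less_iff)
qed (simp add: base_digit_def)

text \<open>The number of digits in the definition of \<open>wal\<close> varies with
  \<open>h\<close>. Padding with zero digits allows any length \<open>L\<close> that covers
  \<open>h\<close>, so that different frequencies can share one length.\<close>

lemma wal_eq_chr:
  assumes "h < CARD('p::prime_card) ^ L"
  shows "wal CARD('p) h x
    = chr (\<Sum>i<L. of_int (frac_digit CARD('p) x (Suc i)) * of_nat (base_digit CARD('p) h i) :: 'p mod_ring)"
proof -
  let ?b = "CARD('p)"
  let ?t = "\<lambda>i. frac_digit ?b x (Suc i) * int (base_digit ?b h i)"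
  let ?P = "nat (psi ?b h)"
  have "(\<Sum>i\<le>?P. ?t i) = (\<Sum>i<L + Suc ?P. ?t i)"
    using card_gt_1[where 'p = 'p] by (intro sum.mono_neutral_left) (auto simp: base_digit_psi_eq_0)
  also have "\<dots> = (\<Sum>i<L. ?t i)"
  proof (intro sum.mono_neutral_right ballI)
    fix i assume "i \<in> {..<L + Suc ?P} - {..<L}"
    then have "?b ^ L \<le> ?b ^ i" by (intro power_increasing) auto
    with assms show "?t i = 0" by (simp add: base_digit_eq_0)
  qed auto
  finally have "wal ?b h x = cis (2 * pi * of_int (\<Sum>i<L. ?t i) / real ?b)"
    by (simp add: wal_def cis_conv_exp mult_ac)
  also have "\<dots> = chr (of_int (\<Sum>i<L. ?t i) :: 'p mod_ring)"
    by (rule chr_of_int[symmetric])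
  finally show ?thesis by simp
qed

definition tr :: "nat \<Rightarrow> nat \<Rightarrow> 'p::prime_card mod_ring poly" where
  "tr m h = (\<Sum>i<m. Polynomial.monom (of_nat (base_digit CARD('p) h i)) i)"

lemma coeff_tr: "poly.coeff (tr m h :: 'p::prime_card mod_ring poly) i
    = (if i < m then of_nat (base_digit CARD('p) h i) else 0)"
  by (simp add: tr_def coeff_sum)

lemma of_nat_base_digit_eq_iff:
  "of_nat (base_digit CARD('p) h i) = (of_nat (base_digit CARD('p) k i) :: 'p::prime_card mod_ring)
    \<longleftrightarrow> base_digit CARD('p) h i = base_digit CARD('p) k i"
proof -
  have "to_int_mod_ring (of_nat (base_digit CARD('p) h i) :: 'p mod_ring) = int (base_digit CARD('p) h i)" for h
    using to_int_of_int[of "int (base_digit CARD('p) h i)", where 'p = 'p] by (simp add: base_digit_def)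
  then show ?thesis
    by (metis of_nat_eq_iff)
qed

lemma tr_0 [simp]: "tr m 0 = 0"
  by (simp add: tr_def base_digit_def)

text \<open>Subtraction of polynomials is digitwise without carries, so the difference is in general
  not \<open>tr m (h - k)\<close>. Divisibility by a power of the indeterminate only compares low
  digits, and these are determined by the residue.\<close>

lemma monom_dvd_tr_diff_iff:
  assumes "n \<le> m"
  shows "Polynomial.monom 1 n dvd (tr m h - tr m k :: 'p::prime_card mod_ring poly)
    \<longleftrightarrow> h mod CARD('p) ^ n = k mod CARD('p) ^ n"
proof -
  let ?b = "CARD('p)"
  have "Polynomial.monom 1 n dvd (tr m h - tr m k :: 'p mod_ring poly)
    \<longleftrightarrow> (\<forall>i<n. base_digit ?b h i = base_digit ?b k i)"
    using assms unfolding monom_1_dvd_iff'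
    by (auto simp: coeff_tr of_nat_base_digit_eq_iff)
  also have "\<dots> \<longleftrightarrow> h mod ?b ^ n = k mod ?b ^ n"
  proof
    assume "\<forall>i<n. base_digit ?b h i = base_digit ?b k i"
    then have "(\<Sum>i<n. base_digit ?b h i * ?b ^ i) = (\<Sum>i<n. base_digit ?b k i * ?b ^ i)"
      by (intro sum.cong) auto
    then show "h mod ?b ^ n = k mod ?b ^ n" by (simp only: sum_base_digit)
  next
    assume eq: "h mod ?b ^ n = k mod ?b ^ n"
    have "base_digit ?b l i = base_digit ?b (l mod ?b ^ n) i" if "i < n" for l i
    proof -
      have "base_digit ?b (\<Sum>j<n. base_digit ?b l j * ?b ^ j) i = base_digit ?b l i"
        using that by (intro base_digit_sum(2)) (auto simp: base_digit_def)
      then show ?thesis by (simp add: sum_base_digit)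
    qed
    then show "\<forall>i<n. base_digit ?b h i = base_digit ?b k i"
      by (metis eq)
  qed
  finally show ?thesis .
qed

text \<open>The coefficients are read as the digits of an integer, which reverses
  \<open>tr m\<close> on \<open>polys m\<close>. Divided by the \<open>m\<close>-th power of the
  base it becomes \<open>nu m v\<close>, so the values of \<open>nu m\<close> fill a whole
  equidistant grid.\<close>

definition digits_val :: "nat \<Rightarrow> 'p::prime_card mod_ring poly \<Rightarrow> nat" where
  "digits_val m v = (\<Sum>k<m. nat (to_int_mod_ring (poly.coeff v k)) * CARD('p) ^ k)"

lemma nat_to_int_less: "nat (to_int_mod_ring (a :: 'p::prime_card mod_ring)) < CARD('p)"
  using to_int_bounds[of a] by linarith

lemma digits_val_less: "digits_val m (v :: 'p::prime_card mod_ring poly) < CARD('p) ^ m"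
  unfolding digits_val_def by (rule base_digit_sum) (rule nat_to_int_less)

lemma base_digit_digits_val:
  "i < m \<Longrightarrow> base_digit CARD('p) (digits_val m v) i = nat (to_int_mod_ring (poly.coeff v i))"
  for v :: "'p::prime_card mod_ring poly"
  unfolding digits_val_def by (rule base_digit_sum) (rule nat_to_int_less)

lemma bij_betw_digits_val:
  "bij_betw (digits_val m) (polys m :: 'p::prime_card mod_ring poly set) {..<CARD('p) ^ m}"
proof -
  have inj: "inj_on (digits_val m) (polys m :: 'p mod_ring poly set)"
  proof (rule inj_onI)
    fix u v :: "'p mod_ring poly"
    assume uv: "u \<in> polys m" "v \<in> polys m" "digits_val m u = digits_val m v"
    have "poly.coeff u i = poly.coeff v i" for i
    proof (cases "i < m")
      case True
      then have "nat (to_int_mod_ring (poly.coeff u i)) = nat (to_int_mod_ring (poly.coeff v i))"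
        using uv base_digit_digits_val by metis
      then have "to_int_mod_ring (poly.coeff u i) = to_int_mod_ring (poly.coeff v i)"
        using to_int_bounds by (metis nat_0_le)
      then show ?thesis by (metis of_int_to_int)
    qed (use uv in \<open>simp add: polys_def\<close>)
    then show "u = v" by (simp add: poly_eq_iff)
  qed
  moreover have "digits_val m ` (polys m :: 'p mod_ring poly set) = {..<CARD('p) ^ m}"
    using digits_val_less by (intro card_subset_eq) (auto simp: card_image[OF inj] card_polys)
  ultimately show ?thesis by (simp add: bij_betw_def)
qed

lemma nu_eq: "nu m v = real (digits_val m v) / real CARD('p) ^ m" for v :: "'p::prime_card mod_ring poly"
proof -
  have "real_of_int (to_int_mod_ring (poly.coeff v k)) / real CARD('p) ^ (m - k)
     = real (nat (to_int_mod_ring (poly.coeff v k)) * CARD('p) ^ k) / real CARD('p) ^ m" if "k < m" for k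
    using that to_int_bounds(1)[of "poly.coeff v k"] by (simp add: power_diff field_simps)
  then show ?thesis
    by (simp add: nu_def digits_val_def sum_divide_distrib)
qed

lemma nu_bounds: "0 \<le> nu m v" "nu m v < 1" for v :: "'p::prime_card mod_ring poly"
  using digits_val_less[of m v]
  by (simp_all add: nu_eq flip: of_nat_power)

text \<open>Dividing \<open>x * b ^ M\<close> by the integer \<open>b ^ (M - i)\<close> has the same
  floor whether or not \<open>x * b ^ M\<close> was rounded down first. Thus truncation to
  \<open>M\<close> digits preserves the first \<open>M\<close> digits.\<close>

lemma floor_pow_div:
  assumes "i \<le> M" "b > 0"
  shows "\<lfloor>of_int \<lfloor>x * real b ^ M\<rfloor> / real b ^ M * real b ^ i\<rfloor> = \<lfloor>x * real b ^ i\<rfloor>"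
proof -
  have M: "real b ^ M = real_of_int (int b ^ (M - i)) * real b ^ i"
    using assms by (simp flip: power_add)
  have eq: "y / real b ^ M * real b ^ i = y / real_of_int (int b ^ (M - i))" for y
    using assms unfolding M by simp
  have "x * real b ^ i = x * real b ^ M / real_of_int (int b ^ (M - i))"
    using assms unfolding M by simp
  then have "\<lfloor>x * real b ^ i\<rfloor> = \<lfloor>x * real b ^ M\<rfloor> div (int b ^ (M - i))"
    by (simp only: floor_divide_real_eq_div zero_le_power of_nat_0_le_iff)
  then show ?thesis
    unfolding eq by (simp only: floor_divide_of_int_eq)
qed

lemma wal_trunc:
  assumes "h < CARD('p::prime_card) ^ M"
  shows "wal CARD('p) h (of_int \<lfloor>x * real CARD('p) ^ M\<rfloor> / real CARD('p) ^ M) = wal CARD('p) h x"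
proof -
  have "frac_digit CARD('p) (of_int \<lfloor>x * real CARD('p) ^ M\<rfloor> / real CARD('p) ^ M) (Suc i)
      = frac_digit CARD('p) x (Suc i)" if "i < M" for i
    unfolding frac_digit_def by (subst floor_pow_div) (use that in auto)
  then show ?thesis
    by (simp add: wal_eq_chr[OF assms])
qed

text \<open>\<open>nu\<close> reads the coefficients from the top downwards. For
  \<open>i \<ge> m\<close>, scaling by \<open>b ^ Suc i\<close> gives an integer multiple of
  \<open>b\<close>, so all later digits are zero.\<close>

lemma frac_digit_nu:
  fixes v :: "'p::prime_card mod_ring poly"
  shows "frac_digit CARD('p) (nu m v) (Suc i)
    = (if i < m then to_int_mod_ring (poly.coeff v (m - 1 - i)) else 0)"
proof (cases "i < m")
  case True
  let ?b = "CARD('p)"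
  have "nu m v * real ?b ^ Suc i = of_int (int (digits_val m v)) / of_int (int ?b ^ (m - 1 - i))"
  proof -
    have "real ?b ^ m = real ?b ^ (m - 1 - i) * real ?b ^ Suc i"
      using True by (simp flip: power_Suc power_add)
    then show ?thesis by (simp add: nu_eq)
  qed
  then have "\<lfloor>nu m v * real ?b ^ Suc i\<rfloor> = int (digits_val m v) div int ?b ^ (m - 1 - i)"
    by (simp only: floor_divide_of_int_eq)
  also have "\<dots> mod int ?b = int (base_digit ?b (digits_val m v) (m - 1 - i))"
    by (simp add: base_digit_def zdiv_int zmod_int)
  finally show ?thesis
    using True to_int_bounds(1)[of "poly.coeff v (m - Suc i)"] by (simp add: frac_digit_def base_digit_digits_val)
next
  case False
  let ?b = "CARD('p)"
  have "nu m v * real ?b ^ Suc i = of_int (int (digits_val m v) * (int ?b ^ Suc (i - m)))"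
  proof -
    have "real ?b ^ Suc i = real ?b ^ m * real ?b ^ Suc (i - m)"
      using False by (simp flip: power_Suc power_add)
    then show ?thesis by (simp add: nu_eq)
  qed
  then have "frac_digit ?b (nu m v) (Suc i) = int (digits_val m v) * int ?b ^ Suc (i - m) mod int ?b"
    unfolding frac_digit_def by (simp only: floor_of_int)
  then show ?thesis
    using False by simp
qed

text \<open>Because \<open>nu\<close> reverses the coefficients, pairing the digits of the node with
  those of \<open>h\<close> is a Cauchy product, hence a single coefficient of
  \<open>v * tr m h\<close>. Digits of \<open>h\<close> from position \<open>m\<close> on meet zero
  digits of the node, which is why \<open>tr m\<close> appears.\<close>

lemma wal_nu:
  fixes v :: "'p::prime_card mod_ring poly"
  assumes "m \<ge> 1"
  shows "wal CARD('p) h (nu m v) = chr (poly.coeff (v * tr m h) (m - 1))"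
proof -
  let ?b = "CARD('p)"
  \<comment> \<open>A length that is at least \<open>m\<close> and covers all digits of
    \<open>h\<close>, since \<open>h < b ^ h\<close>.\<close>
  define L where "L = m + h"
  have "h < ?b ^ h"
    using card_gt_1[where 'p = 'p] by (intro less_exp[THEN order.strict_trans2]) (simp add: power_mono)
  also have "\<dots> \<le> ?b ^ L" by (intro power_increasing) (auto simp: L_def)
  finally have "wal ?b h (nu m v) = chr (\<Sum>i<L. of_int (frac_digit ?b (nu m v) (Suc i)) * of_nat (base_digit ?b h i) :: 'p mod_ring)"
    by (rule wal_eq_chr)
  also have "(\<Sum>i<L. of_int (frac_digit ?b (nu m v) (Suc i)) * of_nat (base_digit ?b h i) :: 'p mod_ring)
    = (\<Sum>i<m. of_int (frac_digit ?b (nu m v) (Suc i)) * of_nat (base_digit ?b h i))"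
    by (intro sum.mono_neutral_right) (auto simp: L_def frac_digit_nu)
  also have "\<dots> = (\<Sum>i\<le>m - 1. poly.coeff (tr m h) i * poly.coeff v (m - 1 - i))"
    using assms by (intro sum.cong) (auto simp: frac_digit_nu coeff_tr)
  also have "\<dots> = poly.coeff (v * tr m h) (m - 1)"
    by (subst mult.commute) (simp add: coeff_mult)
  finally show ?thesis .
qed

lemma norm_wal [simp]: "norm (wal CARD('p::prime_card) h x) = 1"
proof -
  have "h < CARD('p) ^ h"
    using card_gt_1[where 'p = 'p] by (intro less_exp[THEN order.strict_trans2]) (simp add: power_mono)
  from wal_eq_chr[OF this] show ?thesis by simp
qed

section \<open>Reproducing kernel Hilbert spaces from square-summable features\<close>

context rkhs begin

lemma ip_add_right:
  assumes "f \<in> H" "g \<in> H" "h \<in> H"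
  shows "ip h (\<lambda>x\<in>X. f x + g x) = ip h f + ip h g"
  unfolding ip_cnj[OF add_mem[OF assms(1,2)] assms(3)] ip_add[OF assms]
  by (simp only: complex_cnj_add ip_cnj[OF assms(1,3), symmetric] ip_cnj[OF assms(2,3), symmetric])

lemma ip_scale_right:
  assumes "f \<in> H" "h \<in> H"
  shows "ip h (\<lambda>x\<in>X. c * f x) = cnj c * ip h f"
  unfolding ip_cnj[OF scale_mem[OF assms(1)] assms(2)] ip_scale[OF assms]
  by (simp only: complex_cnj_mult ip_cnj[OF assms, symmetric])

lemma ip_zero_right: "h \<in> H \<Longrightarrow> ip h (\<lambda>x\<in>X. 0) = 0"
  using ip_scale_right[OF zero_mem, of h 0] by simp

lemma ip_self_real: "f \<in> H \<Longrightarrow> ip f f = of_real (Re (ip f f))"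
  using ip_cnj[of f f] by (simp add: complex_eq_iff)

lemma Cauchy_Schwarz:
  assumes f: "f \<in> H" and g: "g \<in> H"
  shows "(cmod (ip f g))\<^sup>2 \<le> Re (ip f f) * Re (ip g g)"
proof (cases "Re (ip g g) = 0")
  case True
  then have "g = (\<lambda>x\<in>X. 0)"
    using g ip_definite ip_self_real by (metis of_real_0)
  then show ?thesis
    using f zero_mem by (simp add: ip_zero_right)
next
  case False
  define G where "G = Re (ip g g)"
  have G: "G > 0" using False ip_nonneg[OF g] by (simp add: G_def)
  \<comment> \<open>With this \<open>c\<close>, the function \<open>u\<close> is the component of
    \<open>f\<close> orthogonal to \<open>g\<close>; nonnegativity of its squared norm is the
    claim.\<close>
  define c where "c = - ip f g / of_real G"
  define v where "v = (\<lambda>x\<in>X. c * g x)"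
  define u where "u = (\<lambda>x\<in>X. f x + v x)"
  have v: "v \<in> H" and u: "u \<in> H"
    unfolding u_def v_def by (intro add_mem scale_mem f g)+
  have gg: "ip g g = of_real G" and ff: "ip f f = of_real (Re (ip f f))"
    using ip_self_real f g by (auto simp: G_def)
  have gf: "ip g f = cnj (ip f g)"
    using ip_cnj f g by blast
  have "ip f v = cnj c * ip f g" "ip v f = c * ip g f" "ip v v = c * (cnj c * ip g g)"
    using f g v unfolding v_def by (simp_all add: ip_scale ip_scale_right scale_mem)
  moreover have "ip u u = ip f f + ip f v + (ip v f + ip v v)"
    using f v u unfolding u_def by (simp add: ip_add ip_add_right add_mem)
  ultimately have "ip u u = of_real (Re (ip f f)) - ip f g * cnj (ip f g) / of_real G"
    using G ff by (simp add: gg gf c_def field_simps)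
  also have "ip f g * cnj (ip f g) = of_real ((cmod (ip f g))\<^sup>2)"
    by (simp only: complex_norm_square)
  finally have "Re (ip u u) = Re (ip f f) - (cmod (ip f g))\<^sup>2 / G"
    by simp
  then have "(cmod (ip f g))\<^sup>2 / G \<le> Re (ip f f)"
    using ip_nonneg[OF u] by simp
  then show ?thesis
    using G by (simp add: field_simps flip: G_def)
qed

text \<open>Kernel sections represent evaluations, and conjugate linearity in the second argument
  conjugates the coefficients. Membership and the inner product formula share one induction since
  the second needs the first.\<close>

lemma kernel_combination:
  assumes "finite A" "p ` A \<subseteq> X"
  shows "(\<lambda>x\<in>X. \<Sum>i\<in>A. c i * K x (p i)) \<in> H"
    and "f \<in> H \<Longrightarrow> ip f (\<lambda>x\<in>X. \<Sum>i\<in>A. c i * K x (p i)) = (\<Sum>i\<in>A. cnj (c i) * f (p i))"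
proof -
  have "(\<lambda>x\<in>X. \<Sum>i\<in>A. c i * K x (p i)) \<in> H \<and>
    (\<forall>f\<in>H. ip f (\<lambda>x\<in>X. \<Sum>i\<in>A. c i * K x (p i)) = (\<Sum>i\<in>A. cnj (c i) * f (p i)))"
    using assms
  proof (induction A)
    case empty
    then show ?case
      using zero_mem ip_zero_right by (simp add: restrict_def)
  next
    case (insert a A)
    define u where "u = (\<lambda>x\<in>X. \<Sum>i\<in>A. c i * K x (p i))"
    define v where "v = (\<lambda>x\<in>X. c a * (\<lambda>x\<in>X. K x (p a)) x)"
    have u: "u \<in> H" "\<And>f. f \<in> H \<Longrightarrow> ip f u = (\<Sum>i\<in>A. cnj (c i) * f (p i))"
      using insert.IH insert.prems unfolding u_def by (simp_all only: insert_subset image_insert ball_simps)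
    have k: "(\<lambda>x\<in>X. K x (p a)) \<in> H"
      using insert by (intro kernel_mem) auto
    have "p a \<in> X"
      using insert.prems by blast
    have v: "v \<in> H" "\<And>f. f \<in> H \<Longrightarrow> ip f v = cnj (c a) * f (p a)"
      unfolding v_def using scale_mem[OF k] ip_scale_right[OF k] reproducing[OF _ \<open>p a \<in> X\<close>] by metis+
    have "(\<lambda>x\<in>X. \<Sum>i\<in>insert a A. c i * K x (p i)) = (\<lambda>x\<in>X. u x + v x)"
      unfolding u_def v_def by (intro restrict_ext) (simp add: insert.hyps add.commute)
    then show ?case
      using add_mem[OF u(1) v(1)] ip_add_right[OF u(1) v(1)] u(2) v(2)
      unfolding sum.insert[OF insert.hyps] by (simp only: add.commute) blast
  qed
  then show "(\<lambda>x\<in>X. \<Sum>i\<in>A. c i * K x (p i)) \<in> H"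
    and "f \<in> H \<Longrightarrow> ip f (\<lambda>x\<in>X. \<Sum>i\<in>A. c i * K x (p i)) = (\<Sum>i\<in>A. cnj (c i) * f (p i))"
    by blast+
qed

lemma point_functional_bound:
  assumes "finite A" "p ` A \<subseteq> X" "f \<in> H"
  shows "(cmod (\<Sum>i\<in>A. c i * f (p i)))\<^sup>2
    \<le> Re (ip f f) * Re (\<Sum>i\<in>A. \<Sum>j\<in>A. c i * cnj (c j) * K (p i) (p j))"
proof -
  define k where "k = (\<lambda>x\<in>X. \<Sum>i\<in>A. cnj (c i) * K x (p i))"
  have k: "k \<in> H" and ip_k: "\<And>f. f \<in> H \<Longrightarrow> ip f k = (\<Sum>i\<in>A. c i * f (p i))"
    using kernel_combination[OF assms(1,2), where c = "\<lambda>i. cnj (c i)"] by (auto simp: k_def)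
  have "ip k k = (\<Sum>i\<in>A. \<Sum>j\<in>A. c i * cnj (c j) * K (p i) (p j))"
    using assms(2) by (subst ip_k[OF k]) (auto simp: k_def sum_distrib_left mult.assoc image_subset_iff)
  then show ?thesis
    using Cauchy_Schwarz[OF assms(3) k] ip_k[OF assms(3)] by simp
qed

end

section \<open>Square-summable families\<close>

definition ell2 :: "'i set \<Rightarrow> ('i \<Rightarrow> complex) set" where
  "ell2 I = {c. (\<lambda>h. (cmod (c h))\<^sup>2) summable_on I}"

lemma abs_summable_ell2_mult:
  assumes "c \<in> ell2 I" "d \<in> ell2 I"
  shows "(\<lambda>h. norm (c h * d h)) summable_on I"
proof (rule Infinite_Sum.abs_summable_product)
  show "(\<lambda>h. norm (c h * c h)) summable_on I" "(\<lambda>h. norm (d h * d h)) summable_on I"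
    using assms by (simp_all add: ell2_def norm_mult power2_eq_square)
qed

lemma summable_ell2_mult:
  assumes "c \<in> ell2 I" "d \<in> ell2 I"
  shows "(\<lambda>h. c h * d h) summable_on I"
  using abs_summable_ell2_mult[OF assms] by (rule Infinite_Sum.abs_summable_summable)

lemma ell2_cnj: "c \<in> ell2 I \<Longrightarrow> (\<lambda>h. cnj (c h)) \<in> ell2 I"
  by (simp add: ell2_def)

lemma ell2_scale: "c \<in> ell2 I \<Longrightarrow> (\<lambda>h. a * c h) \<in> ell2 I"
  unfolding ell2_def mem_Collect_eq norm_mult power_mult_distrib by (rule summable_on_cmult_right)

lemma cmod_add_power2_le: "(cmod (x + y))\<^sup>2 \<le> 2 * (cmod x)\<^sup>2 + 2 * (cmod y)\<^sup>2"
proof -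
  have "(cmod (x + y))\<^sup>2 \<le> (cmod x + cmod y)\<^sup>2"
    by (intro power_mono norm_triangle_ineq) auto
  also have "\<dots> \<le> 2 * (cmod x)\<^sup>2 + 2 * (cmod y)\<^sup>2"
    using sum_squares_bound[of "cmod x" "cmod y"] by (simp add: power2_sum)
  finally show ?thesis .
qed

lemma ell2_add:
  assumes "c \<in> ell2 I" "d \<in> ell2 I"
  shows "(\<lambda>h. c h + d h) \<in> ell2 I"
proof -
  have "(\<lambda>h. 2 * (cmod (c h))\<^sup>2 + 2 * (cmod (d h))\<^sup>2) summable_on I"
    using assms unfolding ell2_def mem_Collect_eq by (intro summable_on_add summable_on_cmult_right)
  then show ?thesis
    unfolding ell2_def mem_Collect_eq
    by (rule summable_on_comparison_test) (auto simp: cmod_add_power2_le)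
qed

lemma ell2_diff:
  assumes "c \<in> ell2 I" "d \<in> ell2 I"
  shows "(\<lambda>h. c h - d h) \<in> ell2 I"
  using ell2_add[OF assms(1) ell2_scale[OF assms(2), of "-1"]] by simp

text \<open>The limit is taken pointwise; Cauchy estimates on finite sets of indices survive this
  limit and then pass to the infinite sum.\<close>

lemma ell2_complete:
  fixes c :: "nat \<Rightarrow> 'i \<Rightarrow> complex"
  assumes c: "\<And>n. c n \<in> ell2 I"
    and Cau: "\<And>\<epsilon>. 0 < \<epsilon> \<Longrightarrow> \<exists>n0. \<forall>k\<ge>n0. \<forall>n\<ge>n0. (\<Sum>\<^sub>\<infinity>h\<in>I. (cmod (c k h - c n h))\<^sup>2) < \<epsilon>"
  shows "\<exists>d\<in>ell2 I. (\<lambda>n. \<Sum>\<^sub>\<infinity>h\<in>I. (cmod (c n h - d h))\<^sup>2) \<longlonglongrightarrow> 0"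
proof -
  have summ: "(\<lambda>h. (cmod (c k h - c n h))\<^sup>2) summable_on I" for k n
    using ell2_diff[OF c c] by (simp add: ell2_def)
  have fin: "(\<Sum>h\<in>F. (cmod (c k h - c n h))\<^sup>2) \<le> (\<Sum>\<^sub>\<infinity>h\<in>I. (cmod (c k h - c n h))\<^sup>2)"
    if "finite F" "F \<subseteq> I" for F k n
    using that summ by (intro finite_sum_le_infsum) auto
  have "Cauchy (\<lambda>n. c n h)" if "h \<in> I" for h
  proof (rule CauchyI)
    fix e :: real assume "e > 0"
    then obtain n0 where n0: "\<forall>k\<ge>n0. \<forall>n\<ge>n0. (\<Sum>\<^sub>\<infinity>h\<in>I. (cmod (c k h - c n h))\<^sup>2) < e\<^sup>2"
      using Cau[of "e\<^sup>2"] by auto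
    have "cmod (c k h - c n h) < e" if "k \<ge> n0" "n \<ge> n0" for k n
    proof -
      have "(cmod (c k h - c n h))\<^sup>2 < e\<^sup>2"
        using fin[of "{h}" k n] n0 that \<open>h \<in> I\<close> by (auto intro: order.strict_trans1)
      then show ?thesis
        using \<open>e > 0\<close> by (simp add: power_less_imp_less_base)
    qed
    then show "\<exists>M. \<forall>m\<ge>M. \<forall>n\<ge>M. norm (c m h - c n h) < e"
      by blast
  qed
  then have "\<forall>h. \<exists>l. h \<in> I \<longrightarrow> (\<lambda>n. c n h) \<longlonglongrightarrow> l"
    by (meson Cauchy_convergent_iff convergent_def)
  then obtain d where d: "\<And>h. h \<in> I \<Longrightarrow> (\<lambda>n. c n h) \<longlonglongrightarrow> d h"
    by metis
  have bound: "\<exists>n0. \<forall>n\<ge>n0. (\<lambda>h. c n h - d h) \<in> ell2 I \<and> (\<Sum>\<^sub>\<infinity>h\<in>I. (cmod (c n h - d h))\<^sup>2) \<le> e"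
    if "e > 0" for e
  proof -
    obtain n0 where n0: "\<forall>k\<ge>n0. \<forall>n\<ge>n0. (\<Sum>\<^sub>\<infinity>h\<in>I. (cmod (c k h - c n h))\<^sup>2) < e"
      using Cau[OF \<open>e > 0\<close>] by blast
    have le: "(\<Sum>h\<in>F. (cmod (c n h - d h))\<^sup>2) \<le> e" if "n \<ge> n0" "finite F" "F \<subseteq> I" for n F
    proof (rule tendsto_le[OF _ tendsto_const])
      show "(\<lambda>k. \<Sum>h\<in>F. (cmod (c n h - c k h))\<^sup>2) \<longlonglongrightarrow> (\<Sum>h\<in>F. (cmod (c n h - d h))\<^sup>2)"
        using that by (intro tendsto_intros d) auto
      show "\<forall>\<^sub>F k in sequentially. (\<Sum>h\<in>F. (cmod (c n h - c k h))\<^sup>2) \<le> e"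
        using eventually_ge_at_top[of n0]
      proof eventually_elim
        case (elim k)
        then show ?case
          using n0 that fin[of F n k] by (meson less_imp_le order_trans)
      qed
    qed simp
    have "(\<lambda>h. (cmod (c n h - d h))\<^sup>2) summable_on I" if "n \<ge> n0" for n
      using le[OF that] by (intro nonneg_bdd_above_summable_on) (auto intro!: bdd_aboveI2)
    moreover have "(\<Sum>\<^sub>\<infinity>h\<in>I. (cmod (c n h - d h))\<^sup>2) \<le> e" if "n \<ge> n0" for n
      using le[OF that] calculation[OF that] by (intro infsum_le_finite_sums) auto
    ultimately show ?thesis by (auto simp: ell2_def)
  qed
  \<comment> \<open>One index suffices: \<open>d\<close> is the difference of \<open>c n\<close> and
    \<open>c n - d\<close>, both square summable.\<close>
  obtain n where "(\<lambda>h. c n h - d h) \<in> ell2 I"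
    using bound[of 1] by auto
  from ell2_diff[OF c[of n] this] have "d \<in> ell2 I"
    by simp
  moreover have "(\<lambda>n. \<Sum>\<^sub>\<infinity>h\<in>I. (cmod (c n h - d h))\<^sup>2) \<longlonglongrightarrow> 0"
  proof (rule LIMSEQ_I)
    fix r :: real assume "r > 0"
    then obtain n0 where "\<forall>n\<ge>n0. (\<Sum>\<^sub>\<infinity>h\<in>I. (cmod (c n h - d h))\<^sup>2) \<le> r / 2"
      using bound[of "r / 2"] by auto
    moreover have "0 \<le> (\<Sum>\<^sub>\<infinity>h\<in>I. (cmod (c n h - d h))\<^sup>2)" for n
      by (intro infsum_nonneg) auto
    ultimately show "\<exists>n0. \<forall>n\<ge>n0. norm ((\<Sum>\<^sub>\<infinity>h\<in>I. (cmod (c n h - d h))\<^sup>2) - 0) < r"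
      using \<open>r > 0\<close> by (intro exI[of _ n0]) fastforce
  qed
  ultimately show ?thesis by blast
qed

lemma has_sum_sum:
  fixes f :: "'j \<Rightarrow> 'i \<Rightarrow> 'a :: topological_comm_monoid_add"
  assumes "finite A" "\<And>a. a \<in> A \<Longrightarrow> (f a has_sum S a) I"
  shows "((\<lambda>h. \<Sum>a\<in>A. f a h) has_sum (\<Sum>a\<in>A. S a)) I"
  using assms by (induction A) (simp_all add: has_sum_add)

text \<open>Square summability makes the value of a series at \<open>x\<close> continuous in its
  coefficients; independence makes the coefficients unique, so that their norm can serve as a norm
  of the function.\<close>

locale features =
  fixes X :: "'a set" and I :: "'i set" and \<phi> :: "'i \<Rightarrow> 'a \<Rightarrow> complex"
  assumes ell2_feature: "x \<in> X \<Longrightarrow> (\<lambda>h. \<phi> h x) \<in> ell2 I"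
    and features_independent: "c \<in> ell2 I \<Longrightarrow> (\<And>x. x \<in> X \<Longrightarrow> (\<Sum>\<^sub>\<infinity>h\<in>I. c h * \<phi> h x) = 0)
      \<Longrightarrow> h \<in> I \<Longrightarrow> c h = 0"
begin

definition kernel :: "'a \<Rightarrow> 'a \<Rightarrow> complex" where
  "kernel x y = (\<Sum>\<^sub>\<infinity>h\<in>I. \<phi> h x * cnj (\<phi> h y))"

text \<open>Expanding the kernel turns the double sum into a sum of squares, one for each feature:
  the squared modulus of the functional applied to that feature.\<close>

lemma point_functional_bound:
  assumes rkhs: "rkhs X K H ip" and K: "\<And>x y. x \<in> X \<Longrightarrow> y \<in> X \<Longrightarrow> K x y = kernel x y"
    and f: "f \<in> H" "sqrt (Re (ip f f)) \<le> 1" and A: "finite A" "p ` A \<subseteq> X"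
  shows "((\<lambda>h. (cmod (\<Sum>i\<in>A. c i * \<phi> h (p i)))\<^sup>2) summable_on I)" (is ?th1)
    and "(cmod (\<Sum>i\<in>A. c i * f (p i)))\<^sup>2 \<le> (\<Sum>\<^sub>\<infinity>h\<in>I. (cmod (\<Sum>i\<in>A. c i * \<phi> h (p i)))\<^sup>2)" (is ?th2)
proof -
  interpret rkhs X K H ip by fact
  have "((\<lambda>h. \<Sum>i\<in>A. \<Sum>j\<in>A. c i * cnj (c j) * (\<phi> h (p i) * cnj (\<phi> h (p j))))
      has_sum (\<Sum>i\<in>A. \<Sum>j\<in>A. c i * cnj (c j) * K (p i) (p j))) I"
  proof (intro has_sum_sum A has_sum_cmult_right)
    fix i j assume "i \<in> A" "j \<in> A"
    then show "((\<lambda>h. \<phi> h (p i) * cnj (\<phi> h (p j))) has_sum K (p i) (p j)) I"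
      using A by (auto simp: K kernel_def image_subset_iff
          intro!: has_sum_infsum summable_ell2_mult ell2_cnj ell2_feature)
  qed
  also have "(\<lambda>h. \<Sum>i\<in>A. \<Sum>j\<in>A. c i * cnj (c j) * (\<phi> h (p i) * cnj (\<phi> h (p j))))
    = (\<lambda>h. of_real ((cmod (\<Sum>i\<in>A. c i * \<phi> h (p i)))\<^sup>2))"
    unfolding complex_norm_square by (simp add: sum_product mult_ac)
  finally have hs: "((\<lambda>h. (cmod (\<Sum>i\<in>A. c i * \<phi> h (p i)))\<^sup>2)
      has_sum Re (\<Sum>i\<in>A. \<Sum>j\<in>A. c i * cnj (c j) * K (p i) (p j))) I"
    by (drule_tac has_sum_Re) simp
  then show ?th1 by (rule has_sum_imp_summable)
  have "(cmod (\<Sum>i\<in>A. c i * f (p i)))\<^sup>2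
    \<le> Re (ip f f) * Re (\<Sum>i\<in>A. \<Sum>j\<in>A. c i * cnj (c j) * K (p i) (p j))"
    by (intro point_functional_bound A f)
  also have "\<dots> \<le> 1 * Re (\<Sum>i\<in>A. \<Sum>j\<in>A. c i * cnj (c j) * K (p i) (p j))"
    using f(2) has_sum_nonneg[OF hs] by (intro mult_right_mono) auto
  finally show ?th2
    using infsumI[OF hs] by simp
qed

definition synth :: "('i \<Rightarrow> complex) \<Rightarrow> 'a \<Rightarrow> complex" where
  "synth c = (\<lambda>x\<in>X. \<Sum>\<^sub>\<infinity>h\<in>I. c h * \<phi> h x)"

text \<open>The coefficients are recovered by choice. They are unique only on \<open>I\<close>, the
  only place where \<open>inner_prod\<close> reads them.\<close>

definition analysis :: "('a \<Rightarrow> complex) \<Rightarrow> 'i \<Rightarrow> complex" where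
  "analysis f = (SOME c. c \<in> ell2 I \<and> synth c = f)"

definition inner_prod :: "('a \<Rightarrow> complex) \<Rightarrow> ('a \<Rightarrow> complex) \<Rightarrow> complex" where
  "inner_prod f g = (\<Sum>\<^sub>\<infinity>h\<in>I. analysis f h * cnj (analysis g h))"

lemma summable_synth: "c \<in> ell2 I \<Longrightarrow> x \<in> X \<Longrightarrow> (\<lambda>h. c h * \<phi> h x) summable_on I"
  by (intro summable_ell2_mult ell2_feature)

lemma synth_apply: "x \<in> X \<Longrightarrow> synth c x = (\<Sum>\<^sub>\<infinity>h\<in>I. c h * \<phi> h x)"
  by (simp add: synth_def)

lemma eq_synthI: "(\<And>x. x \<in> X \<Longrightarrow> f x = (\<Sum>\<^sub>\<infinity>h\<in>I. c h * \<phi> h x)) \<Longrightarrow> (\<lambda>x\<in>X. f x) = synth c"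
  unfolding synth_def by (rule restrict_ext)

lemma synth_add:
  assumes "c \<in> ell2 I" "d \<in> ell2 I"
  shows "(\<lambda>x\<in>X. synth c x + synth d x) = synth (\<lambda>h. c h + d h)"
  using assms by (intro eq_synthI) (simp add: synth_apply distrib_right infsum_add summable_synth)

lemma synth_scale: "(\<lambda>x\<in>X. a * synth c x) = synth (\<lambda>h. a * c h)"
  by (intro eq_synthI) (simp add: synth_apply mult.assoc infsum_cmult_right')

lemma synth_diff:
  assumes "c \<in> ell2 I" "d \<in> ell2 I"
  shows "(\<lambda>x\<in>X. synth c x - synth d x) = synth (\<lambda>h. c h - d h)"
proof (intro eq_synthI)
  fix x assume x: "x \<in> X"
  have "(\<Sum>\<^sub>\<infinity>h\<in>I. c h * \<phi> h x + - (d h * \<phi> h x)) = (\<Sum>\<^sub>\<infinity>h\<in>I. c h * \<phi> h x) + - (\<Sum>\<^sub>\<infinity>h\<in>I. d h * \<phi> h x)"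
    using assms x by (subst infsum_add) (auto simp: infsum_uminus summable_on_uminus intro: summable_synth)
  then show "synth c x - synth d x = (\<Sum>\<^sub>\<infinity>h\<in>I. (c h - d h) * \<phi> h x)"
    using x by (simp add: synth_apply left_diff_distrib)
qed

lemma synth_inject:
  assumes "c \<in> ell2 I" "d \<in> ell2 I" "synth c = synth d" "h \<in> I"
  shows "c h = d h"
proof -
  have "synth (\<lambda>h. c h - d h) = (\<lambda>x\<in>X. 0)"
    unfolding synth_diff[OF assms(1,2), symmetric] assms(3) by simp
  then have "(\<Sum>\<^sub>\<infinity>h\<in>I. (c h - d h) * \<phi> h x) = 0" if "x \<in> X" for x
    using that synth_apply[OF that, of "\<lambda>h. c h - d h"] by simp
  from features_independent[OF ell2_diff[OF assms(1,2)] this assms(4)] show ?thesis by simp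
qed

lemma inner_prod_synth:
  assumes "c \<in> ell2 I" "d \<in> ell2 I"
  shows "inner_prod (synth c) (synth d) = (\<Sum>\<^sub>\<infinity>h\<in>I. c h * cnj (d h))"
proof -
  have "analysis (synth c) h = c h" if "c \<in> ell2 I" "h \<in> I" for c h
  proof -
    have "analysis (synth c) \<in> ell2 I \<and> synth (analysis (synth c)) = synth c"
      unfolding analysis_def
      by (rule someI[where P = "\<lambda>d. d \<in> ell2 I \<and> synth d = synth c" and x = c]) (simp add: that)
    then show ?thesis using synth_inject[of "analysis (synth c)" c h] that by simp
  qed
  then show ?thesis
    unfolding inner_prod_def using assms by (intro infsum_cong) simp
qed

lemma inner_prod_self:
  assumes "c \<in> ell2 I"
  shows "inner_prod (synth c) (synth c) = of_real (\<Sum>\<^sub>\<infinity>h\<in>I. (cmod (c h))\<^sup>2)"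
proof -
  have "((\<lambda>h. (cmod (c h))\<^sup>2) has_sum (\<Sum>\<^sub>\<infinity>h\<in>I. (cmod (c h))\<^sup>2)) I"
    using assms unfolding ell2_def by (intro has_sum_infsum) simp
  then have "((\<lambda>h. complex_of_real ((cmod (c h))\<^sup>2)) has_sum of_real (\<Sum>\<^sub>\<infinity>h\<in>I. (cmod (c h))\<^sup>2)) I"
    by (rule has_sum_of_real)
  then show ?thesis
    unfolding inner_prod_synth[OF assms assms] complex_norm_square by (rule infsumI)
qed

text \<open>The structure is transported from square-summable coefficients along
  \<open>synth\<close>, including completeness. The kernel section at \<open>y\<close> has
  coefficients \<open>cnj (\<phi> h y)\<close>, so the inner product with it is the series evaluated
  at \<open>y\<close>.\<close>

theorem rkhs_features: "rkhs X kernel (synth ` ell2 I) inner_prod"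
proof
  show "synth ` ell2 I \<subseteq> extensional X"
    unfolding synth_def by auto
  have "(\<lambda>_. 0) \<in> ell2 I"
    by (simp add: ell2_def)
  moreover have "(\<lambda>x\<in>X. 0) = synth (\<lambda>_. 0)"
    by (rule eq_synthI) simp
  ultimately show "(\<lambda>x\<in>X. 0) \<in> synth ` ell2 I"
    by (simp only: image_eqI)
next
  fix f g assume "f \<in> synth ` ell2 I" "g \<in> synth ` ell2 I"
  then obtain c d where f: "c \<in> ell2 I" "f = synth c" and g: "d \<in> ell2 I" "g = synth d"
    by blast
  show "(\<lambda>x\<in>X. f x + g x) \<in> synth ` ell2 I"
    unfolding f(2) g(2) synth_add[OF f(1) g(1)] by (intro imageI ell2_add f g)
  show "inner_prod g f = cnj (inner_prod f g)"
    unfolding f(2) g(2) inner_prod_synth[OF f(1) g(1)] inner_prod_synth[OF g(1) f(1)] infsum_cnj[symmetric]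
    by (simp add: mult.commute)
  fix h assume "h \<in> synth ` ell2 I"
  then obtain e where h: "e \<in> ell2 I" "h = synth e"
    by blast
  show "inner_prod (\<lambda>x\<in>X. f x + g x) h = inner_prod f h + inner_prod g h"
    unfolding f(2) g(2) h(2) synth_add[OF f(1) g(1)] inner_prod_synth[OF ell2_add[OF f(1) g(1)] h(1)]
      inner_prod_synth[OF f(1) h(1)] inner_prod_synth[OF g(1) h(1)] distrib_right
    by (rule infsum_add) (rule summable_ell2_mult f g ell2_cnj[OF h(1)])+
next
  fix f a assume "f \<in> synth ` ell2 I"
  then obtain c where f: "c \<in> ell2 I" "f = synth c"
    by blast
  show "(\<lambda>x\<in>X. a * f x) \<in> synth ` ell2 I"
    unfolding f(2) synth_scale by (intro imageI ell2_scale f)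
  show "0 \<le> Re (inner_prod f f)"
    unfolding f(2) inner_prod_self[OF f(1)] Re_complex_of_real by (rule infsum_nonneg) simp
  fix h assume "h \<in> synth ` ell2 I"
  then obtain e where h: "e \<in> ell2 I" "h = synth e"
    by blast
  show "inner_prod (\<lambda>x\<in>X. a * f x) h = a * inner_prod f h"
    unfolding f(2) h(2) synth_scale inner_prod_synth[OF ell2_scale[OF f(1)] h(1)]
      inner_prod_synth[OF f(1) h(1)] mult.assoc
    by (rule infsum_cmult_right')
next
  fix f assume "f \<in> synth ` ell2 I" and 0: "inner_prod f f = 0"
  then obtain c where f: "c \<in> ell2 I" "f = synth c"
    by blast
  have c: "(\<Sum>\<^sub>\<infinity>h\<in>I. (cmod (c h))\<^sup>2) = 0"
    using 0 unfolding f(2) inner_prod_self[OF f(1)] by simp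
  have "(cmod (c h))\<^sup>2 = 0" if "h \<in> I" for h
    using c f(1) that by (intro nonneg_infsum_le_0D[of "\<lambda>h. (cmod (c h))\<^sup>2" I]) (simp_all add: ell2_def)
  then have "(\<Sum>\<^sub>\<infinity>h\<in>I. c h * \<phi> h x) = 0" for x
    by (intro infsum_0) simp
  then show "f = (\<lambda>x\<in>X. 0)"
    unfolding f(2) by (intro eq_synthI[symmetric]) simp
next
  fix F :: "nat \<Rightarrow> 'a \<Rightarrow> complex"
  assume F: "\<And>n. F n \<in> synth ` ell2 I"
    and Cau: "\<And>\<epsilon>. 0 < \<epsilon> \<Longrightarrow> \<exists>n0. \<forall>k\<ge>n0. \<forall>n\<ge>n0.
      sqrt (Re (inner_prod (\<lambda>x\<in>X. F k x - F n x) (\<lambda>x\<in>X. F k x - F n x))) < \<epsilon>"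
  from F have "\<forall>n. \<exists>c. c \<in> ell2 I \<and> F n = synth c"
    by blast
  then obtain c where c: "\<And>n. c n \<in> ell2 I" and Fc: "\<And>n. F n = synth (c n)"
    by metis
  have norm: "Re (inner_prod (\<lambda>x\<in>X. F k x - synth d x) (\<lambda>x\<in>X. F k x - synth d x))
      = (\<Sum>\<^sub>\<infinity>h\<in>I. (cmod (c k h - d h))\<^sup>2)" if "d \<in> ell2 I" for k d
    unfolding Fc synth_diff[OF c that] inner_prod_self[OF ell2_diff[OF c that]] by simp
  \<comment> \<open>The Cauchy hypothesis bounds norms while \<open>ell2_complete\<close> asks for
    squared norms, hence the instance \<open>sqrt \<epsilon>\<close>.\<close>
  have "\<exists>n0. \<forall>k\<ge>n0. \<forall>n\<ge>n0. (\<Sum>\<^sub>\<infinity>h\<in>I. (cmod (c k h - c n h))\<^sup>2) < \<epsilon>" if "\<epsilon> > 0" for \<epsilon>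
    using Cau[of "sqrt \<epsilon>"] that unfolding Fc norm[OF c, unfolded Fc] by simp
  from ell2_complete[OF c this] obtain d where d: "d \<in> ell2 I"
    and lim: "(\<lambda>n. \<Sum>\<^sub>\<infinity>h\<in>I. (cmod (c n h - d h))\<^sup>2) \<longlonglongrightarrow> 0"
    by blast
  have "(\<lambda>n. sqrt (\<Sum>\<^sub>\<infinity>h\<in>I. (cmod (c n h - d h))\<^sup>2)) \<longlonglongrightarrow> 0"
    using tendsto_real_sqrt[OF lim] by simp
  then show "\<exists>f\<in>synth ` ell2 I. (\<lambda>n. sqrt (Re (inner_prod (\<lambda>x\<in>X. F n x - f x) (\<lambda>x\<in>X. F n x - f x)))) \<longlonglongrightarrow> 0"
    unfolding norm[OF d, symmetric] using d by blast
next
  fix y assume y: "y \<in> X"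
  have eq: "(\<lambda>x\<in>X. kernel x y) = synth (\<lambda>h. cnj (\<phi> h y))"
    by (rule eq_synthI) (simp add: kernel_def mult.commute)
  have e: "(\<lambda>h. cnj (\<phi> h y)) \<in> ell2 I"
    using y by (intro ell2_cnj ell2_feature)
  show "(\<lambda>x\<in>X. kernel x y) \<in> synth ` ell2 I"
    unfolding eq using e by (rule imageI)
  fix f assume "f \<in> synth ` ell2 I"
  then obtain c where f: "c \<in> ell2 I" "f = synth c"
    by blast
  show "f y = inner_prod f (\<lambda>x\<in>X. kernel x y)"
    unfolding eq f(2) inner_prod_synth[OF f(1) e] using y by (simp add: synth_apply)
qed

end

section \<open>Product weights\<close>

lemma r_decay_pos: "b > 0 \<Longrightarrow> r_decay b \<alpha> k > 0"
  by (simp add: r_decay_def)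

lemma r_decay_powr: "b > 0 \<Longrightarrow> r_decay b \<alpha> k powr t = r_decay b (\<alpha> * t) k"
  by (simp add: r_decay_def powr_powr mult_ac)

text \<open>Rounding the logarithm down costs at most a factor \<open>b powr \<beta>\<close>. The
  comparison with a power of \<open>k\<close> yields summability for
  \<open>\<beta> > 1\<close>.\<close>

lemma r_decay_le:
  assumes "b > 1" "\<beta> > 0" "k \<ge> 1"
  shows "r_decay b \<beta> k \<le> real b powr \<beta> * real k powr (- \<beta>)"
proof -
  have "log b k - 1 \<le> psi b k"
    unfolding psi_def by linarith
  then have "- \<beta> * psi b k \<le> - \<beta> * (log b k - 1)"
    using assms by (intro mult_left_mono_neg) auto
  then have "r_decay b \<beta> k \<le> real b powr (- \<beta> * (log b k - 1))"
    unfolding r_decay_def using assms by (intro powr_mono) auto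
  also have "\<dots> = real b powr (\<beta> + log b k * (- \<beta>))"
    by (simp add: algebra_simps)
  also have "\<dots> = real b powr \<beta> * (real b powr log b k) powr (- \<beta>)"
    by (simp only: powr_add powr_powr)
  also have "real b powr log b k = real k"
    using assms by (simp add: powr_log_cancel)
  finally show ?thesis .
qed

text \<open>Multiplication by \<open>b ^ v\<close> moves the leading digit up by \<open>v\<close>
  places; this evaluates sums of weights over the multiples of \<open>b ^ v\<close>.\<close>

lemma r_decay_mult_pow:
  assumes "b > 1" "k \<ge> 1"
  shows "r_decay b \<beta> (b ^ v * k) = real b powr (- \<beta> * real v) * r_decay b \<beta> k"
proof -
  have "log b (real (b ^ v * k)) = log b (real k) + of_int (int v)"
    using assms by (simp add: log_mult log_nat_power)
  then have "psi b (b ^ v * k) = psi b k + int v"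
    unfolding psi_def by (simp only: floor_add_int)
  then show ?thesis
    by (simp add: r_decay_def powr_add[symmetric] algebra_simps)
qed

lemma summable_r_decay:
  assumes "b > 1" "\<beta> > 1"
  shows "summable (\<lambda>h. r_decay b \<beta> (Suc h))"
proof (rule summable_comparison_test')
  have "summable (\<lambda>k. real k powr (- \<beta>))"
    using assms by (simp add: summable_real_powr_iff)
  then have "summable (\<lambda>h. real (Suc h) powr (- \<beta>))"
    by (subst (asm) summable_Suc_iff[symmetric])
  then show "summable (\<lambda>h. real b powr \<beta> * real (Suc h) powr (- \<beta>))"
    by (rule summable_mult)
  show "norm (r_decay b \<beta> (Suc h)) \<le> real b powr \<beta> * real (Suc h) powr (- \<beta>)" for h
    using r_decay_le[of b \<beta> "Suc h"] r_decay_pos[of b \<beta> "Suc h"] assms by simp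
qed

lemma has_sum_mu:
  assumes "b > 1" "\<beta> > 1"
  shows "(r_decay b \<beta> has_sum mu b \<beta>) {1..}"
proof -
  have "((\<lambda>h. r_decay b \<beta> (Suc h)) has_sum mu b \<beta>) UNIV"
    unfolding mu_def using summable_r_decay[OF assms] r_decay_pos[of b \<beta>] assms
    by (intro sums_nonneg_imp_has_sum summable_sums) (auto intro: less_imp_le)
  moreover have "range Suc = {1..}"
    by (auto simp: image_iff Suc_le_eq gr0_conv_Suc)
  ultimately show ?thesis
    using has_sum_reindex[of Suc UNIV "r_decay b \<beta>" "mu b \<beta>"] by (simp add: o_def)
qed

lemma mu_pos:
  assumes "b > 1" "\<beta> > 1"
  shows "mu b \<beta> > 0"
  unfolding mu_def using r_decay_pos assms by (intro suminf_pos summable_r_decay) auto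

definition freqs :: "nat set \<Rightarrow> (nat \<Rightarrow> nat) set" where
  "freqs J = J \<rightarrow>\<^sub>E UNIV"

text \<open>The value 1 at \<open>k = 0\<close> lets one product over all coordinates encode every
  subset: the subset belonging to \<open>h\<close> is its support, and empty support accounts for
  the constant 1 of the kernel.\<close>

definition coord_weight :: "nat \<Rightarrow> real \<Rightarrow> (nat \<Rightarrow> real) \<Rightarrow> nat \<Rightarrow> nat \<Rightarrow> real" where
  "coord_weight b \<alpha> \<gamma> j k = (if k = 0 then 1 else \<gamma> j * r_decay b \<alpha> k)"

definition weight :: "nat \<Rightarrow> real \<Rightarrow> (nat \<Rightarrow> real) \<Rightarrow> nat set \<Rightarrow> (nat \<Rightarrow> nat) \<Rightarrow> real" where
  "weight b \<alpha> \<gamma> J h = (\<Prod>j\<in>J. coord_weight b \<alpha> \<gamma> j (h j))"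

lemma has_sum_from_1:
  fixes f :: "nat \<Rightarrow> 'a :: topological_comm_monoid_add"
  assumes "(f has_sum S) {1..}"
  shows "(f has_sum (f 0 + S)) UNIV"
proof -
  have "(f has_sum (f 0 + S)) ({0} \<union> {1..})"
    using assms by (intro has_sum_Un_disjoint) (auto intro: has_sum_finiteI)
  moreover have "{0::nat} \<union> {1..} = UNIV"
    by auto
  ultimately show ?thesis
    by simp
qed

lemma coord_weight_pos: "b > 0 \<Longrightarrow> \<gamma> j > 0 \<Longrightarrow> coord_weight b \<alpha> \<gamma> j k > 0"
  by (simp add: coord_weight_def r_decay_pos)

lemma weight_pos: "b > 0 \<Longrightarrow> (\<And>j. j \<in> J \<Longrightarrow> \<gamma> j > 0) \<Longrightarrow> weight b \<alpha> \<gamma> J h > 0"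
  by (auto simp: weight_def intro!: prod_pos coord_weight_pos)

text \<open>Powers of product weights are again product weights, with new parameters. Estimates for
  general parameters can therefore be reused after Jensen's inequality.\<close>

lemma weight_powr:
  assumes "b > 0" "\<And>j. j \<in> J \<Longrightarrow> \<gamma> j > 0"
  shows "weight b \<alpha> \<gamma> J h powr t = weight b (\<alpha> * t) (\<lambda>j. \<gamma> j powr t) J h"
proof -
  have "coord_weight b \<alpha> \<gamma> j k powr t = coord_weight b (\<alpha> * t) (\<lambda>j. \<gamma> j powr t) j k" if "j \<in> J" for j k
    using assms that r_decay_pos[of b \<alpha> k] by (simp add: coord_weight_def powr_mult r_decay_powr)
  then show ?thesis
    unfolding weight_def prod_powr_distrib by (intro prod.cong) simp_all
qed

lemma has_sum_coord_weight:
  assumes "b > 1" "\<alpha> > 1"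
  shows "(coord_weight b \<alpha> \<gamma> j has_sum (1 + \<gamma> j * mu b \<alpha>)) UNIV"
proof -
  have "((\<lambda>k. \<gamma> j * r_decay b \<alpha> k) has_sum \<gamma> j * mu b \<alpha>) {1..}"
    using assms by (intro has_sum_cmult_right has_sum_mu)
  moreover have "(coord_weight b \<alpha> \<gamma> j has_sum \<gamma> j * mu b \<alpha>) {1..}
      \<longleftrightarrow> ((\<lambda>k. \<gamma> j * r_decay b \<alpha> k) has_sum \<gamma> j * mu b \<alpha>) {1..}"
    by (rule has_sum_cong) (simp add: coord_weight_def)
  ultimately have "(coord_weight b \<alpha> \<gamma> j has_sum \<gamma> j * mu b \<alpha>) {1..}"
    by blast
  from has_sum_from_1[OF this] show ?thesis
    by (simp add: coord_weight_def)
qed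

text \<open>A finite set of functions lies in the box spanned by its coordinate projections. Over
  this box the sum factors, and each factor is bounded by the full one-dimensional sum.\<close>

lemma summable_on_prod_PiE:
  fixes f :: "'a \<Rightarrow> 'b \<Rightarrow> real"
  assumes "finite A" "\<And>x. x \<in> A \<Longrightarrow> f x summable_on B x"
    and nonneg: "\<And>x y. x \<in> A \<Longrightarrow> y \<in> B x \<Longrightarrow> f x y \<ge> 0"
  shows "(\<lambda>g. \<Prod>x\<in>A. f x (g x)) summable_on (PiE A B)"
proof (rule nonneg_bdd_above_summable_on)
  show "0 \<le> (\<Prod>x\<in>A. f x (g x))" if "g \<in> PiE A B" for g
    using that nonneg by (intro prod_nonneg) (auto simp: PiE_iff)
  show "bdd_above (sum (\<lambda>g. \<Prod>x\<in>A. f x (g x)) ` {F. F \<subseteq> PiE A B \<and> finite F})"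
  proof (rule bdd_aboveI2)
    fix F assume "F \<in> {F. F \<subseteq> PiE A B \<and> finite F}"
    then have F: "F \<subseteq> PiE A B" "finite F" by auto
    let ?C = "\<lambda>x. (\<lambda>g. g x) ` F"
    have "(\<Sum>g\<in>F. \<Prod>x\<in>A. f x (g x)) \<le> (\<Sum>g\<in>PiE A ?C. \<Prod>x\<in>A. f x (g x))"
    proof (intro sum_mono2 prod_nonneg nonneg)
      show "finite (PiE A ?C)"
        using assms F by (intro finite_PiE) auto
      show "F \<subseteq> PiE A ?C"
        using F by (auto simp: PiE_iff)
      fix g x assume "g \<in> PiE A ?C - F" "x \<in> A"
      then have "g x \<in> ?C x" by auto
      then show "g x \<in> B x" using F \<open>x \<in> A\<close> PiE_mem by fastforce
    qed
    also have "\<dots> = (\<Prod>x\<in>A. sum (f x) (?C x))"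
      using assms F by (subst prod_sum_PiE) auto
    also have "\<dots> \<le> (\<Prod>x\<in>A. infsum (f x) (B x))"
    proof (intro prod_mono conjI sum_nonneg finite_sum_le_infsum)
      fix x assume x: "x \<in> A"
      show "f x summable_on B x" using assms x by blast
      show "finite (?C x)" using F by blast
      show "?C x \<subseteq> B x" using F x by auto
      show "0 \<le> f x y" if "y \<in> ?C x" for y using nonneg x that F by auto
      show "0 \<le> f x y" if "y \<in> B x - ?C x" for y using nonneg x that by auto
    qed
    finally show "(\<Sum>g\<in>F. \<Prod>x\<in>A. f x (g x)) \<le> (\<Prod>x\<in>A. infsum (f x) (B x))" .
  qed
qed

lemma has_sum_weight:
  assumes "b > 1" "\<alpha> > 1" "finite J" "\<And>j. j \<in> J \<Longrightarrow> \<gamma> j > 0"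
  shows "(weight b \<alpha> \<gamma> J has_sum (\<Prod>j\<in>J. 1 + \<gamma> j * mu b \<alpha>)) (freqs J)"
proof -
  have s: "coord_weight b \<alpha> \<gamma> j summable_on UNIV" for j
    using has_sum_coord_weight[OF assms(1,2)] by (rule has_sum_imp_summable)
  have "weight b \<alpha> \<gamma> J summable_on freqs J"
    unfolding weight_def freqs_def using assms s
    by (intro summable_on_prod_PiE) (auto intro!: less_imp_le coord_weight_pos)
  moreover have "infsum (weight b \<alpha> \<gamma> J) (freqs J) = (\<Prod>j\<in>J. infsum (coord_weight b \<alpha> \<gamma> j) UNIV)"
    using calculation unfolding weight_def freqs_def using assms s by (intro infsum_prod_PiE) auto
  moreover have "infsum (coord_weight b \<alpha> \<gamma> j) UNIV = 1 + \<gamma> j * mu b \<alpha>" for j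
    using has_sum_coord_weight[OF assms(1,2)] by (rule infsumI)
  ultimately show ?thesis
    using has_sum_infsum[of "weight b \<alpha> \<gamma> J" "freqs J"] by simp
qed

section \<open>The Walsh expansion of the kernel\<close>

definition walsh_prod :: "nat \<Rightarrow> nat \<Rightarrow> (nat \<Rightarrow> nat) \<Rightarrow> (nat \<Rightarrow> real) \<Rightarrow> complex" where
  "walsh_prod b s h x = (\<Prod>j\<in>{1..s}. wal b (h j) (x j))"

lemma wal_0 [simp]: "wal b 0 x = 1"
  by (simp add: wal_def base_digit_def)

lemma norm_walsh_prod [simp]: "norm (walsh_prod CARD('p::prime_card) s h x) = 1"
  by (simp add: walsh_prod_def prod_norm[symmetric])

text \<open>Each coordinate contributes 1 plus a series over \<open>k \<ge> 1\<close>. Multiplying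
  out over subsets gives the kernel as defined, and absolute convergence lets the product of series
  become one series over all frequency vectors.\<close>

lemma walsh_kernel_eq:
  assumes "\<alpha> > 1"
  shows "walsh_kernel CARD('p::prime_card) s \<alpha> (\<lambda>u. \<Prod>j\<in>u. \<gamma> j) x y
    = (\<Sum>\<^sub>\<infinity>h\<in>freqs {1..s}. of_real (weight CARD('p) \<alpha> \<gamma> {1..s} h)
        * (walsh_prod CARD('p) s h x * cnj (walsh_prod CARD('p) s h y)))"
proof -
  let ?b = "CARD('p)"
  have b: "?b > 1" by (rule card_gt_1)
  define f where "f j k = wal ?b k (x j) * cnj (wal ?b k (y j))" for j k
  define R where "R j k = complex_of_real (\<gamma> j * r_decay ?b \<alpha> k) * f j k" for j k
  define F where "F j k = complex_of_real (coord_weight ?b \<alpha> \<gamma> j k) * f j k" for j k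
  have norm_f: "norm (f j k) = 1" for j k
    by (simp add: f_def norm_mult)
  have absR: "(\<lambda>k. norm (R j k)) summable_on {1..}" for j
  proof -
    have "(\<lambda>k. \<bar>\<gamma> j\<bar> * r_decay ?b \<alpha> k) summable_on {1..}"
      using has_sum_mu[OF b assms] by (intro summable_on_cmult_right has_sum_imp_summable)
    moreover have "norm (R j k) = \<bar>\<gamma> j\<bar> * r_decay ?b \<alpha> k" for k
      using r_decay_pos[of ?b \<alpha> k] by (simp add: R_def norm_mult norm_f abs_mult)
    ultimately show ?thesis
      by simp
  qed
  have sumF: "(F j has_sum (1 + infsum (R j) {1..})) UNIV" for j
  proof -
    have "(R j has_sum infsum (R j) {1..}) {1..}"
      by (rule has_sum_infsum, rule Infinite_Sum.abs_summable_summable, rule absR)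
    moreover have "(R j has_sum infsum (R j) {1..}) {1..} \<longleftrightarrow> (F j has_sum infsum (R j) {1..}) {1..}"
      by (rule has_sum_cong) (simp add: F_def R_def coord_weight_def)
    ultimately have "(F j has_sum infsum (R j) {1..}) {1..}"
      by blast
    from has_sum_from_1[OF this] show ?thesis
      by (simp add: F_def f_def coord_weight_def)
  qed
  have absF: "(\<lambda>k. norm (F j k)) summable_on UNIV" for j
    using has_sum_imp_summable[OF sumF] by (simp only: summable_on_iff_abs_summable_on_complex)
  have "(\<Sum>\<^sub>\<infinity>h\<in>freqs {1..s}. of_real (weight ?b \<alpha> \<gamma> {1..s} h)
        * (walsh_prod ?b s h x * cnj (walsh_prod ?b s h y)))
    = (\<Sum>\<^sub>\<infinity>h\<in>{1..s} \<rightarrow>\<^sub>E UNIV. \<Prod>j\<in>{1..s}. F j (h j))"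
    by (simp add: freqs_def weight_def walsh_prod_def F_def f_def prod.distrib)
  also have "\<dots> = (\<Prod>j\<in>{1..s}. infsum (F j) UNIV)"
    by (intro infsum_prod_PiE_abs absF) simp
  also have "\<dots> = (\<Prod>j\<in>{1..s}. infsum (R j) {1..} + 1)"
    using infsumI[OF sumF] by (simp add: add.commute)
  also have "\<dots> = (\<Sum>u\<in>Pow {1..s}. \<Prod>j\<in>u. infsum (R j) {1..})"
    by (subst prod_add) simp_all
  also have "\<dots> = 1 + (\<Sum>u\<in>Pow {1..s} - {{}}. \<Prod>j\<in>u. infsum (R j) {1..})"
    by (subst sum.remove[of _ "{}"]) auto
  also have "(\<Sum>u\<in>Pow {1..s} - {{}}. \<Prod>j\<in>u. infsum (R j) {1..})
    = (\<Sum>u\<in>Pow {1..s} - {{}}. of_real (\<Prod>j\<in>u. \<gamma> j) *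
            (\<Sum>\<^sub>\<infinity>h\<in>u \<rightarrow>\<^sub>E {1..}. of_real (\<Prod>j\<in>u. r_decay ?b \<alpha> (h j)) *
               (\<Prod>j\<in>u. wal ?b (h j) (x j)) * cnj (\<Prod>j\<in>u. wal ?b (h j) (y j))))"
  proof (intro sum.cong refl)
    fix u assume "u \<in> Pow {1..s} - {{}}"
    then have u: "finite u" by (auto intro: finite_subset)
    have "(\<Prod>j\<in>u. infsum (R j) {1..}) = (\<Sum>\<^sub>\<infinity>h\<in>u \<rightarrow>\<^sub>E {1..}. \<Prod>j\<in>u. R j (h j))"
      by (intro infsum_prod_PiE_abs[symmetric] absR u)
    also have "\<dots> = (\<Sum>\<^sub>\<infinity>h\<in>u \<rightarrow>\<^sub>E {1..}. of_real (\<Prod>j\<in>u. \<gamma> j) * (of_real (\<Prod>j\<in>u. r_decay ?b \<alpha> (h j)) *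
               (\<Prod>j\<in>u. wal ?b (h j) (x j)) * cnj (\<Prod>j\<in>u. wal ?b (h j) (y j))))"
      by (simp add: R_def f_def prod.distrib mult_ac)
    finally show "(\<Prod>j\<in>u. infsum (R j) {1..}) = of_real (\<Prod>j\<in>u. \<gamma> j) *
            (\<Sum>\<^sub>\<infinity>h\<in>u \<rightarrow>\<^sub>E {1..}. of_real (\<Prod>j\<in>u. r_decay ?b \<alpha> (h j)) *
               (\<Prod>j\<in>u. wal ?b (h j) (x j)) * cnj (\<Prod>j\<in>u. wal ?b (h j) (y j)))"
      by (simp only: infsum_cmult_right')
  qed
  finally show ?thesis
    by (simp only: walsh_kernel_def)
qed

section \<open>Grid means and integration\<close>

definition freq_box :: "nat \<Rightarrow> nat \<Rightarrow> nat \<Rightarrow> (nat \<Rightarrow> nat) set" where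
  "freq_box b s M = {1..s} \<rightarrow>\<^sub>E {..<b ^ M}"

definition grid_point :: "nat \<Rightarrow> nat \<Rightarrow> nat \<Rightarrow> (nat \<Rightarrow> nat) \<Rightarrow> nat \<Rightarrow> real" where
  "grid_point b s M k = (\<lambda>j\<in>{1..s}. real (k j) / real b ^ M)"

definition grid_mean :: "nat \<Rightarrow> nat \<Rightarrow> nat \<Rightarrow> ((nat \<Rightarrow> real) \<Rightarrow> complex) \<Rightarrow> complex" where
  "grid_mean b s M f = (\<Sum>k\<in>freq_box b s M. f (grid_point b s M k)) / of_nat (b ^ (M * s))"

definition trunc :: "nat \<Rightarrow> nat \<Rightarrow> nat \<Rightarrow> (nat \<Rightarrow> real) \<Rightarrow> nat \<Rightarrow> real" where
  "trunc b s M x = (\<lambda>j\<in>{1..s}. of_int \<lfloor>x j * real b ^ M\<rfloor> / real b ^ M)"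

lemma finite_freq_box [simp]: "finite (freq_box b s M)"
  by (simp add: freq_box_def finite_PiE)

lemma freq_box_subset: "freq_box b s M \<subseteq> freqs {1..s}"
  by (auto simp: freq_box_def freqs_def PiE_iff)

lemma grid_point_in_unit_cube: "b > 0 \<Longrightarrow> k \<in> freq_box b s M \<Longrightarrow> grid_point b s M k \<in> unit_cube s"
  by (auto simp: grid_point_def unit_cube_def freq_box_def PiE_iff simp flip: of_nat_power)

lemma trunc_in_unit_cube:
  assumes "b > 0" "x \<in> unit_cube s"
  shows "trunc b s M x \<in> unit_cube s"
proof -
  have "of_int \<lfloor>x j * real b ^ M\<rfloor> / real b ^ M \<in> {0..<1}" if "j \<in> {1..s}" for j
  proof -
    have x: "0 \<le> x j" "x j < 1"
      using assms that by (auto simp: unit_cube_def PiE_iff)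
    have b: "real b ^ M > 0" using assms by simp
    have "of_int \<lfloor>x j * real b ^ M\<rfloor> \<le> x j * real b ^ M"
      by simp
    also have "\<dots> < real b ^ M"
      using x b by simp
    finally show ?thesis
      using x b by simp
  qed
  then show ?thesis
    unfolding trunc_def unit_cube_def by (intro restrict_PiE_iff[THEN iffD2]) blast
qed

lemma eventually_freq_box:
  assumes "b > 1" "h \<in> freqs {1..s}"
  shows "\<forall>\<^sub>F M in sequentially. h \<in> freq_box b s M"
proof -
  have "\<forall>\<^sub>F M in sequentially. \<forall>j\<in>{1..s}. h j < b ^ M"
  proof (intro eventually_ball_finite ballI)
    fix j
    show "\<forall>\<^sub>F M in sequentially. h j < b ^ M"
      using eventually_ge_at_top[of "h j"]
    proof eventually_elim
      case (elim M)
      have "h j < 2 ^ h j" by (rule less_exp)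
      also have "\<dots> \<le> b ^ h j" using assms by (intro power_mono) auto
      also have "\<dots> \<le> b ^ M" using assms elim by (intro power_increasing) auto
      finally show ?case .
    qed
  qed simp
  then show ?thesis
    by eventually_elim (use assms in \<open>auto simp: freq_box_def freqs_def PiE_iff\<close>)
qed

text \<open>The boxes eventually contain any given finite set of frequencies, so the sums over them
  converge along the filter that defines \<open>infsum\<close>.\<close>

lemma tail_tendsto_0:
  fixes f :: "(nat \<Rightarrow> nat) \<Rightarrow> real"
  assumes "b > 1" "f summable_on freqs {1..s}"
  shows "(\<lambda>M. infsum f (freqs {1..s} - freq_box b s M)) \<longlonglongrightarrow> 0"
proof -
  have "filterlim (freq_box b s) (finite_subsets_at_top (freqs {1..s})) sequentially"
    unfolding filterlim_finite_subsets_at_top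
  proof (intro allI impI)
    fix X assume X: "finite X \<and> X \<subseteq> freqs {1..s}"
    have "\<forall>\<^sub>F M in sequentially. \<forall>h\<in>X. h \<in> freq_box b s M"
      using X assms by (intro eventually_ball_finite ballI eventually_freq_box) auto
    then show "\<forall>\<^sub>F M in sequentially. finite (freq_box b s M) \<and> X \<subseteq> freq_box b s M \<and> freq_box b s M \<subseteq> freqs {1..s}"
      by eventually_elim (intro conjI finite_freq_box freq_box_subset subsetI; blast)
  qed
  then have "(\<lambda>M. sum f (freq_box b s M)) \<longlonglongrightarrow> infsum f (freqs {1..s})"
    by (rule filterlim_compose[OF infsum_tendsto[OF assms(2)]])
  then have "(\<lambda>M. infsum f (freqs {1..s}) - sum f (freq_box b s M)) \<longlonglongrightarrow> infsum f (freqs {1..s}) - infsum f (freqs {1..s})"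
    by (intro tendsto_intros)
  moreover have "infsum f (freqs {1..s}) - sum f (freq_box b s M) = infsum f (freqs {1..s} - freq_box b s M)" for M
  proof -
    have "freq_box b s M \<union> (freqs {1..s} - freq_box b s M) = freqs {1..s}"
      using freq_box_subset by blast
    then have "infsum f (freqs {1..s}) = infsum f (freq_box b s M) + infsum f (freqs {1..s} - freq_box b s M)"
      using infsum_Un_disjoint[of f "freq_box b s M" "freqs {1..s} - freq_box b s M"]
        summable_on_subset_banach[OF assms(2), of "freqs {1..s} - freq_box b s M"] by simp
    then show ?thesis by simp
  qed
  ultimately show ?thesis by simp
qed

lemma infsum_le_tail:
  fixes f g :: "'i \<Rightarrow> real"
  assumes "f summable_on I" "g summable_on I"
    and "\<And>h. h \<in> I \<inter> B \<Longrightarrow> g h \<le> 0" "\<And>h. h \<in> I - B \<Longrightarrow> g h \<le> f h"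
  shows "infsum g I \<le> infsum f (I - B)"
  using assms summable_on_subset_banach[OF assms(1), of "I - B"]
  by (intro infsum_mono_neutral) auto

text \<open>The grid points are the values \<open>nu M v\<close>, so this is orthogonality of
  characters for \<open>tr M h - tr M l\<close>. Frequencies congruent modulo \<open>b ^ M\<close>
  cannot be told apart on the grid.\<close>

lemma mean_wal:
  assumes "M \<ge> 1"
  shows "(\<Sum>k<CARD('p::prime_card) ^ M. wal CARD('p) h (real k / real CARD('p) ^ M)
      * cnj (wal CARD('p) l (real k / real CARD('p) ^ M))) / of_nat (CARD('p) ^ M)
    = of_bool (h mod CARD('p) ^ M = l mod CARD('p) ^ M)"
proof -
  let ?b = "CARD('p)"
  let ?f = "\<lambda>x. wal ?b h x * cnj (wal ?b l x)"
  have "(\<Sum>k<?b ^ M. ?f (real k / real ?b ^ M)) = (\<Sum>v\<in>(polys M :: 'p mod_ring poly set). ?f (nu M v))"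
    unfolding nu_eq by (rule sum.reindex_bij_betw[OF bij_betw_digits_val, symmetric])
  also have "\<dots> = (\<Sum>v\<in>(polys M :: 'p mod_ring poly set). chr (poly.coeff (v * (tr M h - tr M l)) (M - 1)))"
  proof (intro sum.cong refl)
    fix v :: "'p mod_ring poly"
    have "?f (nu M v) = chr (poly.coeff (v * tr M h) (M - 1) + - poly.coeff (v * tr M l) (M - 1))"
      unfolding chr_add chr_uminus wal_nu[OF assms] by simp
    then show "?f (nu M v) = chr (poly.coeff (v * (tr M h - tr M l)) (M - 1))"
      by (simp add: right_diff_distrib)
  qed
  finally show ?thesis
    using mean_chr_coeff[OF assms, of "tr M h - tr M l :: 'p mod_ring poly"]
    by (simp add: monom_dvd_tr_diff_iff)
qed

lemma grid_mean_walsh_prod: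
  assumes "M \<ge> 1"
  shows "grid_mean CARD('p::prime_card) s M (\<lambda>x. walsh_prod CARD('p) s h x * cnj (walsh_prod CARD('p) s l x))
    = of_bool (\<forall>j\<in>{1..s}. h j mod CARD('p) ^ M = l j mod CARD('p) ^ M)"
proof -
  let ?b = "CARD('p)"
  let ?f = "\<lambda>j k. wal ?b (h j) (real k / real ?b ^ M) * cnj (wal ?b (l j) (real k / real ?b ^ M))"
  have "(\<Sum>k\<in>freq_box ?b s M. walsh_prod ?b s h (grid_point ?b s M k) * cnj (walsh_prod ?b s l (grid_point ?b s M k)))
    = (\<Sum>k\<in>freq_box ?b s M. \<Prod>j\<in>{1..s}. ?f j (k j))"
    by (simp add: walsh_prod_def grid_point_def prod.distrib)
  also have "\<dots> = (\<Prod>j\<in>{1..s}. \<Sum>k<?b ^ M. ?f j k)"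
    unfolding freq_box_def by (rule prod_sum_PiE[symmetric]) auto
  finally have "grid_mean ?b s M (\<lambda>x. walsh_prod ?b s h x * cnj (walsh_prod ?b s l x))
    = (\<Prod>j\<in>{1..s}. (\<Sum>k<?b ^ M. ?f j k) / of_nat (?b ^ M))"
    by (simp add: grid_mean_def prod_dividef power_mult)
  also have "\<dots> = (\<Prod>j\<in>{1..s}. of_bool (h j mod ?b ^ M = l j mod ?b ^ M))"
    by (simp only: mean_wal[OF assms])
  also have "\<dots> = of_bool (\<forall>j\<in>{1..s}. h j mod ?b ^ M = l j mod ?b ^ M)"
    by (cases "\<forall>j\<in>{1..s}. h j mod ?b ^ M = l j mod ?b ^ M") (auto simp: prod_zero_iff)
  finally show ?thesis .
qed

text \<open>A grid mean adds up the coefficients of all frequencies congruent to \<open>k\<close>.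
  The box holds one representative of each class, so apart from \<open>a k\<close> only coefficients
  outside the box enter.\<close>

lemma grid_mean_series:
  fixes a :: "(nat \<Rightarrow> nat) \<Rightarrow> complex"
  assumes a: "(\<lambda>h. norm (a h)) summable_on freqs {1..s}" and M: "M \<ge> 1" and k: "k \<in> freq_box CARD('p::prime_card) s M"
  shows "norm (grid_mean CARD('p) s M
      (\<lambda>x. (\<Sum>\<^sub>\<infinity>h\<in>freqs {1..s}. a h * walsh_prod CARD('p) s h x) * cnj (walsh_prod CARD('p) s k x)) - a k)
    \<le> infsum (\<lambda>h. norm (a h)) (freqs {1..s} - freq_box CARD('p) s M)"
proof -
  let ?b = "CARD('p)" and ?I = "freqs {1..s}"
  let ?W = "walsh_prod ?b s"
  let ?f = "\<lambda>x. (\<Sum>\<^sub>\<infinity>h\<in>?I. a h * ?W h x) * cnj (?W k x)"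
  define d where "d h = (of_bool (\<forall>j\<in>{1..s}. h j mod ?b ^ M = k j mod ?b ^ M) :: complex)" for h
  \<comment> \<open>The contribution of \<open>h\<close> to the mean with the wanted term removed.
    It vanishes in the box and never exceeds \<open>a h\<close> in modulus.\<close>
  define e where "e h = a h * d h + (if h = k then - a h else 0)" for h
  have kI: "k \<in> ?I" using k freq_box_subset by blast
  have hs: "((\<lambda>h. a h * (?W h x * cnj (?W k x))) has_sum ?f x) ?I" for x
  proof -
    have "(\<lambda>h. norm (a h * ?W h x)) summable_on ?I"
      using a by (simp add: norm_mult)
    then have "((\<lambda>h. a h * ?W h x) has_sum (\<Sum>\<^sub>\<infinity>h\<in>?I. a h * ?W h x)) ?I"
      by (rule has_sum_infsum[OF Infinite_Sum.abs_summable_summable])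
    from has_sum_cmult_left[OF this, of "cnj (?W k x)"] show ?thesis
      by (simp only: mult.assoc)
  qed
  have "((\<lambda>h. (\<Sum>l\<in>freq_box ?b s M. a h * (?W h (grid_point ?b s M l) * cnj (?W k (grid_point ?b s M l)))) * (1 / of_nat (?b ^ (M * s))))
      has_sum (\<Sum>l\<in>freq_box ?b s M. ?f (grid_point ?b s M l)) * (1 / of_nat (?b ^ (M * s)))) ?I"
    by (intro has_sum_cmult_left has_sum_sum finite_freq_box hs)
  also have "(\<lambda>h. (\<Sum>l\<in>freq_box ?b s M. a h * (?W h (grid_point ?b s M l) * cnj (?W k (grid_point ?b s M l)))) * (1 / of_nat (?b ^ (M * s))))
    = (\<lambda>h. a h * grid_mean ?b s M (\<lambda>x. ?W h x * cnj (?W k x)))"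
    by (simp add: grid_mean_def sum_distrib_left)
  finally have "((\<lambda>h. a h * d h) has_sum grid_mean ?b s M ?f) ?I"
    unfolding grid_mean_walsh_prod[OF M] d_def by (simp add: grid_mean_def)
  moreover have "((\<lambda>h. if h = k then - a h else 0) has_sum - a k) ?I"
    using kI by (intro has_sum_finite_neutralI[of "{k}"]) auto
  ultimately have e: "(e has_sum (grid_mean ?b s M ?f + - a k)) ?I"
    unfolding e_def by (rule has_sum_add)
  have e_le: "norm (e h) \<le> norm (a h)" for h
    by (auto simp: e_def d_def)
  have abs_e: "(\<lambda>h. norm (e h)) summable_on ?I"
    using a by (rule Infinite_Sum.abs_summable_on_comparison_test') (rule e_le)
  have e_0: "e h = 0" if h: "h \<in> freq_box ?b s M" for h
  proof (cases "h = k")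
    case False
    have "h = k" if "\<forall>j\<in>{1..s}. h j mod ?b ^ M = k j mod ?b ^ M"
    proof (rule PiE_ext)
      show "h \<in> {1..s} \<rightarrow>\<^sub>E {..<?b ^ M}" "k \<in> {1..s} \<rightarrow>\<^sub>E {..<?b ^ M}"
        using h k by (simp_all add: freq_box_def)
      then show "h j = k j" if "j \<in> {1..s}" for j
        using that \<open>\<forall>j\<in>{1..s}. _ j\<close> by (auto simp: PiE_iff)
    qed
    then show ?thesis
      using False by (auto simp: e_def d_def)
  qed (simp add: e_def d_def)
  have "norm (infsum e ?I) \<le> infsum (\<lambda>h. norm (e h)) ?I"
    by (rule norm_infsum_bound[OF abs_e])
  also have "\<dots> \<le> infsum (\<lambda>h. norm (a h)) (?I - freq_box ?b s M)"
    using a abs_e by (rule infsum_le_tail) (simp_all add: e_0 e_le)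
  finally show ?thesis
    using infsumI[OF e] by simp
qed

interpretation lborel_pi: product_sigma_finite "\<lambda>_. lborel :: real measure"
  by standard

text \<open>On the cube, \<open>f\<close> is a uniform limit of step functions that take on each
  cell the value at its lower corner. This limit also provides measurability and integrability of
  \<open>f\<close> on the cube.\<close>

lemma integral_grid_limit:
  fixes f :: "(nat \<Rightarrow> real) \<Rightarrow> complex"
  assumes b: "b > 0" and \<epsilon>: "\<epsilon> \<longlonglongrightarrow> 0"
    and bound: "\<And>M x. x \<in> unit_cube s \<Longrightarrow> norm (f x - f (trunc b s M x)) \<le> \<epsilon> M"
  shows "(\<lambda>M. grid_mean b s M f) \<longlonglongrightarrow> (LINT x:unit_cube s|PiM {1..s} (\<lambda>_. lborel). f x)"
proof -
  let ?P = "PiM {1..s} (\<lambda>_. lborel :: real measure)"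
  let ?X = "unit_cube s"
  \<comment> \<open>Half-open cells, so that each point of the cube lies in exactly one of them, the
    one whose lower corner is its truncation.\<close>
  define cell where "cell M k = (\<Pi>\<^sub>E j\<in>{1..s}. {real (k j) / real b ^ M..<(real (k j) + 1) / real b ^ M})" for M k
  define G where "G M x = (\<Sum>k\<in>freq_box b s M. indicator (cell M k) x *\<^sub>R f (grid_point b s M k))" for M x
  define F where "F x = indicator ?X x *\<^sub>R f x" for x
  have bM: "real b ^ M > 0" for M using b by simp
  have cube: "has_bochner_integral ?P (\<lambda>x. indicator ?X x *\<^sub>R c) (1 *\<^sub>R c)" for c :: real
  proof -
    have em: "emeasure ?P ?X = 1"
      unfolding unit_cube_def by (subst lborel_pi.emeasure_PiM) auto
    have "?X \<in> sets ?P"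
      unfolding unit_cube_def by (intro sets_PiM_I_finite) auto
    then show ?thesis
      using has_bochner_integral_indicator[of ?X ?P c] em by (simp add: measure_def)
  qed
  have cell: "has_bochner_integral ?P (\<lambda>x. indicator (cell M k) x *\<^sub>R c) ((1 / real b ^ (M * s)) *\<^sub>R c)" for M k and c :: complex
  proof -
    have "emeasure ?P (cell M k) = (\<Prod>j\<in>{1..s}. ennreal (1 / real b ^ M))"
      unfolding cell_def using bM[of M]
      by (subst lborel_pi.emeasure_PiM) (auto simp: divide_right_mono add_divide_distrib intro!: prod.cong)
    also have "\<dots> = ennreal (1 / real b ^ (M * s))"
      by (simp add: ennreal_power power_mult power_divide)
    finally have em: "emeasure ?P (cell M k) = ennreal (1 / real b ^ (M * s))" .
    have "cell M k \<in> sets ?P"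
      unfolding cell_def by (intro sets_PiM_I_finite) auto
    then show ?thesis
      using has_bochner_integral_indicator[of "cell M k" ?P c] em by (simp add: measure_def)
  qed
  have hG: "has_bochner_integral ?P (G M) (grid_mean b s M f)" for M
  proof -
    have "has_bochner_integral ?P (G M) (\<Sum>k\<in>freq_box b s M. (1 / real b ^ (M * s)) *\<^sub>R f (grid_point b s M k))"
      unfolding G_def by (intro has_bochner_integral_sum cell)
    also have "(\<Sum>k\<in>freq_box b s M. (1 / real b ^ (M * s)) *\<^sub>R f (grid_point b s M k)) = grid_mean b s M f"
      by (simp add: grid_mean_def sum_divide_distrib scaleR_conv_of_real)
    finally show ?thesis .
  qed
  have in_cell: "x j \<in> {real (k j) / real b ^ M..<(real (k j) + 1) / real b ^ M} \<longleftrightarrow> \<lfloor>x j * real b ^ M\<rfloor> = int (k j)"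
    for x j and k :: "nat \<Rightarrow> nat" and M
    using bM[of M] by (simp add: floor_eq_iff field_simps)
  have G_in: "G M x = f (trunc b s M x)" if x: "x \<in> ?X" for M x
  proof -
    define k0 where "k0 = (\<lambda>j\<in>{1..s}. nat \<lfloor>x j * real b ^ M\<rfloor>)"
    have nn: "0 \<le> \<lfloor>x j * real b ^ M\<rfloor>" "\<lfloor>x j * real b ^ M\<rfloor> < int (b ^ M)" if "j \<in> {1..s}" for j
    proof -
      have "0 \<le> x j" "x j < 1" using x that by (auto simp: unit_cube_def PiE_iff)
      then show "0 \<le> \<lfloor>x j * real b ^ M\<rfloor>" "\<lfloor>x j * real b ^ M\<rfloor> < int (b ^ M)"
        using bM[of M] by (simp_all add: floor_less_iff)
    qed
    have k0: "k0 \<in> freq_box b s M"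
      unfolding freq_box_def k0_def using nn by (intro restrict_PiE_iff[THEN iffD2] ballI) (simp add: nat_less_iff)
    have xe: "x \<in> extensional {1..s}"
      using x by (auto simp: unit_cube_def PiE_iff)
    have iff: "x \<in> cell M k \<longleftrightarrow> k = k0" if k: "k \<in> freq_box b s M" for k
    proof -
      have "x \<in> cell M k \<longleftrightarrow> (\<forall>j\<in>{1..s}. \<lfloor>x j * real b ^ M\<rfloor> = int (k j))"
        unfolding cell_def PiE_iff in_cell using xe by blast
      also have "\<dots> \<longleftrightarrow> (\<forall>j\<in>{1..s}. k j = k0 j)"
        using nn by (force simp: k0_def)
      also have "\<dots> \<longleftrightarrow> k = k0"
        using PiE_ext[of k "{1..s}" "\<lambda>_. {..<b ^ M}" k0] k k0 by (auto simp: freq_box_def)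
      finally show ?thesis .
    qed
    have "G M x = (\<Sum>k\<in>freq_box b s M. if k = k0 then f (grid_point b s M k) else 0)"
      unfolding G_def by (intro sum.cong refl) (simp add: iff indicator_def)
    also have "\<dots> = f (grid_point b s M k0)"
      using k0 by simp
    also have "grid_point b s M k0 = trunc b s M x"
      unfolding grid_point_def trunc_def using nn by (intro restrict_ext) (simp add: k0_def)
    finally show ?thesis .
  qed
  have G_out: "G M x = 0" if x: "x \<notin> ?X" for M x
  proof -
    have "cell M k \<subseteq> ?X" if k: "k \<in> freq_box b s M" for k
    proof -
      have "{real (k j) / real b ^ M..<(real (k j) + 1) / real b ^ M} \<subseteq> {0..<1}" if "j \<in> {1..s}" for j
      proof -
        have "k j < b ^ M"
          using k that by (auto simp: freq_box_def PiE_iff)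
        then have "real (k j + 1) \<le> real (b ^ M)"
          by (simp only: of_nat_le_iff)
        then have "(real (k j) + 1) / real b ^ M \<le> 1"
          using bM[of M] by simp
        then show ?thesis
          using bM[of M] by (auto intro: order_trans[rotated])
      qed
      then show ?thesis
        unfolding cell_def unit_cube_def by (rule PiE_mono)
    qed
    then show ?thesis
      using x unfolding G_def by (intro sum.neutral) (auto simp: indicator_def)
  qed
  have FG: "norm (F x - G M x) \<le> indicator ?X x *\<^sub>R \<epsilon> M" for x M
    using bound[of x M] by (cases "x \<in> ?X") (simp_all add: F_def G_in G_out)
  have \<epsilon>_nonneg: "0 \<le> \<epsilon> M" for M
  proof -
    have "(\<lambda>j\<in>{1..s}. 0) \<in> ?X" by (simp add: unit_cube_def)
    from bound[OF this, of M] show ?thesis using norm_ge_zero order_trans by blast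
  qed
  have mG: "G M \<in> borel_measurable ?P" for M
    using hG by (rule borel_measurable_has_bochner_integral)
  have "(\<lambda>M. G M x) \<longlonglongrightarrow> F x" for x
  proof (rule LIM_zero_cancel, rule tendsto_norm_zero_cancel, rule tendsto_sandwich[OF _ _ tendsto_const \<epsilon>])
    have "indicator ?X x *\<^sub>R \<epsilon> M \<le> \<epsilon> M" for M
      using \<epsilon>_nonneg[of M] by (simp add: indicator_def)
    then show "\<forall>\<^sub>F M in sequentially. norm (G M x - F x) \<le> \<epsilon> M"
      using FG[of x] by (intro always_eventually allI) (metis norm_minus_commute order_trans)
  qed simp
  then have mF: "F \<in> borel_measurable ?P"
    by (intro borel_measurable_LIMSEQ_metric[of G ?P F] mG)
  \<comment> \<open>The difference is dominated by a constant on the cube, which has measure one,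
    and it is zero elsewhere.\<close>
  have iD: "integrable ?P (\<lambda>x. F x - G M x)" for M
    by (rule Bochner_Integration.integrable_bound[OF integrable.intros[OF cube[of "\<epsilon> M"]]])
      (use mF mG FG \<epsilon>_nonneg in \<open>auto intro!: AE_I2 intro: order_trans\<close>)
  have iG: "integrable ?P (G M)" for M
    using hG by (rule integrable.intros)
  have iF: "integrable ?P F"
    using Bochner_Integration.integrable_add[OF iD[of 0] iG[of 0]] by simp
  have le: "norm (grid_mean b s M f - (LINT x|?P. F x)) \<le> \<epsilon> M" for M
  proof -
    have "grid_mean b s M f - (LINT x|?P. F x) = - (LINT x|?P. F x - G M x)"
      using Bochner_Integration.integral_diff[OF iF iG[of M]] has_bochner_integral_integral_eq[OF hG[of M]] by simp
    also have "norm \<dots> \<le> (LINT x|?P. norm (F x - G M x))"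
      by (simp add: integral_norm_bound)
    also have "\<dots> \<le> (LINT x|?P. indicator ?X x *\<^sub>R \<epsilon> M)"
      by (intro integral_mono integrable_norm iD integrable.intros[OF cube[of "\<epsilon> M"]] FG)
    also have "\<dots> = \<epsilon> M"
      using has_bochner_integral_integral_eq[OF cube[of "\<epsilon> M"]] by simp
    finally show ?thesis .
  qed
  have "(\<lambda>M. norm (grid_mean b s M f - (LINT x|?P. F x))) \<longlonglongrightarrow> 0"
    by (rule tendsto_sandwich[OF _ _ tendsto_const \<epsilon>]) (intro always_eventually allI norm_ge_zero le)+
  then have "(\<lambda>M. grid_mean b s M f) \<longlonglongrightarrow> (LINT x|?P. F x)"
    by (rule LIM_zero_cancel[OF tendsto_norm_zero_cancel])
  then show ?thesis
    by (simp add: set_lebesgue_integral_def F_def)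
qed

section \<open>The worst-case error\<close>

definition dual :: "nat \<Rightarrow> nat \<Rightarrow> (nat \<Rightarrow> 'p::prime_card mod_ring poly) \<Rightarrow> (nat \<Rightarrow> nat) \<Rightarrow> bool" where
  "dual m s g h \<longleftrightarrow> Polynomial.monom 1 m dvd (\<Sum>j\<in>{1..s}. g j * tr m (h j))"

text \<open>The known series for the squared error with all subsets merged: the subset is the
  support of \<open>h\<close>, and entries equal to zero contribute nothing to the congruence or to
  the product of weights.\<close>

definition dual_sum ::
  "nat \<Rightarrow> nat \<Rightarrow> real \<Rightarrow> (nat \<Rightarrow> real) \<Rightarrow> (nat \<Rightarrow> 'p::prime_card mod_ring poly) \<Rightarrow> real" where
  "dual_sum m s \<alpha> \<gamma> g = (\<Sum>\<^sub>\<infinity>h\<in>freqs {1..s}.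
     of_bool (h \<noteq> (\<lambda>j\<in>{1..s}. 0) \<and> dual m s g h) * weight CARD('p) \<alpha> \<gamma> {1..s} h)"

lemma polylat_point_in_unit_cube: "polylat_point m s g n \<in> unit_cube s"
  unfolding polylat_point_def unit_cube_def by (intro restrict_PiE_iff[THEN iffD2]) (simp add: nu_bounds)

text \<open>At the node of \<open>n\<close> the product of Walsh values is the character of one
  coefficient of \<open>n\<close> times a fixed polynomial, so orthogonality evaluates the mean over
  \<open>n\<close>.\<close>

lemma polylat_rule_walsh_prod:
  fixes g :: "nat \<Rightarrow> 'p::prime_card mod_ring poly"
  assumes "m \<ge> 1"
  shows "polylat_rule m s g (walsh_prod CARD('p) s h) = of_bool (dual m s g h)"
proof -
  have "walsh_prod CARD('p) s h (polylat_point m s g n)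
    = chr (poly.coeff (n * (\<Sum>j\<in>{1..s}. g j * tr m (h j))) (m - 1))" for n
    by (simp add: walsh_prod_def polylat_point_def wal_nu[OF assms] sum_distrib_left coeff_sum chr_sum mult.assoc)
  then show ?thesis
    unfolding polylat_rule_def dual_def degree_less_eq_polys[OF assms]
    by (simp only: mean_chr_coeff[OF assms])
qed

text \<open>Here \<open>b\<close> is a number tied to \<open>CARD('p)\<close> by a hypothesis, so
  that the definitions below depend on a number and not on a type. The hypothesis is discharged by
  \<open>refl\<close> afterwards.\<close>

context
  fixes b s :: nat and \<alpha> :: real and \<gamma> :: "nat \<Rightarrow> real"
  assumes b: "b = CARD('p::prime_card)" and \<alpha>: "\<alpha> > 1" and \<gamma>: "\<And>j. j \<in> {1..s} \<Longrightarrow> \<gamma> j > 0"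
begin

abbreviation "II \<equiv> freqs {1..s}"
abbreviation "ww \<equiv> weight b \<alpha> \<gamma> {1..s}"

text \<open>The square root splits the weight evenly between the two arguments of the
  kernel.\<close>

definition walsh_feature :: "(nat \<Rightarrow> nat) \<Rightarrow> (nat \<Rightarrow> real) \<Rightarrow> complex" where
  "walsh_feature h x = of_real (sqrt (ww h)) * walsh_prod b s h x"

lemma b_gt_1: "b > 1"
  unfolding b by (rule card_gt_1)

lemma b_pos: "b > 0"
  using b_gt_1 by simp

lemmas grid_mean_series_b = grid_mean_series[where 'p = 'p, folded b]
lemmas grid_mean_walsh_prod_b = grid_mean_walsh_prod[where 'p = 'p, folded b]
lemmas polylat_rule_walsh_prod_b = polylat_rule_walsh_prod[where 'p = 'p, folded b]
lemmas norm_walsh_prod_b [simp] = norm_walsh_prod[where 'p = 'p, folded b]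
lemmas dual_sum_def_b = dual_sum_def[where 'p = 'p, folded b]
lemmas walsh_kernel_eq_b = walsh_kernel_eq[where 'p = 'p, folded b]
lemmas wal_trunc_b = wal_trunc[where 'p = 'p, folded b]
lemmas polylat_rule_def_b = polylat_rule_def[where 'p = 'p, folded b]
lemmas worst_case_error_def_b = worst_case_error_def[where 'p = 'p, folded b]

lemma ww_pos: "ww h > 0"
  using b_gt_1 by (intro weight_pos \<gamma>) auto

lemmas ww_nonneg = less_imp_le[OF ww_pos] less_imp_le[OF ww_pos, simplified]

lemma summable_ww: "ww summable_on II"
proof (rule has_sum_imp_summable)
  show "(ww has_sum (\<Prod>j\<in>{1..s}. 1 + \<gamma> j * mu b \<alpha>)) II"
    by (rule has_sum_weight[OF b_gt_1 \<alpha> finite_atLeastAtMost]) (rule \<gamma>)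
qed

lemma ell2_sqrt_ww: "(\<lambda>h. complex_of_real (sqrt (ww h))) \<in> ell2 II"
  using summable_ww less_imp_le[OF ww_pos] by (simp add: ell2_def)

text \<open>If a Walsh series vanishes on the cube, so do its grid means against any Walsh function;
  these determine each coefficient up to a tail that tends to zero.\<close>

lemma features_walsh: "features (unit_cube s) II walsh_feature"
proof
  show "(\<lambda>h. walsh_feature h x) \<in> ell2 II" for x
    using ell2_sqrt_ww by (simp add: ell2_def walsh_feature_def norm_mult)
  fix c k
  assume c: "c \<in> ell2 II" and 0: "\<And>x. x \<in> unit_cube s \<Longrightarrow> (\<Sum>\<^sub>\<infinity>h\<in>II. c h * walsh_feature h x) = 0"
    and k: "k \<in> II"
  define a where "a h = c h * of_real (sqrt (ww h))" for h
  have a: "(\<lambda>h. norm (a h)) summable_on II"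
    unfolding a_def by (rule abs_summable_ell2_mult[OF c ell2_sqrt_ww])
  let ?f = "\<lambda>M x. (\<Sum>\<^sub>\<infinity>h\<in>II. a h * walsh_prod b s h x) * cnj (walsh_prod b s k x)"
  have f0: "?f M (grid_point b s M l) = 0" if "l \<in> freq_box b s M" for M l
    using 0[OF grid_point_in_unit_cube[OF b_pos that]] by (simp add: a_def walsh_feature_def mult.assoc)
  have "\<forall>\<^sub>F M in sequentially. norm (a k) \<le> infsum (\<lambda>h. norm (a h)) (II - freq_box b s M)"
    using eventually_freq_box[OF b_gt_1 k] eventually_ge_at_top[of 1]
  proof eventually_elim
    case (elim M)
    have "(\<Sum>l\<in>freq_box b s M. ?f M (grid_point b s M l)) = 0"
      by (intro sum.neutral ballI f0)
    then have "grid_mean b s M (?f M) = 0"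
      by (simp only: grid_mean_def div_0)
    with grid_mean_series_b[OF a elim(2,1)] show ?case
      by simp
  qed
  from tendsto_lowerbound[OF tail_tendsto_0[OF b_gt_1 a] this] have "a k = 0"
    by simp
  then show "c k = 0"
    using ww_pos[of k] by (simp add: a_def)
qed

interpretation features "unit_cube s" II walsh_feature
  by (rule features_walsh)

abbreviation "KK \<equiv> walsh_kernel b s \<alpha> (\<lambda>u. \<Prod>j\<in>u. \<gamma> j)"

lemma kernel_eq: "kernel = KK"
proof (intro ext)
  fix x y
  have "walsh_feature h x * cnj (walsh_feature h y)
      = of_real (ww h) * (walsh_prod b s h x * cnj (walsh_prod b s h y))" for h
  proof -
    have "complex_of_real (sqrt (ww h)) * of_real (sqrt (ww h)) = of_real (ww h)"
      using ww_pos[of h] by (simp flip: of_real_mult)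
    moreover have "walsh_feature h x * cnj (walsh_feature h y)
      = complex_of_real (sqrt (ww h)) * of_real (sqrt (ww h)) * (walsh_prod b s h x * cnj (walsh_prod b s h y))"
      by (simp add: walsh_feature_def mult_ac)
    ultimately show ?thesis
      by simp
  qed
  then show "kernel x y = KK x y"
    by (simp only: kernel_def walsh_kernel_eq_b[OF \<alpha>])
qed

definition tail :: "nat \<Rightarrow> real" where
  "tail M = infsum ww (II - freq_box b s M)"

lemma tail_0: "tail \<longlonglongrightarrow> 0"
  unfolding tail_def by (rule tail_tendsto_0[OF b_gt_1 summable_ww])

lemma tail_nonneg: "tail M \<ge> 0"
  unfolding tail_def by (intro infsum_nonneg less_imp_le ww_pos)

lemma unit_ball_functional_bound:
  assumes f: "f \<in> rkhs_unit_ball (unit_cube s) KK" and A: "finite A" "p ` A \<subseteq> unit_cube s"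
  shows "((\<lambda>h. (cmod (\<Sum>i\<in>A. c i * walsh_feature h (p i)))\<^sup>2) summable_on II)"
    and "(cmod (\<Sum>i\<in>A. c i * f (p i)))\<^sup>2 \<le> (\<Sum>\<^sub>\<infinity>h\<in>II. (cmod (\<Sum>i\<in>A. c i * walsh_feature h (p i)))\<^sup>2)"
proof -
  from f obtain H ip where "rkhs (unit_cube s) KK H ip" "f \<in> H" "sqrt (Re (ip f f)) \<le> 1"
    by (auto simp: rkhs_unit_ball_def)
  moreover have "KK x y = kernel x y" for x y
    by (simp only: kernel_eq)
  ultimately show
    "((\<lambda>h. (cmod (\<Sum>i\<in>A. c i * walsh_feature h (p i)))\<^sup>2) summable_on II)"
    "(cmod (\<Sum>i\<in>A. c i * f (p i)))\<^sup>2 \<le> (\<Sum>\<^sub>\<infinity>h\<in>II. (cmod (\<Sum>i\<in>A. c i * walsh_feature h (p i)))\<^sup>2)"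
    using point_functional_bound[of KK H ip f A p c] A by blast+
qed

lemma norm_walsh_feature: "(cmod (of_real (sqrt (ww h)) * z))\<^sup>2 = ww h * (cmod z)\<^sup>2"
  using ww_pos[of h] by (simp add: norm_mult power_mult_distrib)

text \<open>This is a functional with two nodes, indexed by \<open>bool\<close>. Walsh functions
  with frequencies in the box see only the first \<open>M\<close> digits and cancel; each remaining
  one contributes at most 4 times its weight.\<close>

lemma unit_ball_trunc:
  assumes f: "f \<in> rkhs_unit_ball (unit_cube s) KK" and x: "x \<in> unit_cube s"
  shows "norm (f x - f (trunc b s M x)) \<le> 2 * sqrt (tail M)"
proof -
  let ?p = "\<lambda>i. if i then x else trunc b s M x" and ?c = "\<lambda>i. if i then 1 else -1 :: complex"
  have p: "?p ` UNIV \<subseteq> unit_cube s"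
    using x trunc_in_unit_cube[OF b_pos x, of M] by auto
  note B = unit_ball_functional_bound[OF f finite[of UNIV] p, where c = ?c, unfolded UNIV_bool, simplified]
  have eq: "walsh_feature h x - walsh_feature h (trunc b s M x)
      = of_real (sqrt (ww h)) * (walsh_prod b s h x - walsh_prod b s h (trunc b s M x))" for h
    by (simp add: walsh_feature_def algebra_simps)
  have "(cmod (f x - f (trunc b s M x)))\<^sup>2
    \<le> (\<Sum>\<^sub>\<infinity>h\<in>II. (cmod (walsh_feature h x - walsh_feature h (trunc b s M x)))\<^sup>2)"
    using B(2) by (simp add: norm_minus_commute)
  also have "\<dots> \<le> infsum (\<lambda>h. 4 * ww h) (II - freq_box b s M)"
  proof (rule infsum_le_tail)
    show "(\<lambda>h. 4 * ww h) summable_on II"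
      by (rule summable_on_cmult_right[OF summable_ww])
    show "(\<lambda>h. (cmod (walsh_feature h x - walsh_feature h (trunc b s M x)))\<^sup>2) summable_on II"
      using B(1) by (simp add: norm_minus_commute)
    fix h
    show "(cmod (walsh_feature h x - walsh_feature h (trunc b s M x)))\<^sup>2 \<le> 0" if "h \<in> II \<inter> freq_box b s M"
    proof -
      have "h j < b ^ M" if "j \<in> {1..s}" for j
        using \<open>h \<in> II \<inter> _\<close> that by (auto simp: freq_box_def PiE_iff)
      then have "walsh_prod b s h (trunc b s M x) = walsh_prod b s h x"
        unfolding walsh_prod_def trunc_def by (intro prod.cong refl) (simp add: wal_trunc_b)
      then show ?thesis by (simp add: walsh_feature_def)
    qed
    have "cmod (walsh_prod b s h x - walsh_prod b s h (trunc b s M x)) \<le> 2"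
      using norm_triangle_ineq4[of "walsh_prod b s h x" "walsh_prod b s h (trunc b s M x)"] by simp
    then have "(cmod (walsh_prod b s h x - walsh_prod b s h (trunc b s M x)))\<^sup>2 \<le> 2\<^sup>2"
      by (intro power_mono) auto
    then show "(cmod (walsh_feature h x - walsh_feature h (trunc b s M x)))\<^sup>2 \<le> 4 * ww h"
      unfolding eq norm_walsh_feature using ww_pos[of h] by simp
  qed
  also have "\<dots> = (2 * sqrt (tail M))\<^sup>2"
    unfolding power_mult_distrib real_sqrt_pow2[OF tail_nonneg] unfolding tail_def
    by (simp add: infsum_cmult_right')
  finally show ?thesis
    by (rule power2_le_imp_le) (simp add: tail_nonneg)
qed

lemma unit_ball_grid_limit:
  assumes f: "f \<in> rkhs_unit_ball (unit_cube s) KK"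
  shows "(\<lambda>M. grid_mean b s M f) \<longlonglongrightarrow> (LINT x:unit_cube s|PiM {1..s} (\<lambda>_. lborel). f x)"
proof (rule integral_grid_limit)
  show "(\<lambda>M. 2 * sqrt (tail M)) \<longlonglongrightarrow> 0"
    using tendsto_mult_right_zero[OF tendsto_real_sqrt[OF tail_0, simplified], of 2] by simp
qed (use unit_ball_trunc[OF f] b_gt_1 in auto)

text \<open>With the integral replaced by a grid mean the error becomes a finite combination of
  evaluations. A frequency contributes its weight when grid mean and lattice rule disagree on it; in
  the box these are exactly the nonzero dual points, and the rest is at most a tail.\<close>

lemma unit_ball_error_le:
  fixes g :: "nat \<Rightarrow> 'p mod_ring poly"
  assumes f: "f \<in> rkhs_unit_ball (unit_cube s) KK" and m: "m \<ge> 1"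
  shows "norm ((LINT x:unit_cube s|PiM {1..s} (\<lambda>_. lborel). f x) - polylat_rule m s g f)
    \<le> sqrt (dual_sum m s \<alpha> \<gamma> g)"
proof -
  let ?z = "\<lambda>j\<in>{1..s}. 0 :: nat"
  let ?N = "{n :: 'p mod_ring poly. degree n < m}"
  define t where "t h = of_bool (h \<noteq> ?z \<and> dual m s g h) * ww h" for h
  have summ_t: "t summable_on II"
    using summable_ww by (rule summable_on_comparison_test) (simp_all add: t_def ww_nonneg)
  have finN: "finite ?N"
    using m by (simp add: degree_less_eq_polys)
  have bound: "(cmod (grid_mean b s M f - polylat_rule m s g f))\<^sup>2 \<le> dual_sum m s \<alpha> \<gamma> g + tail M"
    if M: "M \<ge> 1" for M
  proof -
    \<comment> \<open>A disjoint sum of index sets, since a grid point may coincide with a lattice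
      node while the two carry different coefficients.\<close>
    define A where "A = freq_box b s M <+> ?N"
    define p where "p = case_sum (grid_point b s M) (polylat_point m s g)"
    define c :: "(nat \<Rightarrow> nat) + 'p mod_ring poly \<Rightarrow> complex" where "c = case_sum (\<lambda>_. 1 / of_nat (b ^ (M * s))) (\<lambda>_. - 1 / of_nat (b ^ m))"
    have A: "finite A" "p ` A \<subseteq> unit_cube s"
      using finN b_gt_1 grid_point_in_unit_cube[of b _ s M] polylat_point_in_unit_cube[of m s g]
      by (auto simp: A_def p_def)
    have L: "(\<Sum>i\<in>A. c i * F (p i)) = grid_mean b s M F - polylat_rule m s g F" for F
      unfolding A_def using finN
      by (subst sum.Plus) (simp_all add: c_def p_def grid_mean_def polylat_rule_def_b
          sum_divide_distrib sum_negf)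
    note B = unit_ball_functional_bound[OF f A, where c = c, unfolded L]
    define e where "e h = (cmod (grid_mean b s M (walsh_feature h) - polylat_rule m s g (walsh_feature h)))\<^sup>2" for h
    define G where "G h \<longleftrightarrow> (\<forall>j\<in>{1..s}. h j mod b ^ M = 0)" for h :: "nat \<Rightarrow> nat"
    have e: "e h = ww h * (cmod (of_bool (G h) - of_bool (dual m s g h)))\<^sup>2" for h
    proof -
      have "walsh_prod b s (\<lambda>_. 0) x = 1" for x
        by (simp add: walsh_prod_def)
      then have "grid_mean b s M (walsh_prod b s h) = of_bool (G h)"
        using grid_mean_walsh_prod_b[OF M, of s h "\<lambda>_. 0"] by (simp add: G_def)
      moreover have "grid_mean b s M (walsh_feature h) = of_real (sqrt (ww h)) * grid_mean b s M (walsh_prod b s h)"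
        by (simp add: grid_mean_def walsh_feature_def sum_distrib_left)
      moreover have "polylat_rule m s g (walsh_feature h) = of_real (sqrt (ww h)) * polylat_rule m s g (walsh_prod b s h)"
        by (simp add: polylat_rule_def_b walsh_feature_def sum_distrib_left)
      ultimately show ?thesis
        by (simp add: e_def polylat_rule_walsh_prod_b[OF m] norm_walsh_feature ww_nonneg flip: right_diff_distrib)
    qed
    have e_box: "e h = t h" if h: "h \<in> freq_box b s M" for h
    proof -
      \<comment> \<open>An entry below \<open>b ^ M\<close> and divisible by it is zero. At the zero
        frequency grid mean and lattice rule both give 1 and cancel.\<close>
      have "G h \<longleftrightarrow> h = ?z"
      proof
        assume "G h"
        then have "h j = 0" if "j \<in> {1..s}" for j
          using h that by (auto simp: G_def freq_box_def PiE_iff)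
        then show "h = ?z"
          using h by (intro extensionalityI[of _ "{1..s}"]) (auto simp: freq_box_def PiE_iff)
      qed (simp add: G_def)
      moreover have "dual m s g ?z"
        by (simp add: dual_def)
      ultimately show ?thesis
        by (cases "h = ?z") (simp_all add: e t_def)
    qed
    have e_le: "e h \<le> ww h" for h
      using ww_pos[of h] by (simp add: e)
    have summ_e: "e summable_on II"
      unfolding e_def by (rule B(1))
    have "infsum (\<lambda>h. e h + - t h) II \<le> infsum ww (II - freq_box b s M)"
    proof (rule infsum_le_tail[OF summable_ww])
      show "(\<lambda>h. e h + - t h) summable_on II"
        by (intro summable_on_add summ_e summable_on_uminus[THEN iffD2] summ_t)
      show "e h + - t h \<le> ww h" for h
        using e_le[of h] ww_pos[of h] by (simp add: t_def)
    qed (simp add: e_box)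
    moreover have "infsum (\<lambda>h. e h + - t h) II = infsum e II + - infsum t II"
      using summ_e summ_t by (subst infsum_add) (simp_all add: infsum_uminus summable_on_uminus)
    ultimately have "infsum e II \<le> dual_sum m s \<alpha> \<gamma> g + tail M"
      by (simp add: dual_sum_def_b t_def[abs_def] tail_def)
    then show ?thesis
      using B(2) unfolding e_def by linarith
  qed
  have "(cmod ((LINT x:unit_cube s|PiM {1..s} (\<lambda>_. lborel). f x) - polylat_rule m s g f))\<^sup>2
    \<le> dual_sum m s \<alpha> \<gamma> g + 0"
  proof (rule tendsto_le)
    show "(\<lambda>M. (cmod (grid_mean b s M f - polylat_rule m s g f))\<^sup>2) \<longlonglongrightarrow>
      (cmod ((LINT x:unit_cube s|PiM {1..s} (\<lambda>_. lborel). f x) - polylat_rule m s g f))\<^sup>2"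
      by (intro tendsto_intros unit_ball_grid_limit f)
    show "(\<lambda>M. dual_sum m s \<alpha> \<gamma> g + tail M) \<longlonglongrightarrow> dual_sum m s \<alpha> \<gamma> g + 0"
      by (intro tendsto_intros tail_0)
    show "\<forall>\<^sub>F M in sequentially. (cmod (grid_mean b s M f - polylat_rule m s g f))\<^sup>2
        \<le> dual_sum m s \<alpha> \<gamma> g + tail M"
      using eventually_ge_at_top[of 1] by eventually_elim (rule bound)
  qed simp
  then show ?thesis
    by (intro real_le_rsqrt) simp
qed

text \<open>The extremal function is a normalized sum over the nonzero dual points. Its zero
  frequency is absent, so the integral vanishes, while the lattice rule gives 1 on each of its Walsh
  functions and thus adds up all coefficients.\<close>

lemma unit_ball_error_attained:
  fixes g :: "nat \<Rightarrow> 'p mod_ring poly"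
  assumes m: "m \<ge> 1"
  shows "\<exists>f\<in>rkhs_unit_ball (unit_cube s) KK.
    norm ((LINT x:unit_cube s|PiM {1..s} (\<lambda>_. lborel). f x) - polylat_rule m s g f) = sqrt (dual_sum m s \<alpha> \<gamma> g)"
proof -
  let ?z = "\<lambda>j\<in>{1..s}. 0 :: nat"
  let ?S = "dual_sum m s \<alpha> \<gamma> g"
  define \<eta> where "\<eta> h = (of_bool (h \<noteq> ?z \<and> dual m s g h) :: real)" for h
  have t: "((\<lambda>h. \<eta> h * ww h) has_sum ?S) II"
    unfolding dual_sum_def_b \<eta>_def
    by (rule has_sum_infsum, rule summable_on_comparison_test[OF summable_ww])
      (simp_all add: ww_nonneg)
  have S: "?S \<ge> 0"
    by (rule has_sum_nonneg[OF t]) (simp add: \<eta>_def ww_nonneg)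
  \<comment> \<open>If \<open>?S = 0\<close>, division by zero makes every \<open>c h\<close> zero,
    and the zero function attains the error 0. Otherwise the coefficients have norm 1.\<close>
  define c where "c h = complex_of_real (\<eta> h * sqrt (ww h) / sqrt ?S)" for h
  have c2: "(cmod (c h))\<^sup>2 = \<eta> h * ww h / ?S" for h
    using S less_imp_le[OF ww_pos[of h]] by (simp add: c_def \<eta>_def norm_divide power_divide)
  have hs: "((\<lambda>h. (cmod (c h))\<^sup>2) has_sum ?S / ?S) II"
    unfolding c2 by (rule has_sum_divide_const[OF t])
  then have c: "c \<in> ell2 II"
    unfolding ell2_def by (auto intro: has_sum_imp_summable)
  define f where "f = synth c"
  have "sqrt (Re (inner_prod f f)) \<le> 1"
    unfolding f_def inner_prod_self[OF c] infsumI[OF hs] by (simp add: divide_le_eq)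
  then have f: "f \<in> rkhs_unit_ball (unit_cube s) KK"
    unfolding rkhs_unit_ball_def f_def using rkhs_features c kernel_eq by auto
  define a where "a h = complex_of_real (\<eta> h * ww h / sqrt ?S)" for h
  have a: "(a has_sum of_real (?S / sqrt ?S)) II"
    unfolding a_def by (intro has_sum_of_real has_sum_divide_const t)
  have abs_a: "(\<lambda>h. norm (a h)) summable_on II"
    by (rule summable_on_iff_abs_summable_on_complex[THEN iffD1, OF has_sum_imp_summable[OF a]])
  have f_eq: "f x = (\<Sum>\<^sub>\<infinity>h\<in>II. a h * walsh_prod b s h x)" if "x \<in> unit_cube s" for x
  proof -
    have "c h * walsh_feature h x = a h * walsh_prod b s h x" for h
    proof -
      have "complex_of_real (sqrt (ww h)) * of_real (sqrt (ww h)) = of_real (ww h)"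
        using ww_pos[of h] by (simp flip: of_real_mult)
      moreover have "c h * walsh_feature h x = of_real (\<eta> h / sqrt ?S)
          * (complex_of_real (sqrt (ww h)) * of_real (sqrt (ww h))) * walsh_prod b s h x"
        by (simp add: c_def walsh_feature_def)
      ultimately show ?thesis
        by (simp add: a_def)
    qed
    then show ?thesis
      unfolding f_def synth_apply[OF that] by simp
  qed
  have hsf: "((\<lambda>h. a h * walsh_prod b s h x) has_sum f x) II" if "x \<in> unit_cube s" for x
    unfolding f_eq[OF that]
    by (rule has_sum_infsum, rule Infinite_Sum.abs_summable_summable) (simp only: norm_mult norm_walsh_prod_b mult_1_right abs_a)
  have z: "?z \<in> freq_box b s M" for M
    using b_gt_1 by (simp add: freq_box_def)
  have "norm (grid_mean b s M f) \<le> infsum (\<lambda>h. norm (a h)) (II - freq_box b s M)" if "M \<ge> 1" for M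
  proof -
    have "walsh_prod b s ?z x = 1" for x
      by (simp add: walsh_prod_def)
    moreover have "a ?z = 0"
      by (simp add: a_def \<eta>_def)
    moreover have "grid_mean b s M f = grid_mean b s M (\<lambda>x. \<Sum>\<^sub>\<infinity>h\<in>II. a h * walsh_prod b s h x)"
      unfolding grid_mean_def using b_gt_1 by (simp add: f_eq grid_point_in_unit_cube)
    ultimately show ?thesis
      using grid_mean_series_b[OF abs_a that z] by simp
  qed
  then have "(\<lambda>M. grid_mean b s M f) \<longlonglongrightarrow> 0"
    by (intro Lim_null_comparison[OF _ tail_tendsto_0[OF b_gt_1 abs_a]] eventually_sequentiallyI[of 1])
  then have int: "(LINT x:unit_cube s|PiM {1..s} (\<lambda>_. lborel). f x) = 0"
    using unit_ball_grid_limit[OF f] LIMSEQ_unique by blast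
  have "((\<lambda>h. (\<Sum>n | degree n < m. a h * walsh_prod b s h (polylat_point m s g n)) * (1 / of_nat (b ^ m)))
      has_sum (\<Sum>n | degree n < m. f (polylat_point m s g n)) * (1 / of_nat (b ^ m))) II"
    using m by (intro has_sum_cmult_left has_sum_sum hsf polylat_point_in_unit_cube)
      (simp add: degree_less_eq_polys)
  also have "(\<lambda>h. (\<Sum>n | degree n < m. a h * walsh_prod b s h (polylat_point m s g n)) * (1 / of_nat (b ^ m)))
    = (\<lambda>h. a h * polylat_rule m s g (walsh_prod b s h))"
    by (simp add: polylat_rule_def_b sum_distrib_left)
  also have "\<dots> = a"
    by (auto simp: polylat_rule_walsh_prod_b[OF m] a_def \<eta>_def)
  finally have "(a has_sum polylat_rule m s g f) II"
    by (simp add: polylat_rule_def_b)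
  then have "polylat_rule m s g f = of_real (?S / sqrt ?S)"
    using a has_sum_unique by blast
  then have Q: "polylat_rule m s g f = of_real (sqrt ?S)"
    using S by (simp add: real_div_sqrt)
  have "norm ((LINT x:unit_cube s|PiM {1..s} (\<lambda>_. lborel). f x) - polylat_rule m s g f) = sqrt ?S"
    unfolding int Q using S by simp
  then show ?thesis
    by (rule bexI[OF _ f])
qed

text \<open>The supremum is a maximum, which also settles that the set of errors is nonempty and
  bounded, as a meaningful real \<open>SUP\<close> requires.\<close>

lemma worst_case_error_eq_aux:
  fixes g :: "nat \<Rightarrow> 'p mod_ring poly"
  assumes m: "m \<ge> 1"
  shows "worst_case_error m s \<alpha> (\<lambda>u. \<Prod>j\<in>u. \<gamma> j) g = sqrt (dual_sum m s \<alpha> \<gamma> g)"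
  unfolding worst_case_error_def_b
proof (rule cSup_eq_maximum)
  obtain f where "f \<in> rkhs_unit_ball (unit_cube s) KK"
    and "norm ((LINT x:unit_cube s|PiM {1..s} (\<lambda>_. lborel). f x) - polylat_rule m s g f) = sqrt (dual_sum m s \<alpha> \<gamma> g)"
    using unit_ball_error_attained[OF m, of g] by blast
  then show "sqrt (dual_sum m s \<alpha> \<gamma> g) \<in> (\<lambda>f. norm ((LINT x:unit_cube s|PiM {1..s} (\<lambda>_. lborel). f x) - polylat_rule m s g f))
      ` rkhs_unit_ball (unit_cube s) KK"
    by (intro image_eqI[where x = f]) (simp_all only:)
next
  fix y
  assume "y \<in> (\<lambda>f. norm ((LINT x:unit_cube s|PiM {1..s} (\<lambda>_. lborel). f x) - polylat_rule m s g f))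
      ` rkhs_unit_ball (unit_cube s) KK"
  then show "y \<le> sqrt (dual_sum m s \<alpha> \<gamma> g)"
    by (elim imageE) (simp only: unit_ball_error_le[OF _ m])
qed

end

lemmas worst_case_error_eq = worst_case_error_eq_aux[OF refl]

section \<open>Counting solutions of congruences modulo a power of the indeterminate\<close>

text \<open>A polynomial with nonzero constant coefficient is a unit modulo powers of the
  indeterminate: from the bottom up, each coefficient of the product forces one coefficient of
  \<open>r\<close> to be zero.\<close>

lemma monom_dvd_mult_unit:
  fixes a r :: "'a::field poly"
  assumes "poly.coeff a 0 \<noteq> 0" "Polynomial.monom 1 n dvd a * r"
  shows "Polynomial.monom 1 n dvd r"
proof -
  have "poly.coeff r k = 0" if "k < n" for k
    using that
  proof (induction k rule: less_induct)
    case (less k)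
    have "poly.coeff (a * r) k = poly.coeff a 0 * poly.coeff r (k - 0) + (\<Sum>i\<in>{..k} - {0}. poly.coeff a i * poly.coeff r (k - i))"
      unfolding coeff_mult by (rule sum.remove) auto
    also have "(\<Sum>i\<in>{..k} - {0}. poly.coeff a i * poly.coeff r (k - i)) = 0"
    proof (intro sum.neutral ballI)
      fix i assume "i \<in> {..k} - {0}"
      then have "k - i < k" by auto
      then show "poly.coeff a i * poly.coeff r (k - i) = 0"
        using less by simp
    qed
    finally have "poly.coeff a 0 * poly.coeff r k = poly.coeff (a * r) k"
      by simp
    also have "\<dots> = 0"
      using assms(2) less.prems unfolding monom_1_dvd_iff' by blast
    finally show ?case
      using assms(1) by simp
  qed
  then show ?thesis
    unfolding monom_1_dvd_iff' by blast
qed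

lemma monom_dvd_monom_mult_iff:
  fixes p :: "'a::field poly"
  assumes "a \<le> n"
  shows "Polynomial.monom 1 n dvd Polynomial.monom 1 a * p \<longleftrightarrow> Polynomial.monom 1 (n - a) dvd p"
proof -
  have "Polynomial.monom 1 n = Polynomial.monom 1 a * (Polynomial.monom 1 (n - a) :: 'a poly)"
    using assms by (simp add: mult_monom)
  then show ?thesis
    by (simp add: monom_eq_0_iff)
qed

lemma gcd_monom_eq_1_iff:
  fixes g :: "'a::field_gcd poly"
  assumes "m \<ge> 1"
  shows "gcd g (Polynomial.monom 1 m) = 1 \<longleftrightarrow> poly.coeff g 0 \<noteq> 0"
proof
  assume gcd: "gcd g (Polynomial.monom 1 m) = 1"
  show "poly.coeff g 0 \<noteq> 0"
  proof
    assume "poly.coeff g 0 = 0"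
    then have "Polynomial.monom 1 1 dvd g"
      unfolding monom_1_dvd_iff' by simp
    moreover have "Polynomial.monom 1 1 dvd (Polynomial.monom 1 m :: 'a poly)"
      using assms unfolding monom_1_dvd_iff' by simp
    ultimately have "Polynomial.monom 1 1 dvd gcd g (Polynomial.monom 1 m)"
      by (rule gcd_greatest)
    then have "\<forall>k<1. poly.coeff (1 :: 'a poly) k = 0"
      unfolding gcd monom_1_dvd_iff' .
    then show False
      by (auto dest: spec[of _ 0])
  qed
next
  assume g: "poly.coeff g 0 \<noteq> 0"
  define d where "d = gcd g (Polynomial.monom 1 m)"
  obtain f e where f: "g = d * f" and e: "Polynomial.monom 1 m = d * e"
    unfolding d_def by (meson dvdE gcd_dvd1 gcd_dvd2)
  have "poly.coeff d 0 \<noteq> 0"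
    using g unfolding f by (auto simp: coeff_mult)
  \<comment> \<open>As \<open>d\<close> has nonzero constant coefficient, the whole power goes into
    the cofactor \<open>e\<close>, which leaves a unit for \<open>d\<close>.\<close>
  then have "Polynomial.monom 1 m dvd e"
    by (rule monom_dvd_mult_unit) (simp flip: e)
  then obtain e' where "e = Polynomial.monom 1 m * e'"
    by (rule dvdE)
  with e have "Polynomial.monom 1 m * 1 = Polynomial.monom 1 m * (d * e')"
    by (simp add: mult_ac)
  then have "1 = d * e'"
    by (simp add: monom_eq_0_iff)
  then have "is_unit d"
    by (rule dvdI)
  then show "gcd g (Polynomial.monom 1 m) = 1"
    unfolding d_def by (metis coprime_iff_gcd_eq_1 is_unit_gcd)
qed

lemma search_space_eq:
  assumes "w < m"
  shows "search_space m w = {q \<in> polys (m - w). poly.coeff q 0 \<noteq> (0 :: 'p::prime_card mod_ring)}"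
proof -
  have "{q :: 'p mod_ring poly. degree q < m - w} = polys (m - w)"
    using assms by (intro degree_less_eq_polys) simp
  then have "degree q < m - w \<longleftrightarrow> q \<in> polys (m - w)" for q :: "'p mod_ring poly"
    by blast
  moreover have "q \<noteq> 0" if "poly.coeff q 0 \<noteq> 0" for q :: "'p mod_ring poly"
    using that by auto
  ultimately show ?thesis
    using assms by (auto simp: search_space_def gcd_monom_eq_1_iff)
qed

lemma finite_search_space [simp]: "finite (search_space m w)"
  by (cases "w < m") (simp_all add: search_space_eq, simp add: search_space_def)

text \<open>Only polynomials with zero constant coefficient are missing, and their share
  \<open>1 / b\<close> is at most one half.\<close>

lemma card_search_space:
  assumes "w < m"
  shows "CARD('p::prime_card) ^ (m - w) \<le> 2 * card (search_space m w :: 'p mod_ring poly set)"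
    and "card (search_space m w :: 'p mod_ring poly set) \<le> CARD('p) ^ (m - w)"
proof -
  let ?G = "search_space m w :: 'p mod_ring poly set"
  obtain n where n: "m - w = Suc n"
    using assms by (metis Suc_diff_Suc)
  have sub: "?G \<subseteq> polys (m - w)"
    using assms by (auto simp: search_space_eq)
  then show "card ?G \<le> CARD('p) ^ (m - w)"
    using card_mono[OF finite_polys sub] by (simp add: card_polys)
  have "polys (m - w) - ?G \<subseteq> pCons 0 ` polys n"
    using assms unfolding n by (auto simp: search_space_eq n polys_Suc)
  then have "card (polys (m - w) - ?G) \<le> card (pCons 0 ` (polys n :: 'p mod_ring poly set))"
    by (intro card_mono) auto
  also have "\<dots> \<le> CARD('p) ^ n"
    using card_image_le[of "polys n :: 'p mod_ring poly set" "pCons 0"] by (simp add: card_polys)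
  finally have "CARD('p) ^ (m - w) \<le> card ?G + CARD('p) ^ n"
    using sub by (subst (asm) card_Diff_subset) (auto simp: card_polys)
  moreover have "2 * CARD('p) ^ n \<le> CARD('p) ^ (m - w)"
    using card_gt_1[where 'p = 'p] unfolding n by simp
  ultimately show "CARD('p) ^ (m - w) \<le> 2 * card ?G"
    by linarith
qed

text \<open>Here \<open>c\<close> is the contribution of the other coordinates to the dual
  condition, and \<open>k\<close> is the frequency in the coordinate being searched.\<close>

definition sols :: "nat \<Rightarrow> nat \<Rightarrow> 'p::prime_card mod_ring poly \<Rightarrow> nat \<Rightarrow> 'p mod_ring poly set" where
  "sols m w c k = {q \<in> search_space m w. Polynomial.monom 1 m dvd c + Polynomial.monom 1 w * q * tr m k}"

lemma card_sols_le: "card (sols m w c k) \<le> card (search_space m w :: 'p::prime_card mod_ring poly set)"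
  for c :: "'p::prime_card mod_ring poly"
  unfolding sols_def by (intro card_mono) auto

lemma monom_dvd_tr_iff: "n \<le> m \<Longrightarrow> Polynomial.monom 1 n dvd (tr m k :: 'p::prime_card mod_ring poly) \<longleftrightarrow> CARD('p) ^ n dvd k"
  using monom_dvd_tr_diff_iff[of n m k 0, where 'p = 'p] by (simp add: mod_eq_0_iff_dvd)

text \<open>The candidates \<open>q\<close> are units, so the order of vanishing of
  \<open>monom 1 w * q * tr m k\<close> depends on \<open>k\<close> alone and must match that of
  \<open>c\<close> unless both reach \<open>m\<close>. If \<open>c\<close> has order
  \<open>e < m\<close>, this makes \<open>e - w\<close> the valuation of \<open>k\<close> and fixes
  \<open>q\<close> modulo \<open>monom 1 (m - e)\<close>, leaving \<open>e - w\<close> free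
  coefficients.\<close>

lemma sols_bound:
  fixes c :: "'p::prime_card mod_ring poly"
  assumes w: "w < m"
  shows "\<exists>v. \<forall>k. card (sols m w c k) \<le> CARD('p) ^ v \<and> (sols m w c k \<noteq> {} \<longrightarrow> CARD('p) ^ v dvd k)"
proof (cases "Polynomial.monom 1 m dvd c")
  case True
  \<comment> \<open>The term with \<open>q\<close> has to vanish modulo \<open>monom 1 m\<close> by
    itself, so \<open>v = m - w\<close> works together with the trivial count.\<close>
  have "CARD('p) ^ (m - w) dvd k" if "q \<in> sols m w c k" for q k
  proof -
    have q: "poly.coeff q 0 \<noteq> 0" and "Polynomial.monom 1 m dvd c + Polynomial.monom 1 w * q * tr m k"
      using that w by (auto simp: sols_def search_space_eq)
    then have "Polynomial.monom 1 m dvd Polynomial.monom 1 w * (q * tr m k)"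
      unfolding dvd_add_right_iff[OF True] mult.assoc by blast
    then have "Polynomial.monom 1 (m - w) dvd q * tr m k"
      unfolding monom_dvd_monom_mult_iff[OF less_imp_le[OF w]] .
    from monom_dvd_mult_unit[OF q this] show ?thesis
      by (simp add: monom_dvd_tr_iff)
  qed
  moreover have "card (sols m w c k) \<le> CARD('p) ^ (m - w)" for k
    using card_sols_le[of m w c k] card_search_space(2)[OF w, where 'p = 'p] by linarith
  ultimately show ?thesis by blast
next
  case False
  define e where "e = (LEAST i. poly.coeff c i \<noteq> 0)"
  obtain i where i: "i < m" "poly.coeff c i \<noteq> 0"
    using False unfolding monom_1_dvd_iff' by blast
  have ce: "poly.coeff c e \<noteq> 0"
    unfolding e_def by (rule LeastI[of "\<lambda>i. poly.coeff c i \<noteq> 0" i, OF i(2)])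
  have em: "e < m"
    using Least_le[of "\<lambda>i. poly.coeff c i \<noteq> 0" i, OF i(2)] i(1) unfolding e_def by linarith
  have below: "poly.coeff c i = 0" if "i < e" for i
    using not_less_Least[OF that[unfolded e_def]] by simp
  have e_dvd: "Polynomial.monom 1 e dvd c"
    unfolding monom_1_dvd_iff' using below by blast
  show ?thesis
  proof (cases "e < w")
    case True
    \<comment> \<open>Coefficient \<open>e\<close> of \<open>c\<close> lies below the reach of
      \<open>monom 1 w\<close> and cannot be cancelled.\<close>
    have "sols m w c k = {}" for k
    proof -
      have "poly.coeff (c + Polynomial.monom 1 w * q * tr m k) e = poly.coeff c e" for q
        using True by (simp add: mult.assoc coeff_monom_mult)
      then have "\<not> Polynomial.monom 1 m dvd c + Polynomial.monom 1 w * q * tr m k" for q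
        using ce em unfolding monom_1_dvd_iff' by metis
      then show ?thesis
        by (simp add: sols_def)
    qed
    then show ?thesis by (intro exI[of _ 0]) simp
  next
    case False
    then have we: "w \<le> e" by simp
    have tr_order: "\<exists>t :: 'p mod_ring poly. tr m k = Polynomial.monom 1 (e - w) * t \<and> poly.coeff t 0 \<noteq> 0" if "q \<in> sols m w c k" for q k
    proof -
      have q: "poly.coeff q 0 \<noteq> 0" and dvd: "Polynomial.monom 1 m dvd c + Polynomial.monom 1 w * q * tr m k"
        using that w by (auto simp: sols_def search_space_eq)
      have "Polynomial.monom 1 e dvd (Polynomial.monom 1 m :: 'p mod_ring poly)"
        using em by (simp add: monom_1_dvd_iff')
      then have "Polynomial.monom 1 e dvd c + Polynomial.monom 1 w * (q * tr m k)"
        using dvd unfolding mult.assoc by (rule dvd_trans)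
      then have "Polynomial.monom 1 (e - w) dvd q * tr m k"
        unfolding dvd_add_right_iff[OF e_dvd] monom_dvd_monom_mult_iff[OF we] .
      with q have "Polynomial.monom 1 (e - w) dvd (tr m k :: 'p mod_ring poly)"
        by (rule monom_dvd_mult_unit)
      then obtain t :: "'p mod_ring poly" where t: "tr m k = Polynomial.monom 1 (e - w) * t"
        by (rule dvdE)
      have "Polynomial.monom 1 w * q * (Polynomial.monom 1 (e - w) * t)
          = (Polynomial.monom 1 w * Polynomial.monom 1 (e - w)) * (q * t)"
        by (simp only: mult_ac)
      also have "Polynomial.monom 1 w * Polynomial.monom 1 (e - w) = (Polynomial.monom 1 e :: 'p mod_ring poly)"
        using we by (simp add: mult_monom)
      finally have eq: "c + Polynomial.monom 1 w * q * tr m k = c + Polynomial.monom 1 e * (q * t)"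
        unfolding t by simp
      \<comment> \<open>The nonzero coefficient of \<open>c\<close> at \<open>e < m\<close> must be
        cancelled by \<open>coeff q 0 * coeff t 0\<close>, which rules out a higher order of
        \<open>tr m k\<close>.\<close>
      have "poly.coeff (c + Polynomial.monom 1 e * (q * t)) e = 0"
        using dvd em unfolding eq monom_1_dvd_iff' by blast
      then have "poly.coeff c e + poly.coeff q 0 * poly.coeff t 0 = 0"
        by (simp add: coeff_monom_mult coeff_mult_0)
      then have "poly.coeff t 0 \<noteq> 0"
        using ce by auto
      with t show ?thesis by blast
    qed
    have dvd_k: "CARD('p) ^ (e - w) dvd k" if "sols m w c k \<noteq> {}" for k
    proof -
      from that obtain q where "q \<in> sols m w c k" by blast
      from tr_order[OF this] have "Polynomial.monom 1 (e - w) dvd (tr m k :: 'p mod_ring poly)"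
        by auto
      then show ?thesis
        using em by (simp add: monom_dvd_tr_iff)
    qed
    have card: "card (sols m w c k) \<le> CARD('p) ^ (e - w)" for k
    proof -
      \<comment> \<open>Two solutions agree in their lowest \<open>m - e\<close> coefficients, so
        dropping these loses nothing and leaves at most \<open>e - w\<close> of the original
        \<open>m - w\<close>.\<close>
      have inj: "inj_on (poly_shift (m - e)) (sols m w c k)"
      proof (rule inj_onI)
        fix q r assume q: "q \<in> sols m w c k" and r: "r \<in> sols m w c k"
          and shift: "poly_shift (m - e) q = poly_shift (m - e) r"
        obtain t :: "'p mod_ring poly" where t: "tr m k = Polynomial.monom 1 (e - w) * t" and t0: "poly.coeff t 0 \<noteq> 0"
          using tr_order[OF q] by blast
        have eq: "(c + Polynomial.monom 1 w * q * tr m k) - (c + Polynomial.monom 1 w * r * tr m k)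
            = (Polynomial.monom 1 w * Polynomial.monom 1 (e - w)) * (t * (q - r))"
          unfolding t by (simp add: algebra_simps)
        have "Polynomial.monom 1 m dvd (c + Polynomial.monom 1 w * q * tr m k) - (c + Polynomial.monom 1 w * r * tr m k)"
          using q r by (intro dvd_diff) (auto simp: sols_def)
        then have "Polynomial.monom 1 m dvd Polynomial.monom 1 e * (t * (q - r))"
          unfolding eq using we by (simp add: mult_monom)
        then have "Polynomial.monom 1 (m - e) dvd t * (q - r)"
          unfolding monom_dvd_monom_mult_iff[OF less_imp_le[OF em]] .
        with t0 have dvd: "Polynomial.monom 1 (m - e) dvd q - r"
          by (rule monom_dvd_mult_unit)
        have "poly.coeff q i = poly.coeff r i" for i
        proof (cases "i < m - e")
          case True
          then show ?thesis
            using dvd unfolding monom_1_dvd_iff' by simp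
        next
          case False
          have "poly.coeff (poly_shift (m - e) q) (i - (m - e)) = poly.coeff (poly_shift (m - e) r) (i - (m - e))"
            by (simp only: shift)
          then show ?thesis
            using False by (simp add: coeff_poly_shift)
        qed
        then show "q = r" by (simp add: poly_eq_iff)
      qed
      have "poly_shift (m - e) ` sols m w c k \<subseteq> polys (e - w)"
        using w em we by (auto simp: sols_def search_space_eq polys_def coeff_poly_shift)
      then have "card (poly_shift (m - e) ` sols m w c k) \<le> card (polys (e - w) :: 'p mod_ring poly set)"
        by (intro card_mono) auto
      then show ?thesis
        by (simp add: card_image[OF inj] card_polys)
    qed
    show ?thesis using card dvd_k by blast
  qed
qed

text \<open>At most \<open>b ^ v\<close> solutions occur, and only at multiples of
  \<open>b ^ v\<close>, whose weights sum to \<open>b powr (- \<beta> * v) * mu b \<beta>\<close>.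
  Since \<open>\<beta> > 1\<close>, the product is at most \<open>mu b \<beta>\<close>, uniformly in
  \<open>v\<close> and hence in \<open>c\<close>.\<close>

lemma sum_card_sols:
  fixes c :: "'p::prime_card mod_ring poly"
  assumes \<beta>: "\<beta> > 1"
  shows "(\<lambda>k. r_decay CARD('p) \<beta> k * card (sols m w c k)) summable_on {1..}" (is ?th1)
    and "(\<Sum>\<^sub>\<infinity>k\<in>{1..}. r_decay CARD('p) \<beta> k * card (sols m w c k))
    \<le> card (search_space m w :: 'p mod_ring poly set) * (2 * CARD('p) ^ w / CARD('p) ^ m * mu CARD('p) \<beta>)" (is ?th2)
proof -
  let ?b = "CARD('p)" and ?G = "search_space m w :: 'p mod_ring poly set"
  let ?f = "\<lambda>k. r_decay ?b \<beta> k * card (sols m w c k)"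
  have b: "?b > 1" by (rule card_gt_1)
  have r: "r_decay ?b \<beta> k \<ge> 0" for k
    by (simp add: r_decay_def)
  have mu: "(r_decay ?b \<beta> has_sum mu ?b \<beta>) {1..}"
    using b \<beta> by (rule has_sum_mu)
  have mu0: "mu ?b \<beta> > 0"
    using b \<beta> by (rule mu_pos)
  have "(\<lambda>k. r_decay ?b \<beta> k * card ?G) summable_on {1..}"
    using mu by (intro summable_on_cmult_left has_sum_imp_summable)
  then show summ: ?th1
    by (rule summable_on_comparison_test) (auto intro!: mult_left_mono r card_sols_le mult_nonneg_nonneg)
  show ?th2
  proof (cases "w < m")
    case False
    \<comment> \<open>With a single candidate the trivial bound \<open>mu\<close> suffices, because
      \<open>b ^ w / b ^ m \<ge> 1\<close>.\<close>
    then have G: "?G = {1}" by (simp add: search_space_def)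
    have "?f k \<le> r_decay ?b \<beta> k" for k
      using mult_left_mono[OF _ r, of "card (sols m w c k)" 1 k] card_sols_le[of m w c k] G by simp
    then have "infsum ?f {1..} \<le> mu ?b \<beta>"
      using infsum_mono[OF summ has_sum_imp_summable[OF mu]] infsumI[OF mu] by simp
    moreover have "1 \<le> real (?b ^ w) / ?b ^ m"
      using False b by (simp add: power_increasing)
    then have "1 \<le> 2 * (real (?b ^ w) / ?b ^ m)"
      by linarith
    from mult_left_mono[OF this less_imp_le[OF mu0]]
    have "mu ?b \<beta> * 1 \<le> mu ?b \<beta> * (2 * (real (?b ^ w) / ?b ^ m))" .
    ultimately show ?thesis
      by (simp add: G mult_ac)
  next
    case True
    obtain v where v: "\<And>k. card (sols m w c k) \<le> ?b ^ v" "\<And>k. sols m w c k \<noteq> {} \<Longrightarrow> ?b ^ v dvd k"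
      using sols_bound[OF True, of c] by blast
    let ?g = "\<lambda>k. real (?b ^ v) * r_decay ?b \<beta> (?b ^ v * k)"
    have bv: "?b ^ v > 0" by simp
    have inj: "inj_on (\<lambda>k. ?b ^ v * k) {1..}"
      by (auto simp: inj_on_def)
    have "((\<lambda>k. real (?b ^ v) * (real ?b powr (- \<beta> * real v) * r_decay ?b \<beta> k)) has_sum
        real (?b ^ v) * (real ?b powr (- \<beta> * real v) * mu ?b \<beta>)) {1..}"
      by (intro has_sum_cmult_right mu)
    also have "?this \<longleftrightarrow> (?g has_sum real (?b ^ v) * (real ?b powr (- \<beta> * real v) * mu ?b \<beta>)) {1..}"
      by (rule has_sum_cong) (simp add: r_decay_mult_pow[OF b])
    finally have g: "(?g has_sum real (?b ^ v) * (real ?b powr (- \<beta> * real v) * mu ?b \<beta>)) {1..}" .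
    then have g': "((\<lambda>k. real (?b ^ v) * r_decay ?b \<beta> k) has_sum real (?b ^ v) * (real ?b powr (- \<beta> * real v) * mu ?b \<beta>))
        ((\<lambda>k. ?b ^ v * k) ` {1..})"
      using has_sum_reindex[OF inj, of "\<lambda>k. real (?b ^ v) * r_decay ?b \<beta> k"] by (simp add: o_def)
    have "infsum ?f {1..} \<le> infsum (\<lambda>k. real (?b ^ v) * r_decay ?b \<beta> k) ((\<lambda>k. ?b ^ v * k) ` {1..})"
    proof (rule infsum_mono_neutral[OF summ has_sum_imp_summable[OF g']])
      fix k :: nat
      have "real (card (sols m w c k)) \<le> real (?b ^ v)"
        using v(1) by (simp only: of_nat_le_iff)
      from mult_right_mono[OF this r[of k]] show "?f k \<le> real (?b ^ v) * r_decay ?b \<beta> k"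
        by (simp add: mult.commute)
    next
      fix k assume k: "k \<in> {1..} - (\<lambda>k. ?b ^ v * k) ` {1..}"
      have "sols m w c k = {}"
      proof (rule ccontr)
        assume "sols m w c k \<noteq> {}"
        then obtain l where l: "k = ?b ^ v * l"
          using v(2) by (meson dvdE)
        with k have "l \<ge> 1" by (cases l) auto
        with l k show False by auto
      qed
      then show "?f k \<le> 0" by simp
    qed (use r in auto)
    also have "\<dots> = (real ?b powr real v * real ?b powr (- \<beta> * real v)) * mu ?b \<beta>"
      using infsumI[OF g'] by (simp add: powr_realpow)
    also have "real ?b powr real v * real ?b powr (- \<beta> * real v) = real ?b powr ((1 - \<beta>) * real v)"
      by (simp add: powr_add[symmetric] algebra_simps)
    also have "\<dots> \<le> 1"
      using b \<beta> powr_mono[of "(1 - \<beta>) * real v" 0 "real ?b"] by (simp add: mult_nonpos_nonneg)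
    finally have "infsum ?f {1..} \<le> 1 * mu ?b \<beta>"
      using mu0 by (simp add: mult_right_mono)
    \<comment> \<open>The reduced search space is smaller by the factor \<open>b ^ w\<close>, which
      is how this factor enters the constant.\<close>
    also have "1 \<le> card ?G * (2 * ?b ^ w / ?b ^ m)"
    proof -
      have "real (?b ^ (m - w)) \<le> real (2 * card ?G)"
        using card_search_space(1)[OF True] by (simp only: of_nat_le_iff)
      moreover have "real ?b ^ m = real ?b ^ w * real ?b ^ (m - w)"
        using True by (simp flip: power_add)
      ultimately show ?thesis
        using b by (simp add: field_simps)
    qed
    finally show ?thesis
      using mu0 by (simp add: mult_right_mono mult.assoc)
  qed
qed

section \<open>Averaging over the search space\<close>

text \<open>After division by the total \<open>S\<close> all terms lie between 0 and 1, where a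
  power \<open>t \<le> 1\<close> can only increase them.\<close>

lemma infsum_powr_le:
  fixes f :: "'i \<Rightarrow> real"
  assumes f: "f summable_on A" and ft: "(\<lambda>x. f x powr t) summable_on A"
    and nonneg: "\<And>x. x \<in> A \<Longrightarrow> f x \<ge> 0" and t: "0 < t" "t \<le> 1"
  shows "infsum f A powr t \<le> (\<Sum>\<^sub>\<infinity>x\<in>A. f x powr t)"
proof (cases "infsum f A = 0")
  case True
  then show ?thesis
    using infsum_nonneg[of A "\<lambda>x. f x powr t"] by simp
next
  case False
  define S where "S = infsum f A"
  have "S \<ge> 0"
    unfolding S_def by (intro infsum_nonneg nonneg)
  with False have S: "S > 0"
    by (simp add: S_def)
  have le: "f x * (S powr t / S) \<le> f x powr t" if x: "x \<in> A" for x
  proof -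
    have "f x \<le> S"
      using finite_sum_le_infsum[of f A "{x}"] f nonneg x unfolding S_def by auto
    then have "(f x / S) powr 1 \<le> (f x / S) powr t"
      using nonneg[OF x] S t by (intro powr_mono') auto
    then have "f x / S \<le> f x powr t / S powr t"
      using nonneg[OF x] S by (simp add: powr_divide)
    then show ?thesis
      using S by (simp add: field_simps)
  qed
  have "infsum f A * (S powr t / S) \<le> (\<Sum>\<^sub>\<infinity>x\<in>A. f x powr t)"
    unfolding infsum_cmult_left'[symmetric]
    by (intro infsum_mono summable_on_cmult_left f ft le)
  then show ?thesis
    using S unfolding S_def[symmetric] by simp
qed

definition theta ::
  "nat \<Rightarrow> nat \<Rightarrow> real \<Rightarrow> (nat \<Rightarrow> real) \<Rightarrow> (nat \<Rightarrow> 'p::prime_card mod_ring poly) \<Rightarrow> nat \<Rightarrow> real" where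
  "theta m s \<alpha> \<gamma> g d = (\<Sum>\<^sub>\<infinity>h\<in>freqs {1..s}.
     of_bool (h d \<noteq> 0 \<and> dual m s g h) * weight CARD('p) \<alpha> \<gamma> {1..s} h)"

lemma dual_cong:
  assumes "\<And>j. j \<in> {1..s} \<Longrightarrow> h j = 0 \<or> g j = g' j"
  shows "dual m s g h \<longleftrightarrow> dual m s g' h"
proof -
  have "(\<Sum>j\<in>{1..s}. g j * tr m (h j)) = (\<Sum>j\<in>{1..s}. g' j * tr m (h j))"
    using assms by (intro sum.cong refl) fastforce
  then show ?thesis
    unfolding dual_def by (simp only:)
qed

lemma freqs_iff: "h \<in> freqs J \<longleftrightarrow> (\<forall>j. j \<notin> J \<longrightarrow> h j = undefined)"
  by (auto simp: freqs_def PiE_iff extensional_def)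

lemma bij_betw_freqs_fun_upd:
  assumes "d \<in> J"
  shows "bij_betw (\<lambda>(r, k). r(d := k)) (freqs (J - {d}) \<times> {1..}) {h \<in> freqs J. h d \<noteq> 0}"
proof (rule bij_betw_byWitness[where f' = "\<lambda>h. (h(d := undefined), h d)"])
  show "\<forall>a\<in>freqs (J - {d}) \<times> {1..}. (\<lambda>h. (h(d := undefined), h d)) ((\<lambda>(r, k). r(d := k)) a) = a"
    by (auto simp: freqs_iff fun_eq_iff)
  show "(\<lambda>(r, k). r(d := k)) ` (freqs (J - {d}) \<times> {1..}) \<subseteq> {h \<in> freqs J. h d \<noteq> 0}"
    using assms by (auto simp: freqs_iff)
  show "(\<lambda>h. (h(d := undefined), h d)) ` {h \<in> freqs J. h d \<noteq> 0} \<subseteq> freqs (J - {d}) \<times> {1..}"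
    by (auto simp: freqs_iff)
qed auto

context
  fixes s :: nat and \<alpha> :: real and \<gamma> :: "nat \<Rightarrow> real"
  assumes \<alpha>: "\<alpha> > 1" and \<gamma>: "\<And>j. j \<in> {1..s} \<Longrightarrow> \<gamma> j > 0"
begin

lemma weight_nonneg: "0 \<le> weight CARD('p::prime_card) \<alpha> \<gamma> {1..s} h"
  using card_gt_1[where 'p = 'p] by (intro less_imp_le weight_pos \<gamma>) auto

lemma summable_of_bool_weight:
  "(\<lambda>h. of_bool (P h) * weight CARD('p::prime_card) \<alpha> \<gamma> {1..s} h) summable_on freqs {1..s}"
proof (rule summable_on_comparison_test)
  have "(weight CARD('p) \<alpha> \<gamma> {1..s} has_sum (\<Prod>j\<in>{1..s}. 1 + \<gamma> j * mu CARD('p) \<alpha>)) (freqs {1..s})"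
    by (rule has_sum_weight[OF card_gt_1 \<alpha> finite_atLeastAtMost]) (rule \<gamma>)
  then show "weight CARD('p) \<alpha> \<gamma> {1..s} summable_on freqs {1..s}"
    by (rule has_sum_imp_summable)
  show "of_bool (P h) * weight CARD('p) \<alpha> \<gamma> {1..s} h \<le> weight CARD('p) \<alpha> \<gamma> {1..s} h" for h
    by (cases "P h") (simp_all only: of_bool_eq mult_1_left mult_zero_left weight_nonneg order_refl)
  show "0 \<le> of_bool (P h) * weight CARD('p) \<alpha> \<gamma> {1..s} h" for h
    by (intro mult_nonneg_nonneg weight_nonneg) simp
qed

lemma dual_sum_split:
  fixes g :: "nat \<Rightarrow> 'p::prime_card mod_ring poly"
  assumes d: "d \<in> {1..s}"
  shows "dual_sum m s \<alpha> \<gamma> g = (\<Sum>\<^sub>\<infinity>h\<in>freqs {1..s}.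
      of_bool (h \<noteq> (\<lambda>j\<in>{1..s}. 0) \<and> h d = 0 \<and> dual m s g h) * weight CARD('p) \<alpha> \<gamma> {1..s} h) + theta m s \<alpha> \<gamma> g d"
proof -
  have "of_bool (h \<noteq> (\<lambda>j\<in>{1..s}. 0) \<and> dual m s g h) * weight CARD('p) \<alpha> \<gamma> {1..s} h
    = of_bool (h \<noteq> (\<lambda>j\<in>{1..s}. 0) \<and> h d = 0 \<and> dual m s g h) * weight CARD('p) \<alpha> \<gamma> {1..s} h
      + of_bool (h d \<noteq> 0 \<and> dual m s g h) * weight CARD('p) \<alpha> \<gamma> {1..s} h" for h
    using d by (cases "h = (\<lambda>j\<in>{1..s}. 0)"; cases "h d = 0"; cases "dual m s g h") simp_all
  then show ?thesis
    unfolding dual_sum_def theta_def by (simp only: infsum_add summable_of_bool_weight)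
qed

text \<open>Points with \<open>h d = 0\<close> do not see component \<open>d\<close>, so their part
  of the error is common to both vectors and cancels in the comparison.\<close>

lemma theta_mono:
  fixes g g' :: "nat \<Rightarrow> 'p::prime_card mod_ring poly"
  assumes d: "d \<in> {1..s}" and "\<And>j. j \<in> {1..s} \<Longrightarrow> j \<noteq> d \<Longrightarrow> g j = g' j"
    and le: "dual_sum m s \<alpha> \<gamma> g \<le> dual_sum m s \<alpha> \<gamma> g'"
  shows "theta m s \<alpha> \<gamma> g d \<le> theta m s \<alpha> \<gamma> g' d"
proof -
  have "(h \<noteq> (\<lambda>j\<in>{1..s}. 0) \<and> h d = 0 \<and> dual m s g h) \<longleftrightarrow> (h \<noteq> (\<lambda>j\<in>{1..s}. 0) \<and> h d = 0 \<and> dual m s g' h)" for h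
    using dual_cong[of s h g g' m] assms(2) by metis
  then show ?thesis
    using le unfolding dual_sum_split[OF d] by simp
qed

lemma theta_nonneg: "0 \<le> theta m s \<alpha> \<gamma> (g :: nat \<Rightarrow> 'p::prime_card mod_ring poly) d"
  unfolding theta_def by (intro infsum_nonneg mult_nonneg_nonneg weight_nonneg) simp

text \<open>Summing over the candidates first turns the dual condition into a count of solutions.
  With \<open>h\<close> split into its entry at \<open>d\<close> and the rest \<open>r\<close>, the
  inner sum has a bound independent of \<open>r\<close>, and the outer one is a product over the
  other coordinates.\<close>

lemma sum_theta_le:
  fixes u :: "nat \<Rightarrow> 'p::prime_card mod_ring poly"
  assumes d: "d \<in> {1..s}"
  shows "(\<Sum>q\<in>search_space m w. theta m s \<alpha> \<gamma> (u(d := Polynomial.monom 1 w * q)) d)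
    \<le> card (search_space m w :: 'p mod_ring poly set) *
      (\<gamma> d * (2 * CARD('p) ^ w / CARD('p) ^ m * mu CARD('p) \<alpha>) * (\<Prod>j\<in>{1..s} - {d}. 1 + \<gamma> j * mu CARD('p) \<alpha>))"
proof -
  let ?b = "CARD('p)" and ?G = "search_space m w :: 'p mod_ring poly set"
  let ?R = "{1..s} - {d}" and ?J = "{1..s}"
  let ?X = "2 * ?b ^ w / ?b ^ m * mu ?b \<alpha>"
  define c where "c h = (\<Sum>j\<in>?R. u j * tr m (h j))" for h
  define \<psi> where "\<psi> h = (\<Sum>q\<in>?G. of_bool (h d \<noteq> 0 \<and> dual m s (u(d := Polynomial.monom 1 w * q)) h) * weight ?b \<alpha> \<gamma> ?J h)" for h
  define F where "F = (\<lambda>(r, k). weight ?b \<alpha> \<gamma> ?R r * (\<gamma> d * (r_decay ?b \<alpha> k * card (sols m w (c r) k))))"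
  let ?T = "\<Sum>q\<in>?G. theta m s \<alpha> \<gamma> (u(d := Polynomial.monom 1 w * q)) d"
  have \<psi>_sum: "(\<psi> has_sum ?T) (freqs ?J)"
    unfolding \<psi>_def theta_def by (intro has_sum_sum has_sum_infsum summable_of_bool_weight finite_search_space)
  have \<psi>: "\<psi> h = of_bool (h d \<noteq> 0) * card (sols m w (c h) (h d)) * weight ?b \<alpha> \<gamma> ?J h" for h
  proof -
    have iff: "dual m s (u(d := Polynomial.monom 1 w * q)) h
        \<longleftrightarrow> Polynomial.monom 1 m dvd c h + Polynomial.monom 1 w * q * tr m (h d)" for q
    proof -
      have "(\<Sum>j\<in>?J. (u(d := Polynomial.monom 1 w * q)) j * tr m (h j))
        = Polynomial.monom 1 w * q * tr m (h d) + (\<Sum>j\<in>?R. (u(d := Polynomial.monom 1 w * q)) j * tr m (h j))"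
        using sum.remove[OF finite_atLeastAtMost d, of "\<lambda>j. (u(d := Polynomial.monom 1 w * q)) j * tr m (h j)"] by simp
      also have "(\<Sum>j\<in>?R. (u(d := Polynomial.monom 1 w * q)) j * tr m (h j)) = c h"
        unfolding c_def by (intro sum.cong) auto
      finally show ?thesis
        unfolding dual_def by (simp only: add.commute)
    qed
    have "(\<Sum>q\<in>?G. of_bool (dual m s (u(d := Polynomial.monom 1 w * q)) h)) = real (card (sols m w (c h) (h d)))"
      unfolding iff sols_def by (simp add: of_bool_def sum.If_cases Int_def)
    then show ?thesis
      unfolding \<psi>_def by (simp add: sum_distrib_right[symmetric] of_bool_conj mult.assoc sum_distrib_left[symmetric])
  qed
  have bij: "bij_betw (\<lambda>(r, k). r(d := k)) (freqs ?R \<times> {1..}) {h \<in> freqs ?J. h d \<noteq> 0}"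
    using d by (rule bij_betw_freqs_fun_upd)
  have "(\<psi> has_sum ?T) {h \<in> freqs ?J. h d \<noteq> 0}"
  proof (rule has_sum_cong_neutral[THEN iffD1, OF _ _ _ \<psi>_sum])
    show "\<psi> h = 0" if "h \<in> freqs ?J - {h \<in> freqs ?J. h d \<noteq> 0}" for h
      using that unfolding \<psi> by simp
  qed auto
  then have "((\<lambda>x. \<psi> ((\<lambda>(r, k). r(d := k)) x)) has_sum ?T) (freqs ?R \<times> {1..})"
    by (rule has_sum_reindex_bij_betw[OF bij, THEN iffD2])
  moreover have "\<psi> ((\<lambda>(r, k). r(d := k)) x) = F x" if "x \<in> freqs ?R \<times> {1..}" for x
  proof -
    obtain r k where x: "x = (r, k)" "k \<ge> 1"
      using \<open>x \<in> _\<close> by auto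
    have "weight ?b \<alpha> \<gamma> ?J (r(d := k)) = coord_weight ?b \<alpha> \<gamma> d k * weight ?b \<alpha> \<gamma> ?R (r(d := k))"
      unfolding weight_def using prod.remove[OF finite_atLeastAtMost d, of "\<lambda>j. coord_weight ?b \<alpha> \<gamma> j ((r(d := k)) j)"] by simp
    moreover have "weight ?b \<alpha> \<gamma> ?R (r(d := k)) = weight ?b \<alpha> \<gamma> ?R r"
      unfolding weight_def by (intro prod.cong) auto
    moreover have "c (r(d := k)) = c r"
      unfolding c_def by (intro sum.cong) auto
    ultimately show ?thesis
      using x by (simp add: \<psi> F_def coord_weight_def)
  qed
  ultimately have F_sum: "(F has_sum ?T) (freqs ?R \<times> {1..})"
    using has_sum_cong[of "freqs ?R \<times> {1..}" "\<lambda>x. \<psi> ((\<lambda>(r, k). r(d := k)) x)" F ?T] by blast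
  have inner: "((\<lambda>k. F (r, k)) has_sum weight ?b \<alpha> \<gamma> ?R r * (\<gamma> d * (\<Sum>\<^sub>\<infinity>k\<in>{1..}. r_decay ?b \<alpha> k * card (sols m w (c r) k)))) {1..}" for r
    unfolding F_def split by (intro has_sum_cmult_right has_sum_infsum sum_card_sols(1) \<alpha>)
  have outer: "((\<lambda>r. weight ?b \<alpha> \<gamma> ?R r * (\<gamma> d * (\<Sum>\<^sub>\<infinity>k\<in>{1..}. r_decay ?b \<alpha> k * card (sols m w (c r) k)))) has_sum ?T) (freqs ?R)"
    using F_sum inner by (rule has_sum_SigmaD)
  have weight_R: "(weight ?b \<alpha> \<gamma> ?R has_sum (\<Prod>j\<in>?R. 1 + \<gamma> j * mu ?b \<alpha>)) (freqs ?R)"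
    using \<gamma> by (intro has_sum_weight card_gt_1 \<alpha>) auto
  have "?T \<le> (\<Prod>j\<in>?R. 1 + \<gamma> j * mu ?b \<alpha>) * (\<gamma> d * (card ?G * ?X))"
  proof (rule has_sum_mono[OF outer has_sum_cmult_left[OF weight_R]])
    fix r
    have "0 \<le> weight ?b \<alpha> \<gamma> ?R r"
      using card_gt_1[where 'p = 'p] \<gamma> by (intro less_imp_le weight_pos) auto
    then show "weight ?b \<alpha> \<gamma> ?R r * (\<gamma> d * (\<Sum>\<^sub>\<infinity>k\<in>{1..}. r_decay ?b \<alpha> k * card (sols m w (c r) k)))
        \<le> weight ?b \<alpha> \<gamma> ?R r * (\<gamma> d * (card ?G * ?X))"
      using \<gamma>[OF d] sum_card_sols(2)[OF \<alpha>, of m w "c r"] by (intro mult_left_mono) auto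
  qed
  then show ?thesis
    by (simp only: mult_ac)
qed

end

lemma theta_powr_le:
  fixes g :: "nat \<Rightarrow> 'p::prime_card mod_ring poly"
  assumes \<alpha>: "\<alpha> > 1" and \<gamma>: "\<And>j. j \<in> {1..s} \<Longrightarrow> \<gamma> j > 0" and t: "0 < t" "t \<le> 1" "\<alpha> * t > 1"
  shows "theta m s \<alpha> \<gamma> g d powr t \<le> theta m s (\<alpha> * t) (\<lambda>j. \<gamma> j powr t) g d"
proof -
  let ?P = "\<lambda>h. h d \<noteq> 0 \<and> dual m s g h"
  have pos: "\<gamma> j powr t > 0" if "j \<in> {1..s}" for j
    using \<gamma>[OF that] by simp
  have eq: "(of_bool (?P h) * weight CARD('p) \<alpha> \<gamma> {1..s} h) powr t
    = of_bool (?P h) * weight CARD('p) (\<alpha> * t) (\<lambda>j. \<gamma> j powr t) {1..s} h" for h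
  proof -
    have "weight CARD('p) \<alpha> \<gamma> {1..s} h powr t = weight CARD('p) (\<alpha> * t) (\<lambda>j. \<gamma> j powr t) {1..s} h"
      by (rule weight_powr[OF _ \<gamma>]) simp_all
    then show ?thesis
      by (cases "?P h") simp_all
  qed
  have "theta m s \<alpha> \<gamma> g d powr t \<le> (\<Sum>\<^sub>\<infinity>h\<in>freqs {1..s}. (of_bool (?P h) * weight CARD('p) \<alpha> \<gamma> {1..s} h) powr t)"
    unfolding theta_def
  proof (rule infsum_powr_le)
    show "(\<lambda>h. of_bool (?P h) * weight CARD('p) \<alpha> \<gamma> {1..s} h) summable_on freqs {1..s}"
      by (rule summable_of_bool_weight[OF \<alpha> \<gamma>])
    show "(\<lambda>h. (of_bool (?P h) * weight CARD('p) \<alpha> \<gamma> {1..s} h) powr t) summable_on freqs {1..s}"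
      unfolding eq by (rule summable_of_bool_weight[OF t(3) pos])
    show "0 \<le> of_bool (?P h) * weight CARD('p) \<alpha> \<gamma> {1..s} h" for h
      by (intro mult_nonneg_nonneg weight_nonneg[OF \<alpha> \<gamma>]) simp
  qed (use t in auto)
  then show ?thesis
    unfolding eq theta_def .
qed

text \<open>The value at the minimizer is below that of every candidate, hence its power is below
  the mean of the candidates' powers, each of which Jensen's inequality bounds by a sum with
  modified weights. Multiplication by the cardinality replaces taking the mean.\<close>

lemma minimizer_theta_bound:
  fixes g u :: "nat \<Rightarrow> 'p::prime_card mod_ring poly"
  assumes \<alpha>: "\<alpha> > 1" and \<gamma>: "\<And>j. j \<in> {1..s} \<Longrightarrow> \<gamma> j > 0" and t: "0 < t" "t \<le> 1" "\<alpha> * t > 1"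
    and d: "d \<in> {1..s}"
    and min: "\<And>q. q \<in> search_space m w \<Longrightarrow>
      dual_sum m s \<alpha> \<gamma> u \<le> dual_sum m s \<alpha> \<gamma> (u(d := Polynomial.monom 1 w * q))"
  shows "theta m s \<alpha> \<gamma> u d powr t \<le> \<gamma> d powr t * (2 * CARD('p) ^ w / CARD('p) ^ m * mu CARD('p) (\<alpha> * t))
    * (\<Prod>j\<in>{1..s} - {d}. 1 + \<gamma> j powr t * mu CARD('p) (\<alpha> * t))"
    (is "_ \<le> ?B")
proof -
  let ?G = "search_space m w :: 'p mod_ring poly set"
  have pos: "\<gamma> j powr t > 0" if "j \<in> {1..s}" for j
    using \<gamma>[OF that] by simp
  have le: "theta m s \<alpha> \<gamma> u d powr t
      \<le> theta m s (\<alpha> * t) (\<lambda>j. \<gamma> j powr t) (u(d := Polynomial.monom 1 w * q)) d" if q: "q \<in> ?G" for q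
  proof -
    have "theta m s \<alpha> \<gamma> u d \<le> theta m s \<alpha> \<gamma> (u(d := Polynomial.monom 1 w * q)) d"
      by (rule theta_mono[OF \<alpha> \<gamma> d _ min[OF q]]) simp_all
    then have "theta m s \<alpha> \<gamma> u d powr t \<le> theta m s \<alpha> \<gamma> (u(d := Polynomial.monom 1 w * q)) d powr t"
      using t by (intro powr_mono2 theta_nonneg[OF \<alpha> \<gamma>]) auto
    also have "\<dots> \<le> theta m s (\<alpha> * t) (\<lambda>j. \<gamma> j powr t) (u(d := Polynomial.monom 1 w * q)) d"
      by (rule theta_powr_le[OF \<alpha> \<gamma> t])
    finally show ?thesis .
  qed
  have "card ?G * theta m s \<alpha> \<gamma> u d powr t
      \<le> (\<Sum>q\<in>?G. theta m s (\<alpha> * t) (\<lambda>j. \<gamma> j powr t) (u(d := Polynomial.monom 1 w * q)) d)"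
    using sum_mono[of ?G "\<lambda>_. theta m s \<alpha> \<gamma> u d powr t", OF le] by simp
  also have "\<dots> \<le> card ?G * ?B"
    by (rule sum_theta_le[OF t(3) pos d])
  finally have "card ?G * theta m s \<alpha> \<gamma> u d powr t \<le> card ?G * ?B" .
  moreover have "real (card ?G) > 0"
  proof (cases "w < m")
    case True
    have "0 < CARD('p) ^ (m - w)" by simp
    with card_search_space(1)[OF True, where 'p = 'p] have "0 < card ?G" by linarith
    then show ?thesis by simp
  qed (simp add: search_space_def)
  ultimately show ?thesis
    by (rule mult_left_le_imp_le)
qed

text \<open>If \<open>d\<close> is the last nonzero entry of \<open>h\<close>, components after
  \<open>d\<close> are multiplied by zero, so the intermediate vector \<open>U d\<close> and the
  final vector \<open>G\<close> impose the same condition on \<open>h\<close>.\<close>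

lemma dual_sum_le_sum_theta:
  fixes G :: "nat \<Rightarrow> 'p::prime_card mod_ring poly"
  assumes \<alpha>: "\<alpha> > 1" and \<gamma>: "\<And>j. j \<in> {1..s} \<Longrightarrow> \<gamma> j > 0"
    and U: "\<And>d j. d \<in> {1..s} \<Longrightarrow> j \<in> {1..s} \<Longrightarrow> j \<le> d \<Longrightarrow> U d j = G j"
  shows "dual_sum m s \<alpha> \<gamma> G \<le> (\<Sum>d\<in>{1..s}. theta m s \<alpha> \<gamma> (U d) d)"
proof -
  let ?w = "weight CARD('p) \<alpha> \<gamma> {1..s}"
  have hs: "((\<lambda>h. of_bool (P h) * ?w h) has_sum (\<Sum>\<^sub>\<infinity>h\<in>freqs {1..s}. of_bool (P h) * ?w h)) (freqs {1..s})" for P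
    by (rule has_sum_infsum[OF summable_of_bool_weight[OF \<alpha> \<gamma>]])
  have "((\<lambda>h. \<Sum>d\<in>{1..s}. of_bool (h d \<noteq> 0 \<and> dual m s (U d) h) * ?w h) has_sum
      (\<Sum>d\<in>{1..s}. theta m s \<alpha> \<gamma> (U d) d)) (freqs {1..s})"
    unfolding theta_def by (rule has_sum_sum[OF finite_atLeastAtMost hs])
  with hs[of "\<lambda>h. h \<noteq> (\<lambda>j\<in>{1..s}. 0) \<and> dual m s G h"] show ?thesis
    unfolding dual_sum_def[symmetric]
  proof (rule has_sum_mono)
    fix h :: "nat \<Rightarrow> nat" assume h: "h \<in> freqs {1..s}"
    have nonneg: "0 \<le> of_bool Q * ?w h" for Q
      by (intro mult_nonneg_nonneg weight_nonneg[OF \<alpha> \<gamma>]) simp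
    show "of_bool (h \<noteq> (\<lambda>j\<in>{1..s}. 0) \<and> dual m s G h) * ?w h
      \<le> (\<Sum>d\<in>{1..s}. of_bool (h d \<noteq> 0 \<and> dual m s (U d) h) * ?w h)"
    proof (cases "h \<noteq> (\<lambda>j\<in>{1..s}. 0) \<and> dual m s G h")
      case True
      define D where "D = {j \<in> {1..s}. h j \<noteq> 0}"
      have "D \<noteq> {}"
      proof
        assume "D = {}"
        then have "h = (\<lambda>j\<in>{1..s}. 0)"
          using h unfolding D_def by (intro ext) (simp add: freqs_iff restrict_def)
        with True show False by blast
      qed
      moreover have "finite D" by (simp add: D_def)
      ultimately have "Max D \<in> D" and max: "\<And>j. j \<in> D \<Longrightarrow> j \<le> Max D"
        by simp_all
      then have d: "Max D \<in> {1..s}" "h (Max D) \<noteq> 0"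
        by (simp_all add: D_def)
      have "dual m s (U (Max D)) h \<longleftrightarrow> dual m s G h"
      proof (rule dual_cong)
        fix j assume j: "j \<in> {1..s}"
        show "h j = 0 \<or> U (Max D) j = G j"
          using max[of j] U[OF d(1) j] j by (cases "h j = 0") (simp_all add: D_def)
      qed
      then have "of_bool (h \<noteq> (\<lambda>j\<in>{1..s}. 0) \<and> dual m s G h) * ?w h
          = of_bool (h (Max D) \<noteq> 0 \<and> dual m s (U (Max D)) h) * ?w h"
        using True d by simp
      also have "\<dots> \<le> (\<Sum>d\<in>{1..s}. of_bool (h d \<noteq> 0 \<and> dual m s (U d) h) * ?w h)"
        by (rule member_le_sum[OF d(1) nonneg finite_atLeastAtMost])
      finally show ?thesis .
    next
      case False
      then have "of_bool (h \<noteq> (\<lambda>j\<in>{1..s}. 0) \<and> dual m s G h) * ?w h = 0"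
        by (simp only: of_bool_eq mult_zero_left)
      then show ?thesis
        by (simp only:) (intro sum_nonneg nonneg)
    qed
  qed
qed

section \<open>From the single steps to the final constant\<close>

lemma dual_sum_nonneg:
  assumes "\<And>j. j \<in> {1..s} \<Longrightarrow> \<gamma> j > 0"
  shows "0 \<le> dual_sum m s \<alpha> \<gamma> (g :: nat \<Rightarrow> 'p::prime_card mod_ring poly)"
  unfolding dual_sum_def using card_gt_1[where 'p = 'p]
  by (intro infsum_nonneg mult_nonneg_nonneg less_imp_le[OF weight_pos] assms) auto

text \<open>The factor missing on the left varies with \<open>d\<close>; exchanging factor
  \<open>s\<close> for the larger factor \<open>d\<close> gives one product that serves all
  steps.\<close>

lemma prod_remove_le:
  fixes f :: "nat \<Rightarrow> real"
  assumes d: "d \<in> {1..s}" and nonneg: "\<And>j. j \<in> {1..s} \<Longrightarrow> f j \<ge> 0" and le: "f s \<le> f d"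
  shows "(\<Prod>j\<in>{1..s} - {d}. f j) \<le> (\<Prod>j\<in>{1..s - 1}. f j)"
proof -
  have s: "{1..s - 1} = {1..s} - {s}"
    using d by auto
  show ?thesis
  proof (cases "d = s")
    case True
    then show ?thesis unfolding s by simp
  next
    case False
    let ?A = "{1..s} - {s} - {d}"
    have "(\<Prod>j\<in>{1..s} - {d}. f j) = f s * (\<Prod>j\<in>?A. f j)"
      using d False prod.remove[of "{1..s} - {d}" s f] by (simp add: Diff_insert2[symmetric] insert_commute)
    also have "\<dots> \<le> f d * (\<Prod>j\<in>?A. f j)"
      using le nonneg by (intro mult_right_mono prod_nonneg) auto
    also have "\<dots> = (\<Prod>j\<in>{1..s - 1}. f j)"
      unfolding s using d False by (intro prod.remove[symmetric]) auto
    finally show ?thesis .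
  qed
qed

lemma scs_error_bound:
  fixes g0 g :: "nat \<Rightarrow> 'p::prime_card mod_ring poly"
  assumes m: "m \<ge> 1" and \<alpha>: "\<alpha> > 1" and \<gamma>: "\<And>j. j \<in> {1..s} \<Longrightarrow> \<gamma> j > 0"
    and \<gamma>_mono: "\<And>i j. 1 \<le> i \<Longrightarrow> i \<le> j \<Longrightarrow> \<gamma> j \<le> \<gamma> i"
    and scs: "reduced_scs m s \<alpha> (\<lambda>u. \<Prod>j\<in>u. \<gamma> j) w g0 g"
    and \<delta>: "0 < \<delta>" "\<delta> \<le> (\<alpha> - 1) / 2"
  shows "worst_case_error m s \<alpha> (\<lambda>u. \<Prod>j\<in>u. \<gamma> j) (\<lambda>j. Polynomial.monom 1 (w j) * g j)
    \<le> scs_const CARD('p) w s \<alpha> \<gamma> \<delta> * real (CARD('p) ^ m) powr (- \<alpha> / 2 + \<delta>)"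
proof -
  let ?b = "CARD('p)"
  let ?G = "\<lambda>j. Polynomial.monom 1 (w j) * g j"
  define t where "t = 1 / (\<alpha> - 2 * \<delta>)"
  have p: "\<alpha> - 2 * \<delta> \<ge> 1"
    using \<delta> by (simp add: field_simps)
  have t: "0 < t" "t \<le> 1" "\<alpha> * t > 1"
    using p \<delta> by (simp_all add: t_def field_simps)
  define \<mu> where "\<mu> = mu ?b (\<alpha> * t)"
  have \<mu>: "\<mu> > 0"
    unfolding \<mu>_def using card_gt_1 t(3) by (rule mu_pos)
  define P where "P = (\<Prod>j\<in>{1..s - 1}. 1 + \<gamma> j powr t * \<mu>)"
  define C where "C = (\<Sum>d=1..s. \<gamma> d powr t * ?b ^ w d) * (2 * \<mu>) * P"
  define U where "U d = scs_vector w g0 g d (g d)" for d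
  have wce: "worst_case_error m s \<alpha> (\<lambda>u. \<Prod>j\<in>u. \<gamma> j) v = sqrt (dual_sum m s \<alpha> \<gamma> v)"
    for v :: "nat \<Rightarrow> 'p mod_ring poly"
    by (rule worst_case_error_eq[OF \<alpha> _ m]) (rule \<gamma>)
  have nonneg: "0 \<le> dual_sum m s \<alpha> \<gamma> v" for v :: "nat \<Rightarrow> 'p mod_ring poly"
    by (rule dual_sum_nonneg[OF \<gamma>])
  have min: "dual_sum m s \<alpha> \<gamma> (U d) \<le> dual_sum m s \<alpha> \<gamma> ((U d)(d := Polynomial.monom 1 (w d) * q))"
    if d: "d \<in> {1..s}" and q: "q \<in> search_space m (w d)" for d q
  proof -
    have "(U d)(d := Polynomial.monom 1 (w d) * q) = scs_vector w g0 g d q"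
      by (auto simp: U_def scs_vector_def)
    moreover have "(worst_case_error m s \<alpha> (\<lambda>u. \<Prod>j\<in>u. \<gamma> j) (U d))\<^sup>2
        \<le> (worst_case_error m s \<alpha> (\<lambda>u. \<Prod>j\<in>u. \<gamma> j) (scs_vector w g0 g d q))\<^sup>2"
      using scs d q unfolding reduced_scs_def U_def by blast
    ultimately show ?thesis
      unfolding wce real_sqrt_pow2[OF nonneg] by (simp only:)
  qed
  have bound: "theta m s \<alpha> \<gamma> (U d) d powr t \<le> \<gamma> d powr t * ?b ^ w d * (2 * \<mu> * P / ?b ^ m)"
    if d: "d \<in> {1..s}" for d
  proof -
    have "theta m s \<alpha> \<gamma> (U d) d powr t \<le> \<gamma> d powr t * (2 * ?b ^ w d / ?b ^ m * \<mu>)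
        * (\<Prod>j\<in>{1..s} - {d}. 1 + \<gamma> j powr t * \<mu>)"
      unfolding \<mu>_def by (rule minimizer_theta_bound[OF \<alpha> \<gamma> t d min[OF d]])
    also have "\<dots> \<le> \<gamma> d powr t * (2 * ?b ^ w d / ?b ^ m * \<mu>) * P"
    proof (rule mult_left_mono)
      show "(\<Prod>j\<in>{1..s} - {d}. 1 + \<gamma> j powr t * \<mu>) \<le> P"
        unfolding P_def
      proof (rule prod_remove_le[OF d])
        have "\<gamma> s powr t \<le> \<gamma> d powr t"
          using d t \<gamma>[of s] \<gamma>_mono[of d s] by (intro powr_mono2) auto
        then show "1 + \<gamma> s powr t * \<mu> \<le> 1 + \<gamma> d powr t * \<mu>"
          using \<mu> by simp
      qed (use \<mu> in simp)
      show "0 \<le> \<gamma> d powr t * (2 * ?b ^ w d / ?b ^ m * \<mu>)"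
        using \<mu> by simp
    qed
    finally show ?thesis
      by (simp add: mult_ac)
  qed
  have "dual_sum m s \<alpha> \<gamma> ?G powr t \<le> (\<Sum>d\<in>{1..s}. theta m s \<alpha> \<gamma> (U d) d) powr t"
    using t nonneg by (intro powr_mono2 dual_sum_le_sum_theta \<alpha> \<gamma>) (auto simp: U_def scs_vector_def)
  \<comment> \<open>Jensen's inequality once more, now over the steps of the algorithm.\<close>
  also have "\<dots> \<le> (\<Sum>d\<in>{1..s}. theta m s \<alpha> \<gamma> (U d) d powr t)"
  proof -
    have "infsum (\<lambda>d. theta m s \<alpha> \<gamma> (U d) d) {1..s} powr t \<le> (\<Sum>\<^sub>\<infinity>d\<in>{1..s}. theta m s \<alpha> \<gamma> (U d) d powr t)"
      by (intro infsum_powr_le summable_on_finite finite_atLeastAtMost theta_nonneg[OF \<alpha> \<gamma>] t)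
    then show ?thesis
      by (simp only: infsum_finite[OF finite_atLeastAtMost])
  qed
  also have "\<dots> \<le> (\<Sum>d\<in>{1..s}. \<gamma> d powr t * ?b ^ w d * (2 * \<mu> * P / ?b ^ m))"
    by (intro sum_mono bound)
  also have "\<dots> = (\<Sum>d\<in>{1..s}. \<gamma> d powr t * ?b ^ w d) * (2 * \<mu> * P / ?b ^ m)"
    by (rule sum_distrib_right[symmetric])
  also have "\<dots> = C / ?b ^ m"
    by (simp add: C_def)
  finally have le: "dual_sum m s \<alpha> \<gamma> ?G powr t \<le> C / ?b ^ m" .
  \<comment> \<open>The exponent \<open>\<alpha> / 2 - \<delta>\<close> undoes \<open>t\<close> and
    takes the square root that turns \<open>dual_sum\<close> into the error.\<close>
  have half: "t * (\<alpha> / 2 - \<delta>) = 1 / 2"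
    using p by (simp add: t_def field_simps)
  have "worst_case_error m s \<alpha> (\<lambda>u. \<Prod>j\<in>u. \<gamma> j) ?G = (dual_sum m s \<alpha> \<gamma> ?G powr t) powr (\<alpha> / 2 - \<delta>)"
    unfolding wce powr_powr half using nonneg[of ?G] by (simp add: powr_half_sqrt)
  also have "\<dots> \<le> (C / ?b ^ m) powr (\<alpha> / 2 - \<delta>)"
    using p le by (intro powr_mono2) auto
  also have "\<dots> = C powr (\<alpha> / 2 - \<delta>) * real (?b ^ m) powr (- \<alpha> / 2 + \<delta>)"
  proof -
    have "(C / x) powr y = C powr y * x powr (- y)" for x y
      unfolding powr_divide powr_minus by (rule divide_inverse)
    moreover have "- (\<alpha> / 2 - \<delta>) = - \<alpha> / 2 + \<delta>"
      by simp
    ultimately show ?thesis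
      by (metis of_nat_power)
  qed
  also have "C powr (\<alpha> / 2 - \<delta>) = scs_const ?b w s \<alpha> \<gamma> \<delta>"
    by (simp add: scs_const_def C_def P_def \<mu>_def t_def)
  finally show ?thesis .
qed

text \<open>By \<open>1 + x \<le> exp x\<close> the product is controlled by the sum of the powered
  weights, and since \<open>b ^ w d \<ge> 1\<close> that sum is at most the assumed convergent
  series.\<close>

lemma scs_const_bounded:
  fixes \<gamma> :: "nat \<Rightarrow> real" and w :: "nat \<Rightarrow> nat"
  assumes b: "b > 1" and \<delta>: "0 < \<delta>" "\<delta> \<le> (\<alpha> - 1) / 2"
    and summ: "summable (\<lambda>d. \<gamma> (Suc d) powr (1 / (\<alpha> - 2 * \<delta>)) * real b ^ w (Suc d))"
  shows "\<exists>B. \<forall>s\<ge>1. scs_const b w s \<alpha> \<gamma> \<delta> \<le> B"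
proof -
  define t where "t = 1 / (\<alpha> - 2 * \<delta>)"
  define \<mu> where "\<mu> = mu b (\<alpha> / (\<alpha> - 2 * \<delta>))"
  define T where "T = (\<Sum>d. \<gamma> (Suc d) powr t * real b ^ w (Suc d))"
  have p: "\<alpha> - 2 * \<delta> \<ge> 1"
    using \<delta> by (simp add: field_simps)
  have \<mu>: "\<mu> > 0"
    unfolding \<mu>_def using b p \<delta> by (intro mu_pos) (simp_all add: field_simps)
  have part: "(\<Sum>d=1..n. \<gamma> d powr t * real b ^ w d) \<le> T" for n
  proof -
    have "(\<Sum>d=1..n. \<gamma> d powr t * real b ^ w d) = (\<Sum>d<n. \<gamma> (Suc d) powr t * real b ^ w (Suc d))"
      by (rule sum.reindex_bij_witness[of _ Suc "\<lambda>d. d - 1"]) auto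
    also have "\<dots> \<le> T"
      unfolding T_def using summ by (intro sum_le_suminf) (auto simp: t_def)
    finally show ?thesis .
  qed
  have prod: "(\<Prod>d=1..n. 1 + \<gamma> d powr t * \<mu>) \<le> exp (\<mu> * T)" for n
  proof -
    have "(\<Prod>d=1..n. 1 + \<gamma> d powr t * \<mu>) \<le> (\<Prod>d=1..n. exp (\<gamma> d powr t * \<mu>))"
      using \<mu> by (intro prod_mono) (auto simp: exp_ge_add_one_self)
    also have "\<dots> = exp (\<mu> * (\<Sum>d=1..n. \<gamma> d powr t))"
      by (simp add: exp_sum[symmetric] sum_distrib_left mult.commute)
    also have "(\<Sum>d=1..n. \<gamma> d powr t) \<le> (\<Sum>d=1..n. \<gamma> d powr t * real b ^ w d)"
      using b by (intro sum_mono) (simp add: mult_le_cancel_left1)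
    also have "\<dots> \<le> T"
      by (rule part)
    finally show ?thesis
      using \<mu> by simp
  qed
  have "scs_const b w s \<alpha> \<gamma> \<delta> \<le> (T * (2 * \<mu>) * exp (\<mu> * T)) powr (\<alpha> / 2 - \<delta>)" for s
  proof -
    have nonneg: "0 \<le> (\<Sum>d=1..s. \<gamma> d powr t * real b ^ w d)" "0 \<le> (\<Prod>d=1..s - 1. 1 + \<gamma> d powr t * \<mu>)"
      using \<mu> by (auto intro!: sum_nonneg prod_nonneg)
    then have "0 \<le> T"
      using part[of s] by linarith
    then have "(\<Sum>d=1..s. \<gamma> d powr t * real b ^ w d) * (2 * \<mu>) * (\<Prod>d=1..s - 1. 1 + \<gamma> d powr t * \<mu>)
        \<le> T * (2 * \<mu>) * exp (\<mu> * T)"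
      using \<mu> nonneg by (intro mult_mono mult_nonneg_nonneg part prod order_refl) auto
    moreover have "scs_const b w s \<alpha> \<gamma> \<delta> =
        ((\<Sum>d=1..s. \<gamma> d powr t * real b ^ w d) * (2 * \<mu>) * (\<Prod>d=1..s - 1. 1 + \<gamma> d powr t * \<mu>)) powr (\<alpha> / 2 - \<delta>)"
      by (simp only: scs_const_def t_def \<mu>_def)
    ultimately show ?thesis
      using p \<mu> nonneg by (simp only:) (intro powr_mono2 mult_nonneg_nonneg; simp)
  qed
  then show ?thesis by blast
qed

theorem corollary12:
  fixes b m N s :: nat and \<alpha> :: real
    and \<gamma> :: "nat \<Rightarrow> real" and w :: "nat \<Rightarrow> nat"
    and g0 g :: "nat \<Rightarrow> 'p::prime_card mod_ring poly"
  assumes "b = CARD('p)" and "m \<ge> 1" and "N = b ^ m" and "s \<ge> 1" and "\<alpha> > 1"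
    and "\<And>j. j \<ge> 1 \<Longrightarrow> \<gamma> j > 0"
    and "\<And>j. j \<ge> 1 \<Longrightarrow> \<gamma> (Suc j) \<le> \<gamma> j"
    and "\<And>j. j \<ge> 1 \<Longrightarrow> w j \<le> w (Suc j)"
    and "\<And>j. j \<in> {1..s} \<Longrightarrow> degree (g0 j) < m"
    and "reduced_scs m s \<alpha> (\<lambda>u. \<Prod>j\<in>u. \<gamma> j) w g0 g"
  shows "\<forall>\<delta>\<in>{0<..(\<alpha> - 1) / 2}.
      worst_case_error m s \<alpha> (\<lambda>u. \<Prod>j\<in>u. \<gamma> j) (\<lambda>j. Polynomial.monom 1 (w j) * g j)
        \<le> scs_const b w s \<alpha> \<gamma> \<delta> * real N powr (- \<alpha> / 2 + \<delta>)
      \<and> (summable (\<lambda>d. \<gamma> (Suc d) powr (1 / (\<alpha> - 2 * \<delta>)) * real b ^ w (Suc d))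
          \<longrightarrow> (\<exists>B. \<forall>s'\<ge>1. scs_const b w s' \<alpha> \<gamma> \<delta> \<le> B))"
proof (intro ballI conjI impI)
  fix \<delta> assume "\<delta> \<in> {0<..(\<alpha> - 1) / 2}"
  then have \<delta>: "0 < \<delta>" "\<delta> \<le> (\<alpha> - 1) / 2" by auto
  \<comment> \<open>Monotonicity is assumed between neighbours, whereas the exchange of factors
    compares \<open>s\<close> with an arbitrary earlier \<open>d\<close>.\<close>
  have \<gamma>_mono: "\<gamma> j \<le> \<gamma> i" if "1 \<le> i" "i \<le> j" for i j
    using that(2,1)
  proof (induction j rule: dec_induct)
    case (step j)
    then have "1 \<le> j" by simp
    from assms(7)[OF this] step show ?case by simp
  qed simp
  show "worst_case_error m s \<alpha> (\<lambda>u. \<Prod>j\<in>u. \<gamma> j) (\<lambda>j. Polynomial.monom 1 (w j) * g j)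
      \<le> scs_const b w s \<alpha> \<gamma> \<delta> * real N powr (- \<alpha> / 2 + \<delta>)"
    unfolding assms(1,3) using assms(2,5,6,10) \<gamma>_mono \<delta> by (intro scs_error_bound) auto
  show "\<exists>B. \<forall>s'\<ge>1. scs_const b w s' \<alpha> \<gamma> \<delta> \<le> B"
    if "summable (\<lambda>d. \<gamma> (Suc d) powr (1 / (\<alpha> - 2 * \<delta>)) * real b ^ w (Suc d))"
    using card_gt_1[where 'p = 'p] assms(1) \<delta> that by (intro scs_const_bounded) auto
qed

end
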